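(* Let $M$ be a Kähler–Poisson manifold with a star product with separation of variables $\ast$, let $\mathcal A=(C^\infty(M)[[\nu]],\ast)$, and let $E$ be a holomorphic Hermitian vector bundle of rank $d$ on $M$. Let $\{U_\alpha\}$ be an open cover of $M$ with a fixed holomorphic trivialization of $E$ over each $U_\alpha$, let $u_\alpha$ be the corresponding matrix of the Hermitian metric, $\tilde u_\alpha$ its pointwise inverse and $v_\alpha$ its inverse with respect to $\ast$. For $f_\alpha,g_\alpha\in C^\infty(\mathrm{End}(E^\ast|_{U_\alpha}))[[\nu]]\cong \mathrm{Mat}_d(C^\infty(U_\alpha)[[\nu]])$ set $$f_\alpha\ast_\alpha g_\alpha=\big((f_\alpha u_\alpha)\ast v_\alpha\ast(g_\alpha u_\alpha)\big)\tilde u_\alpha .$$ Then the local products $\ast_\alpha$ define a global star product on $C^\infty(\mathrm{End}(E^\ast))[[\nu]]$ associated to $\ast$: for global sections $f,g$ of $\mathrm{End}(E^\ast)$ (formal in $\nu$) with local representatives $f_\alpha,g_\alpha$, the local sections $f_\alpha\ast_\alpha g_\alpha$ agree on overlaps $U_\alpha\cap U_\beta$ as sections of $\mathrm{End}(E^\ast)$, and the resulting product on $C^\infty(\mathrm{End}(E^\ast))[[\nu]]$ is a star product associated to $\ast$.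
   Context: A Kähler–Poisson manifold is a complex manifold $M$ with a Poisson bracket whose Poisson tensor is of type $(1,1)$; in local holomorphic coordinates $\{f,g\}=i g^{\bar lk}\left(\frac{\partial f}{\partial z^k}\frac{\partial g}{\partial\bar z^l}-\frac{\partial g}{\partial z^k}\frac{\partial f}{\partial\bar z^l}\right)$. A star product on $M$ is an associative product $f\ast g=\sum_{r\ge0}\nu^rC_r(f,g)$ on $C^\infty(M)[[\nu]]$ ($\nu$-linear), with $C_r$ bidifferential operators, $C_0(f,g)=fg$, $C_1(f,g)-C_1(g,f)=i\{f,g\}$, for which the constant function $1$ is the unit. It restricts to open subsets. It is with separation of variables if $f\ast g=fg$ for local functions $f,g$ whenever $f$ is holomorphic or $g$ is antiholomorphic. For open $U\subset M$, $\ast$ also denotes the product of the matrix algebra $\mathrm{Mat}_d(C^\infty(U)[[\nu]])$ in which entries are multiplied by $\ast$ (this is $\mathrm{Mat}_d(\mathcal A(U))$, with $\mathcal A(U)$ the localization of $\mathcal A$ to $U$); juxtaposition of matrices denotes the pointwise matrix product. A pointwise invertible matrix in $\mathrm{Mat}_d(C^\infty(U))$ is also invertible for $\ast$. Trivializations: let $h$ be the Hermitian metric on $E$ (linear in the first, conjugate linear in the second argument) and $e_1,\dots,e_d$ the holomorphic frame of $E$ over $U_\alpha$ given by the trivialization. Then $u_\alpha=(h(e_i,e_j))_{ij}$. Sections of $E^\ast$ over $U_\alpha$ are identified with column vectors $(s(e_i))_i$ and sections of $\mathrm{End}(E^\ast)$ with $d\times d$ matrices acting on these. On overlaps $f_\alpha=a_{\alpha\beta}f_\beta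 a_{\alpha\beta}^{-1}$ and $u_\alpha=a_{\alpha\beta}u_\beta b_{\beta\alpha}$ with $a_{\alpha\beta}$ a holomorphic and $b_{\beta\alpha}$ an antiholomorphic matrix-valued function. A star product on $C^\infty(\mathrm{End}(F))[[\nu]]$, for a vector bundle $F$ of rank $d$, associated to a star product $\ast$ on $M$, is an associative product $f\star g=\sum_{r\ge0}\nu^rC_r(f,g)$ with $C_r$ bidifferential operators on $C^\infty(\mathrm{End}(F))$ and $C_0(f,g)=fg$ (pointwise composition), such that the resulting algebra is locally isomorphic to the matrix algebra $\mathrm{Mat}_d(\mathcal A)$ via isomorphisms given by formal differential operators. *)

theory Defs
  imports "HOL-Analysis.Analysis"
begin

section \<open>Smooth and holomorphic functions on open subsets of complex coordinate space\<close>

text \<open>The notions below are only used for open sets \<open>S\<close>. Derivatives are real derivatives;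
  since the domain is finite-dimensional, \<open>Ck_on n S f\<close> says that \<open>f\<close> is of class \<open>C^n\<close> on \<open>S\<close>.\<close>

primrec Ck_on :: "nat \<Rightarrow> 'a::real_normed_vector set \<Rightarrow> ('a \<Rightarrow> 'b::real_normed_vector) \<Rightarrow> bool" where
  "Ck_on 0 S f \<longleftrightarrow> continuous_on S f"
| "Ck_on (Suc n) S f \<longleftrightarrow> (\<forall>x\<in>S. f differentiable (at x)) \<and>
     (\<forall>v. Ck_on n S (\<lambda>x. frechet_derivative f (at x) v))"

definition smooth_on :: "'a::real_normed_vector set \<Rightarrow> ('a \<Rightarrow> 'b::real_normed_vector) \<Rightarrow> bool" where
  "smooth_on S f \<longleftrightarrow> (\<forall>n. Ck_on n S f)"

text \<open>The Wirtinger derivatives: \<open>Inl k\<close> stands for \<open>\<partial>/\<partial>z^k\<close> and \<open>Inr k\<close> for the derivative with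
  respect to the conjugate coordinate of \<open>z^k\<close>.\<close>

definition wirtinger :: "'n::finite + 'n \<Rightarrow> (complex^'n \<Rightarrow> complex) \<Rightarrow> complex^'n \<Rightarrow> complex" where
  "wirtinger w f z = (let D = frechet_derivative f (at z) in
     case w of
       Inl k \<Rightarrow> (D (axis k 1) - \<i> * D (axis k \<i>)) / 2
     | Inr k \<Rightarrow> (D (axis k 1) + \<i> * D (axis k \<i>)) / 2)"


section \<open>Complex manifolds\<close>

text \<open>The manifold is the whole type \<open>'m\<close> (Hausdorff and second countable), together with a
  holomorphic atlas. A chart is a pair of a domain and a coordinate map; the values of the
  coordinate map outside the domain are irrelevant.\<close>

type_synonym ('m, 'n) chart = "'m set \<times> ('m \<Rightarrow> complex^'n)"

definition in_chart :: "('m, 'n::finite) chart \<Rightarrow> ('m \<Rightarrow> 'b) \<Rightarrow> complex^'n \<Rightarrow> 'b" where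
  "in_chart c f = (\<lambda>z. f (inv_into (fst c) (snd c) z))"

definition complex_atlas ::
  "('m::{t2_space, second_countable_topology}, 'n::finite) chart set \<Rightarrow> bool" where
  "complex_atlas A \<longleftrightarrow>
     (\<forall>c\<in>A. open (fst c) \<and> open (snd c ` fst c) \<and>
        homeomorphism (fst c) (snd c ` fst c) (snd c) (inv_into (fst c) (snd c))) \<and>
     (\<Union>c\<in>A. fst c) = UNIV \<and>
     (\<forall>c\<in>A. \<forall>c'\<in>A. \<forall>i.
        let S = snd c ` (fst c \<inter> fst c'); F = in_chart c (\<lambda>x. snd c' x $ i) in
          smooth_on S F \<and> (\<forall>z\<in>S. \<forall>l. wirtinger (Inr l) F z = 0))"

text \<open>Functions on an open subset \<open>V\<close> of the manifold are total functions of which only the values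
  on \<open>V\<close> matter.\<close>

definition smooth_fun ::
  "('m::topological_space, 'n::finite) chart set \<Rightarrow> 'm set \<Rightarrow> ('m \<Rightarrow> 'b::real_normed_vector) \<Rightarrow> bool" where
  "smooth_fun A V f \<longleftrightarrow> (\<forall>c\<in>A. smooth_on (snd c ` (V \<inter> fst c)) (in_chart c f))"

definition chart_deriv ::
  "('m, 'n::finite) chart \<Rightarrow> 'n + 'n \<Rightarrow> ('m \<Rightarrow> complex) \<Rightarrow> 'm \<Rightarrow> complex" where
  "chart_deriv c w f x = wirtinger w (in_chart c f) (snd c x)"

primrec chart_derivs ::
  "('m, 'n::finite) chart \<Rightarrow> ('n + 'n) list \<Rightarrow> ('m \<Rightarrow> complex) \<Rightarrow> 'm \<Rightarrow> complex" where
  "chart_derivs c [] f = f"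
| "chart_derivs c (w # ws) f = chart_deriv c w (chart_derivs c ws f)"

definition holomorphic_fun ::
  "('m::topological_space, 'n::finite) chart set \<Rightarrow> 'm set \<Rightarrow> ('m \<Rightarrow> complex) \<Rightarrow> bool" where
  "holomorphic_fun A V f \<longleftrightarrow> smooth_fun A V f \<and>
     (\<forall>c\<in>A. \<forall>x\<in>V \<inter> fst c. \<forall>l. chart_deriv c (Inr l) f x = 0)"

definition antiholomorphic_fun ::
  "('m::topological_space, 'n::finite) chart set \<Rightarrow> 'm set \<Rightarrow> ('m \<Rightarrow> complex) \<Rightarrow> bool" where
  "antiholomorphic_fun A V f \<longleftrightarrow> smooth_fun A V f \<and>
     (\<forall>c\<in>A. \<forall>x\<in>V \<inter> fst c. \<forall>k. chart_deriv c (Inl k) f x = 0)"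


section \<open>Kaehler-Poisson manifolds\<close>

definition poisson_bracket ::
  "('m::topological_space, 'n::finite) chart set \<Rightarrow>
   (('m \<Rightarrow> complex) \<Rightarrow> ('m \<Rightarrow> complex) \<Rightarrow> 'm \<Rightarrow> complex) \<Rightarrow> bool" where
  "poisson_bracket A br \<longleftrightarrow>
     (\<forall>f g h a b. smooth_fun A UNIV f \<longrightarrow> smooth_fun A UNIV g \<longrightarrow> smooth_fun A UNIV h \<longrightarrow>
        smooth_fun A UNIV (br f g) \<and>
        (\<forall>x. br (\<lambda>y. a * f y + b * g y) h x = a * br f h x + b * br g h x) \<and>
        (\<forall>x. br f g x = - br g f x) \<and>
        (\<forall>x. br f (\<lambda>y. g y * h y) x = br f g x * h x + g x * br f h x) \<and>
        (\<forall>x. br f (br g h) x + br g (br h f) x + br h (br f g) x = 0) \<and>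
        ((\<forall>x. f x \<in> \<real>) \<longrightarrow> (\<forall>x. g x \<in> \<real>) \<longrightarrow> (\<forall>x. br f g x \<in> \<real>)))"

text \<open>A bracket or a (bi)differential operator on the manifold is an operator on total functions.
  Its value at \<open>x\<close> is prescribed, by its expression in local coordinates, for all functions that are
  smooth on some open set containing \<open>x\<close>. In this way such an operator acts on functions on every
  open subset, and this action is the restriction of the one on global functions.\<close>

definition kaehler_poisson ::
  "('m::{t2_space, second_countable_topology}, 'n::finite) chart set \<Rightarrow>
   (('m \<Rightarrow> complex) \<Rightarrow> ('m \<Rightarrow> complex) \<Rightarrow> 'm \<Rightarrow> complex) \<Rightarrow> bool" where
  "kaehler_poisson A br \<longleftrightarrow> complex_atlas A \<and> poisson_bracket A br \<and>
     (\<forall>c\<in>A. \<exists>G :: 'n \<Rightarrow> 'n \<Rightarrow> 'm \<Rightarrow> complex.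
        (\<forall>l k. smooth_fun A (fst c) (G l k)) \<and>
        (\<forall>V f g. open V \<longrightarrow> smooth_fun A V f \<longrightarrow> smooth_fun A V g \<longrightarrow>
          (\<forall>x\<in>V \<inter> fst c. br f g x = \<i> * (\<Sum>k\<in>UNIV. \<Sum>l\<in>UNIV. G l k x *
             (chart_deriv c (Inl k) f x * chart_deriv c (Inr l) g x -
              chart_deriv c (Inl k) g x * chart_deriv c (Inr l) f x)))))"


section \<open>Star products on functions\<close>

text \<open>Bidifferential operators of finite order; the sum runs over words in the derivatives of length
  at most \<open>k\<close> (distinct words may denote the same partial derivative).\<close>

definition bidiff_op ::
  "('m::topological_space, 'n::finite) chart set \<Rightarrow>
   (('m \<Rightarrow> complex) \<Rightarrow> ('m \<Rightarrow> complex) \<Rightarrow> 'm \<Rightarrow> complex) \<Rightarrow> bool" where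
  "bidiff_op A C \<longleftrightarrow> (\<exists>k. \<forall>c\<in>A. \<exists>a :: ('n + 'n) list \<Rightarrow> ('n + 'n) list \<Rightarrow> 'm \<Rightarrow> complex.
     (\<forall>I J. smooth_fun A (fst c) (a I J)) \<and>
     (\<forall>V f g. open V \<longrightarrow> smooth_fun A V f \<longrightarrow> smooth_fun A V g \<longrightarrow>
       (\<forall>x\<in>V \<inter> fst c. C f g x =
          (\<Sum>I | length I \<le> k. \<Sum>J | length J \<le> k.
             a I J x * chart_derivs c I f x * chart_derivs c J g x))))"

text \<open>The formal series \<open>\<Sum>r. \<nu>^r f_r\<close> is the sequence \<open>f\<close> of its coefficients.\<close>

definition formal_smooth ::
  "('m::topological_space, 'n::finite) chart set \<Rightarrow> 'm set \<Rightarrow>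
   (nat \<Rightarrow> 'm \<Rightarrow> 'b::real_normed_vector) \<Rightarrow> bool" where
  "formal_smooth A V f \<longleftrightarrow> (\<forall>r. smooth_fun A V (f r))"

definition fconst :: "('m \<Rightarrow> 'b::zero) \<Rightarrow> nat \<Rightarrow> 'm \<Rightarrow> 'b" where
  "fconst u = (\<lambda>r x. if r = 0 then u x else 0)"

definition star ::
  "(nat \<Rightarrow> ('m \<Rightarrow> complex) \<Rightarrow> ('m \<Rightarrow> complex) \<Rightarrow> 'm \<Rightarrow> complex) \<Rightarrow>
   (nat \<Rightarrow> 'm \<Rightarrow> complex) \<Rightarrow> (nat \<Rightarrow> 'm \<Rightarrow> complex) \<Rightarrow> nat \<Rightarrow> 'm \<Rightarrow> complex" where
  "star C f g = (\<lambda>n x. \<Sum>r\<le>n. \<Sum>i\<le>n - r. C r (f i) (g (n - r - i)) x)"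

definition star_product ::
  "('m::topological_space, 'n::finite) chart set \<Rightarrow>
   (('m \<Rightarrow> complex) \<Rightarrow> ('m \<Rightarrow> complex) \<Rightarrow> 'm \<Rightarrow> complex) \<Rightarrow>
   (nat \<Rightarrow> ('m \<Rightarrow> complex) \<Rightarrow> ('m \<Rightarrow> complex) \<Rightarrow> 'm \<Rightarrow> complex) \<Rightarrow> bool" where
  "star_product A br C \<longleftrightarrow>
     (\<forall>r. bidiff_op A (C r)) \<and>
     (\<forall>f g. smooth_fun A UNIV f \<longrightarrow> smooth_fun A UNIV g \<longrightarrow>
        (\<forall>x. C 0 f g x = f x * g x) \<and>
        (\<forall>x. C 1 f g x - C 1 g f x = \<i> * br f g x)) \<and>
     (\<forall>f g h. formal_smooth A UNIV f \<longrightarrow> formal_smooth A UNIV g \<longrightarrow> formal_smooth A UNIV h \<longrightarrow>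
        (\<forall>n x. star C (star C f g) h n x = star C f (star C g h) n x)) \<and>
     (\<forall>f. formal_smooth A UNIV f \<longrightarrow>
        (\<forall>n x. star C (fconst (\<lambda>_. 1)) f n x = f n x \<and> star C f (fconst (\<lambda>_. 1)) n x = f n x))"

definition separation_of_variables ::
  "('m::topological_space, 'n::finite) chart set \<Rightarrow>
   (nat \<Rightarrow> ('m \<Rightarrow> complex) \<Rightarrow> ('m \<Rightarrow> complex) \<Rightarrow> 'm \<Rightarrow> complex) \<Rightarrow> bool" where
  "separation_of_variables A C \<longleftrightarrow>
     (\<forall>V f g. open V \<longrightarrow> smooth_fun A V f \<longrightarrow> smooth_fun A V g \<longrightarrow>
        holomorphic_fun A V f \<or> antiholomorphic_fun A V g \<longrightarrow>
        (\<forall>n. \<forall>x\<in>V. star C (fconst f) (fconst g) n x = fconst (\<lambda>y. f y * g y) n x))"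

definition mstar ::
  "(nat \<Rightarrow> ('m \<Rightarrow> complex) \<Rightarrow> ('m \<Rightarrow> complex) \<Rightarrow> 'm \<Rightarrow> complex) \<Rightarrow>
   (nat \<Rightarrow> 'm \<Rightarrow> complex^'d::finite^'d) \<Rightarrow> (nat \<Rightarrow> 'm \<Rightarrow> complex^'d^'d) \<Rightarrow>
   nat \<Rightarrow> 'm \<Rightarrow> complex^'d^'d" where
  "mstar C F G = (\<lambda>n x. \<chi> i j. \<Sum>k\<in>UNIV.
     star C (\<lambda>r y. F r y $ i $ k) (\<lambda>r y. G r y $ k $ j) n x)"

definition star_inverse ::
  "('m::topological_space, 'n::finite) chart set \<Rightarrow>
   (nat \<Rightarrow> ('m \<Rightarrow> complex) \<Rightarrow> ('m \<Rightarrow> complex) \<Rightarrow> 'm \<Rightarrow> complex) \<Rightarrow> 'm set \<Rightarrow>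
   ('m \<Rightarrow> complex^'d::finite^'d) \<Rightarrow> (nat \<Rightarrow> 'm \<Rightarrow> complex^'d^'d) \<Rightarrow> bool" where
  "star_inverse A C V u v \<longleftrightarrow> formal_smooth A V v \<and>
     (\<forall>n. \<forall>x\<in>V. mstar C (fconst u) v n x = fconst (\<lambda>_. mat 1) n x \<and>
               mstar C v (fconst u) n x = fconst (\<lambda>_. mat 1) n x)"

definition local_product ::
  "(nat \<Rightarrow> ('m \<Rightarrow> complex) \<Rightarrow> ('m \<Rightarrow> complex) \<Rightarrow> 'm \<Rightarrow> complex) \<Rightarrow>
   ('m \<Rightarrow> complex^'d::finite^'d) \<Rightarrow> (nat \<Rightarrow> 'm \<Rightarrow> complex^'d^'d) \<Rightarrow>
   (nat \<Rightarrow> 'm \<Rightarrow> complex^'d^'d) \<Rightarrow> (nat \<Rightarrow> 'm \<Rightarrow> complex^'d^'d) \<Rightarrow>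
   nat \<Rightarrow> 'm \<Rightarrow> complex^'d^'d" where
  "local_product C u v F G = (\<lambda>n x.
     mstar C (mstar C (\<lambda>r y. F r y ** u y) v) (\<lambda>r y. G r y ** u y) n x ** matrix_inv (u x))"


section \<open>Holomorphic Hermitian vector bundles\<close>

text \<open>The total space is the type \<open>'e\<close>; addition and scaling only matter within one fibre.\<close>

record ('m, 'e) vbundle =
  bproj :: "'e \<Rightarrow> 'm"
  badd :: "'e \<Rightarrow> 'e \<Rightarrow> 'e"
  bscale :: "complex \<Rightarrow> 'e \<Rightarrow> 'e"

definition fibre :: "('m, 'e) vbundle \<Rightarrow> 'm \<Rightarrow> 'e set" where
  "fibre E x = {e. bproj E e = x}"

text \<open>\<open>\<psi>\<close> is the fibre component of the trivialization; being linear and bijective on fibres, it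
  transports the vector space laws from coordinate space to the fibres.\<close>

definition trivialization ::
  "('m, 'e) vbundle \<Rightarrow> 'm set \<Rightarrow> ('e \<Rightarrow> complex^'d::finite) \<Rightarrow> bool" where
  "trivialization E V \<psi> \<longleftrightarrow> (\<forall>x\<in>V. bij_betw \<psi> (fibre E x) UNIV \<and>
     (\<forall>e\<in>fibre E x. \<forall>e'\<in>fibre E x.
        badd E e e' \<in> fibre E x \<and> \<psi> (badd E e e') = \<psi> e + \<psi> e') \<and>
     (\<forall>a. \<forall>e\<in>fibre E x. bscale E a e \<in> fibre E x \<and> \<psi> (bscale E a e) = a *s \<psi> e))"

definition frame ::
  "('m, 'e) vbundle \<Rightarrow> ('e \<Rightarrow> complex^'d::finite) \<Rightarrow> 'm \<Rightarrow> 'd \<Rightarrow> 'e" where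
  "frame E \<psi> x i = inv_into (fibre E x) \<psi> (axis i 1)"

text \<open>The matrix \<open>\<psi> \<beta> (frame E (\<psi> \<alpha>) x i) $ j\<close> is the transition matrix
  \<open>a_{\<alpha>\<beta>}\<close>, for which \<open>e^\<alpha>_i = \<Sum>j. a_ij e^\<beta>_j\<close>. The topology and the complex structure of the total
  space are those for which the given trivializations are biholomorphic.\<close>

definition holomorphic_bundle ::
  "('m::topological_space, 'n::finite) chart set \<Rightarrow> ('m, 'e) vbundle \<Rightarrow>
   ('i \<Rightarrow> 'm set) \<Rightarrow> ('i \<Rightarrow> 'e \<Rightarrow> complex^'d::finite) \<Rightarrow> bool" where
  "holomorphic_bundle A E U \<psi> \<longleftrightarrow>
     (\<forall>\<alpha>. open (U \<alpha>) \<and> trivialization E (U \<alpha>) (\<psi> \<alpha>)) \<and>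
     (\<Union>\<alpha>. U \<alpha>) = UNIV \<and>
     (\<forall>\<alpha> \<beta> i j. holomorphic_fun A (U \<alpha> \<inter> U \<beta>) (\<lambda>x. \<psi> \<beta> (frame E (\<psi> \<alpha>) x i) $ j))"

definition gram ::
  "('m, 'e) vbundle \<Rightarrow> ('e \<Rightarrow> 'e \<Rightarrow> complex) \<Rightarrow> ('e \<Rightarrow> complex^'d::finite) \<Rightarrow>
   'm \<Rightarrow> complex^'d^'d" where
  "gram E h \<psi> x = (\<chi> i j. h (frame E \<psi> x i) (frame E \<psi> x j))"

definition hermitian_metric ::
  "('m::topological_space, 'n::finite) chart set \<Rightarrow> ('m, 'e) vbundle \<Rightarrow>
   ('i \<Rightarrow> 'm set) \<Rightarrow> ('i \<Rightarrow> 'e \<Rightarrow> complex^'d::finite) \<Rightarrow> ('e \<Rightarrow> 'e \<Rightarrow> complex) \<Rightarrow> bool" where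
  "hermitian_metric A E U \<psi> h \<longleftrightarrow>
     (\<forall>x. \<forall>e\<in>fibre E x. \<forall>e'\<in>fibre E x.
        (\<forall>e''\<in>fibre E x. h (badd E e e') e'' = h e e'' + h e' e'') \<and>
        (\<forall>a. h (bscale E a e) e' = a * h e e') \<and>
        h e' e = cnj (h e e') \<and>
        (e \<noteq> bscale E 0 e \<longrightarrow> Re (h e e) > 0)) \<and>
     (\<forall>\<alpha>. smooth_fun A (U \<alpha>) (gram E h (\<psi> \<alpha>)))"


section \<open>Sections of the endomorphism bundle of the dual bundle\<close>

text \<open>Linear functionals on a fibre are extended by \<open>0\<close> to the total space, and endomorphisms of the
  dual of a fibre are extended by \<open>0\<close> to all functions on the total space; so equality of functions
  is equality of functionals and of endomorphisms, respectively.\<close>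

definition dual_fibre :: "('m, 'e) vbundle \<Rightarrow> 'm \<Rightarrow> ('e \<Rightarrow> complex) set" where
  "dual_fibre E x = {s.
     (\<forall>e\<in>fibre E x. \<forall>e'\<in>fibre E x. s (badd E e e') = s e + s e') \<and>
     (\<forall>a. \<forall>e\<in>fibre E x. s (bscale E a e) = a * s e) \<and>
     (\<forall>e. e \<notin> fibre E x \<longrightarrow> s e = 0)}"

type_synonym 'e dual_endo = "('e \<Rightarrow> complex) \<Rightarrow> 'e \<Rightarrow> complex"

definition dual_endos :: "('m, 'e) vbundle \<Rightarrow> 'm \<Rightarrow> 'e dual_endo set" where
  "dual_endos E x = {T.
     (\<forall>s\<in>dual_fibre E x. T s \<in> dual_fibre E x) \<and>
     (\<forall>s\<in>dual_fibre E x. \<forall>t\<in>dual_fibre E x. T (\<lambda>e. s e + t e) = (\<lambda>e. T s e + T t e)) \<and>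
     (\<forall>a. \<forall>s\<in>dual_fibre E x. T (\<lambda>e. a * s e) = (\<lambda>e. a * T s e)) \<and>
     (\<forall>s. s \<notin> dual_fibre E x \<longrightarrow> T s = (\<lambda>e. 0))}"

text \<open>The matrix of an endomorphism acts on the column vectors \<open>(s (e_i))_i\<close>; its \<open>j\<close>-th column
  comes from the \<open>j\<close>-th element of the frame dual to \<open>(e_i)_i\<close>.\<close>

definition endo_matrix ::
  "('m, 'e) vbundle \<Rightarrow> ('e \<Rightarrow> complex^'d::finite) \<Rightarrow> 'm \<Rightarrow> 'e dual_endo \<Rightarrow> complex^'d^'d" where
  "endo_matrix E \<psi> x T =
     (\<chi> i j. T (\<lambda>e. if e \<in> fibre E x then \<psi> e $ j else 0) (frame E \<psi> x i))"

definition matrix_endo ::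
  "('m, 'e) vbundle \<Rightarrow> ('e \<Rightarrow> complex^'d::finite) \<Rightarrow> 'm \<Rightarrow> complex^'d^'d \<Rightarrow> 'e dual_endo" where
  "matrix_endo E \<psi> x M = (\<lambda>s e. if s \<in> dual_fibre E x \<and> e \<in> fibre E x
     then \<Sum>i\<in>UNIV. \<psi> e $ i * (M *v (\<chi> j. s (frame E \<psi> x j))) $ i else 0)"

definition smooth_section ::
  "('m::topological_space, 'n::finite) chart set \<Rightarrow> ('m, 'e) vbundle \<Rightarrow>
   ('i \<Rightarrow> 'm set) \<Rightarrow> ('i \<Rightarrow> 'e \<Rightarrow> complex^'d::finite) \<Rightarrow> 'm set \<Rightarrow> ('m \<Rightarrow> 'e dual_endo) \<Rightarrow> bool" where
  "smooth_section A E U \<psi> V F \<longleftrightarrow> (\<forall>x\<in>V. F x \<in> dual_endos E x) \<and>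
     (\<forall>\<alpha>. smooth_fun A (V \<inter> U \<alpha>) (\<lambda>x. endo_matrix E (\<psi> \<alpha>) x (F x)))"

definition formal_section ::
  "('m::topological_space, 'n::finite) chart set \<Rightarrow> ('m, 'e) vbundle \<Rightarrow>
   ('i \<Rightarrow> 'm set) \<Rightarrow> ('i \<Rightarrow> 'e \<Rightarrow> complex^'d::finite) \<Rightarrow> 'm set \<Rightarrow>
   (nat \<Rightarrow> 'm \<Rightarrow> 'e dual_endo) \<Rightarrow> bool" where
  "formal_section A E U \<psi> V f \<longleftrightarrow> (\<forall>r. smooth_section A E U \<psi> V (f r))"

definition local_rep ::
  "('m, 'e) vbundle \<Rightarrow> ('e \<Rightarrow> complex^'d::finite) \<Rightarrow> (nat \<Rightarrow> 'm \<Rightarrow> 'e dual_endo) \<Rightarrow>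
   nat \<Rightarrow> 'm \<Rightarrow> complex^'d^'d" where
  "local_rep E \<psi> f = (\<lambda>r x. endo_matrix E \<psi> x (f r x))"


section \<open>Differential operators and star products on endomorphism sections\<close>

definition section_bidiff_op ::
  "('m::topological_space, 'n::finite) chart set \<Rightarrow> ('m, 'e) vbundle \<Rightarrow>
   ('i \<Rightarrow> 'm set) \<Rightarrow> ('i \<Rightarrow> 'e \<Rightarrow> complex^'d::finite) \<Rightarrow>
   (('m \<Rightarrow> 'e dual_endo) \<Rightarrow> ('m \<Rightarrow> 'e dual_endo) \<Rightarrow> 'm \<Rightarrow> 'e dual_endo) \<Rightarrow> bool" where
  "section_bidiff_op A E U \<psi> B \<longleftrightarrow>
     (\<forall>V F G. open V \<longrightarrow> smooth_section A E U \<psi> V F \<longrightarrow> smooth_section A E U \<psi> V G \<longrightarrow>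
        (\<forall>x\<in>V. B F G x \<in> dual_endos E x)) \<and>
     (\<exists>k. \<forall>\<alpha>. \<forall>c\<in>A. \<exists>a :: ('n + 'n) list \<Rightarrow> ('n + 'n) list \<Rightarrow>
          'd \<Rightarrow> 'd \<Rightarrow> 'd \<Rightarrow> 'd \<Rightarrow> 'd \<Rightarrow> 'd \<Rightarrow> 'm \<Rightarrow> complex.
        (\<forall>I J p q p' q' i j. smooth_fun A (U \<alpha> \<inter> fst c) (a I J p q p' q' i j)) \<and>
        (\<forall>V F G. open V \<longrightarrow> smooth_section A E U \<psi> V F \<longrightarrow> smooth_section A E U \<psi> V G \<longrightarrow>
          (\<forall>x\<in>V \<inter> U \<alpha> \<inter> fst c. \<forall>i j.
             endo_matrix E (\<psi> \<alpha>) x (B F G x) $ i $ j =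
               (\<Sum>I | length I \<le> k. \<Sum>J | length J \<le> k.
                \<Sum>p\<in>UNIV. \<Sum>q\<in>UNIV. \<Sum>p'\<in>UNIV. \<Sum>q'\<in>UNIV.
                  a I J p q p' q' i j x *
                  chart_derivs c I (\<lambda>y. endo_matrix E (\<psi> \<alpha>) y (F y) $ p $ q) x *
                  chart_derivs c J (\<lambda>y. endo_matrix E (\<psi> \<alpha>) y (G y) $ p' $ q') x))))"

text \<open>Differential operators over the open set \<open>W\<close> from endomorphism sections to matrices of
  functions, and in the opposite direction.\<close>

definition section_to_matrix_diff_op ::
  "('m::topological_space, 'n::finite) chart set \<Rightarrow> ('m, 'e) vbundle \<Rightarrow>
   ('i \<Rightarrow> 'm set) \<Rightarrow> ('i \<Rightarrow> 'e \<Rightarrow> complex^'d::finite) \<Rightarrow> 'm set \<Rightarrow>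
   (('m \<Rightarrow> 'e dual_endo) \<Rightarrow> 'm \<Rightarrow> complex^'d^'d) \<Rightarrow> bool" where
  "section_to_matrix_diff_op A E U \<psi> W T \<longleftrightarrow>
     (\<exists>k. \<forall>\<alpha>. \<forall>c\<in>A. \<exists>a :: ('n + 'n) list \<Rightarrow> 'd \<Rightarrow> 'd \<Rightarrow> 'd \<Rightarrow> 'd \<Rightarrow> 'm \<Rightarrow> complex.
        (\<forall>I p q i j. smooth_fun A (W \<inter> U \<alpha> \<inter> fst c) (a I p q i j)) \<and>
        (\<forall>V F. open V \<longrightarrow> V \<subseteq> W \<longrightarrow> smooth_section A E U \<psi> V F \<longrightarrow>
          (\<forall>x\<in>V \<inter> U \<alpha> \<inter> fst c. \<forall>i j. T F x $ i $ j =
             (\<Sum>I | length I \<le> k. \<Sum>p\<in>UNIV. \<Sum>q\<in>UNIV. a I p q i j x *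
                chart_derivs c I (\<lambda>y. endo_matrix E (\<psi> \<alpha>) y (F y) $ p $ q) x))))"

definition matrix_to_section_diff_op ::
  "('m::topological_space, 'n::finite) chart set \<Rightarrow> ('m, 'e) vbundle \<Rightarrow>
   ('i \<Rightarrow> 'm set) \<Rightarrow> ('i \<Rightarrow> 'e \<Rightarrow> complex^'d::finite) \<Rightarrow> 'm set \<Rightarrow>
   (('m \<Rightarrow> complex^'d^'d) \<Rightarrow> 'm \<Rightarrow> 'e dual_endo) \<Rightarrow> bool" where
  "matrix_to_section_diff_op A E U \<psi> W S \<longleftrightarrow>
     (\<forall>V F. open V \<longrightarrow> V \<subseteq> W \<longrightarrow> smooth_fun A V F \<longrightarrow> (\<forall>x\<in>V. S F x \<in> dual_endos E x)) \<and>
     (\<exists>k. \<forall>\<alpha>. \<forall>c\<in>A. \<exists>a :: ('n + 'n) list \<Rightarrow> 'd \<Rightarrow> 'd \<Rightarrow> 'd \<Rightarrow> 'd \<Rightarrow> 'm \<Rightarrow> complex.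
        (\<forall>I p q i j. smooth_fun A (W \<inter> U \<alpha> \<inter> fst c) (a I p q i j)) \<and>
        (\<forall>V F. open V \<longrightarrow> V \<subseteq> W \<longrightarrow> smooth_fun A V F \<longrightarrow>
          (\<forall>x\<in>V \<inter> U \<alpha> \<inter> fst c. \<forall>i j. endo_matrix E (\<psi> \<alpha>) x (S F x) $ i $ j =
             (\<Sum>I | length I \<le> k. \<Sum>p\<in>UNIV. \<Sum>q\<in>UNIV. a I p q i j x *
                chart_derivs c I (\<lambda>y. F y $ p $ q) x))))"

definition section_star ::
  "(nat \<Rightarrow> ('m \<Rightarrow> 'e dual_endo) \<Rightarrow> ('m \<Rightarrow> 'e dual_endo) \<Rightarrow> 'm \<Rightarrow> 'e dual_endo) \<Rightarrow>
   (nat \<Rightarrow> 'm \<Rightarrow> 'e dual_endo) \<Rightarrow> (nat \<Rightarrow> 'm \<Rightarrow> 'e dual_endo) \<Rightarrow> nat \<Rightarrow> 'm \<Rightarrow> 'e dual_endo" where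
  "section_star B f g = (\<lambda>n x s e. \<Sum>r\<le>n. \<Sum>i\<le>n - r. B r (f i) (g (n - r - i)) x s e)"

definition formal_to_matrix ::
  "(nat \<Rightarrow> ('m \<Rightarrow> 'e dual_endo) \<Rightarrow> 'm \<Rightarrow> complex^'d::finite^'d) \<Rightarrow>
   (nat \<Rightarrow> 'm \<Rightarrow> 'e dual_endo) \<Rightarrow> nat \<Rightarrow> 'm \<Rightarrow> complex^'d^'d" where
  "formal_to_matrix T f = (\<lambda>n x. \<Sum>r\<le>n. T r (f (n - r)) x)"

definition formal_to_section ::
  "(nat \<Rightarrow> ('m \<Rightarrow> complex^'d::finite^'d) \<Rightarrow> 'm \<Rightarrow> 'e dual_endo) \<Rightarrow>
   (nat \<Rightarrow> 'm \<Rightarrow> complex^'d^'d) \<Rightarrow> nat \<Rightarrow> 'm \<Rightarrow> 'e dual_endo" where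
  "formal_to_section S F = (\<lambda>n x s e. \<Sum>r\<le>n. S r (F (n - r)) x s e)"

text \<open>\<open>B\<close> is the sequence of coefficients of a star product on the endomorphism sections associated to
  the star product with coefficients \<open>C\<close>. The last conjunct is the local isomorphism with the
  matrix algebra, by mutually inverse formal differential operators \<open>T\<close> and \<open>S\<close>.\<close>

definition associated_star_product ::
  "('m::topological_space, 'n::finite) chart set \<Rightarrow>
   (nat \<Rightarrow> ('m \<Rightarrow> complex) \<Rightarrow> ('m \<Rightarrow> complex) \<Rightarrow> 'm \<Rightarrow> complex) \<Rightarrow> ('m, 'e) vbundle \<Rightarrow>
   ('i \<Rightarrow> 'm set) \<Rightarrow> ('i \<Rightarrow> 'e \<Rightarrow> complex^'d::finite) \<Rightarrow>
   (nat \<Rightarrow> ('m \<Rightarrow> 'e dual_endo) \<Rightarrow> ('m \<Rightarrow> 'e dual_endo) \<Rightarrow> 'm \<Rightarrow> 'e dual_endo) \<Rightarrow> bool" where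
  "associated_star_product A C E U \<psi> B \<longleftrightarrow>
     (\<forall>r. section_bidiff_op A E U \<psi> (B r)) \<and>
     (\<forall>F G. smooth_section A E U \<psi> UNIV F \<longrightarrow> smooth_section A E U \<psi> UNIV G \<longrightarrow>
        (\<forall>x. B 0 F G x = F x \<circ> G x)) \<and>
     (\<forall>f g h. formal_section A E U \<psi> UNIV f \<longrightarrow> formal_section A E U \<psi> UNIV g \<longrightarrow>
        formal_section A E U \<psi> UNIV h \<longrightarrow>
        (\<forall>n x. section_star B (section_star B f g) h n x =
               section_star B f (section_star B g h) n x)) \<and>
     (\<forall>x0. \<exists>W T S. open W \<and> x0 \<in> W \<and>
        (\<forall>r. section_to_matrix_diff_op A E U \<psi> W (T r)) \<and>
        (\<forall>r. matrix_to_section_diff_op A E U \<psi> W (S r)) \<and>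
        (\<forall>f. formal_section A E U \<psi> W f \<longrightarrow>
           (\<forall>n. \<forall>x\<in>W. formal_to_section S (formal_to_matrix T f) n x = f n x)) \<and>
        (\<forall>F. formal_smooth A W F \<longrightarrow>
           (\<forall>n. \<forall>x\<in>W. formal_to_matrix T (formal_to_section S F) n x = F n x)) \<and>
        (\<forall>f g. formal_section A E U \<psi> W f \<longrightarrow> formal_section A E U \<psi> W g \<longrightarrow>
           (\<forall>n. \<forall>x\<in>W. formal_to_matrix T (section_star B f g) n x =
              mstar C (formal_to_matrix T f) (formal_to_matrix T g) n x)))"

end

theory Submission
  imports Defs
begin

text \<open>Write \<open>u\<close>, \<open>v\<close> for the Gram matrix of one trivialization and its star inverse. The map
  \<open>f \<mapsto> (f u) * v\<close> carries \<open>*\<^sub>\<alpha>\<close> to the matrix product and has the inverse \<open>F \<mapsto> (F * u) u\<^sup>-\<^sup>1\<close>;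
  this gives associativity and the local isomorphism, both by formal differential operators.
  On an overlap \<open>u\<^sub>\<alpha> = a u\<^sub>\<beta> b\<close> with \<open>a\<close> holomorphic and \<open>b\<close> antiholomorphic, so by separation of
  variables the pointwise products with \<open>a\<close> on the left and \<open>b\<close> on the right are star products.
  Hence \<open>v\<^sub>\<beta> = b * v\<^sub>\<alpha> * a\<close> and \<open>f\<^sub>\<alpha> u\<^sub>\<alpha> = a * (f\<^sub>\<beta> u\<^sub>\<beta>) * b\<close>, and the factors \<open>b * v\<^sub>\<alpha> * a\<close> in the
  triple product recombine to \<open>v\<^sub>\<beta>\<close>. Since the axioms of the star product speak about global functions
  only, they are first carried to open subsets by multiplication with bump functions.\<close>

section \<open>Smooth functions\<close>

text \<open>Multiplying matrix entries by the star product does not glue by itself: representatives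
  change by \<open>a f a'\<close> with \<open>a'\<close> the holomorphic inverse of
  \<open>a\<close>, and separation of variables says nothing about a holomorphic factor on the
  right. Right multiplication by the Gram matrix replaces that factor by the antiholomorphic
  \<open>b\<close>, at the price that \<open>f u\<close> and \<open>g u\<close> can no longer be
  composed directly; the factor \<open>v\<close> between them has exactly the opposite
  transformation law. A second obstacle is the form of the claim. A star product is a sequence of
  operators on sections free of \<nu>, whereas the local formula is given for formal series. The
  operators are read off from series with a single coefficient, and bilinearity over \<nu> is needed
  to recover the formula. Each operator must also have one finite order valid in all charts and
  trivializations, so orders are bounded explicitly by sums of the orders of the \<open>C r\<close>,
  while the coefficients may depend on the chart.\<close>

lemma has_derivative_cong_open:
  assumes "open S" "x \<in> S" "\<And>y. y \<in> S \<Longrightarrow> f y = g y"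
  shows "(f has_derivative D) (at x) \<longleftrightarrow> (g has_derivative D) (at x)"
  using has_derivative_transform_within_open[OF _ assms(1,2)] assms(3) by fastforce

lemma frechet_derivative_cong_open:
  assumes "open S" "x \<in> S" "\<And>y. y \<in> S \<Longrightarrow> f y = g y"
  shows "frechet_derivative f (at x) = frechet_derivative g (at x)"
  by (simp add: frechet_derivative_def has_derivative_cong_open[OF assms])

lemma differentiable_cong_open:
  assumes "open S" "x \<in> S" "\<And>y. y \<in> S \<Longrightarrow> f y = g y"
  shows "f differentiable (at x) \<longleftrightarrow> g differentiable (at x)"
  by (simp add: differentiable_def has_derivative_cong_open[OF assms])

text \<open>Derivatives are taken at points of the ambient space, not within \<open>S\<close>;
  openness of \<open>S\<close> makes them depend on the values on \<open>S\<close> alone.\<close>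

lemma Ck_on_cong:
  assumes "open S" "\<And>x. x \<in> S \<Longrightarrow> f x = g x"
  shows "Ck_on n S f \<longleftrightarrow> Ck_on n S g"
  using assms(2)
proof (induction n arbitrary: f g)
  case 0
  then show ?case using continuous_on_cong[OF refl, of S f g] by simp
next
  case (Suc n)
  have "Ck_on n S (\<lambda>x. frechet_derivative f (at x) v) \<longleftrightarrow>
      Ck_on n S (\<lambda>x. frechet_derivative g (at x) v)" for v
    by (rule Suc.IH) (simp add: frechet_derivative_cong_open[OF assms(1) _ Suc.prems])
  moreover have "f differentiable (at x) \<longleftrightarrow> g differentiable (at x)" if "x \<in> S" for x
    by (rule differentiable_cong_open[OF assms(1) that Suc.prems])
  ultimately show ?case by simp
qed

text \<open>Lets an explicit derivative formula replace the choice hidden in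
  \<open>frechet_derivative\<close>, so that the closure properties below become inductions over
  differentiation rules.\<close>

lemma Ck_on_SucI:
  assumes "open S" "\<And>x. x \<in> S \<Longrightarrow> (f has_derivative D x) (at x)"
    and "\<And>v. Ck_on n S (\<lambda>x. D x v)"
  shows "Ck_on (Suc n) S f"
proof -
  have "frechet_derivative f (at x) v = D x v" if "x \<in> S" for x v
    using frechet_derivative_at[OF assms(2)[OF that]] by simp
  then have "Ck_on n S (\<lambda>x. frechet_derivative f (at x) v) \<longleftrightarrow> Ck_on n S (\<lambda>x. D x v)" for v
    by (intro Ck_on_cong assms(1)) auto
  with assms show ?thesis by (auto simp: differentiable_def)
qed

lemma Ck_on_SucD:
  assumes "Ck_on (Suc n) S f"
  shows "x \<in> S \<Longrightarrow> (f has_derivative frechet_derivative f (at x)) (at x)"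
    and "Ck_on n S (\<lambda>x. frechet_derivative f (at x) v)"
  using assms by (auto simp: frechet_derivative_works)

lemma Ck_on_Suc_imp: "Ck_on (Suc n) S f \<Longrightarrow> Ck_on n S f"
proof (induction n arbitrary: f)
  case 0
  then show ?case
    by (auto intro!: differentiable_imp_continuous_on
        simp: differentiable_on_def differentiable_at_withinI)
next
  case (Suc n)
  have "Ck_on n S (\<lambda>x. frechet_derivative f (at x) v)" for v
    by (rule Suc.IH) (use Suc.prems in \<open>simp only: Ck_on.simps(2)[of "Suc n"]\<close>)
  with Suc.prems show ?case by simp
qed

lemma Ck_on_subset: "Ck_on n S f \<Longrightarrow> T \<subseteq> S \<Longrightarrow> Ck_on n T f"
  by (induction n arbitrary: f) (auto intro: continuous_on_subset)

lemma Ck_on_local: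
  assumes "\<And>x. x \<in> S \<Longrightarrow> \<exists>T. open T \<and> x \<in> T \<and> Ck_on n T f"
  shows "Ck_on n S f"
  using assms
proof (induction n arbitrary: f)
  case 0
  then have "isCont f x" if "x \<in> S" for x
    using 0[OF that] by (auto simp: continuous_on_eq_continuous_at)
  then show ?case by (simp add: continuous_at_imp_continuous_on)
next
  case (Suc n)
  have "f differentiable (at x)" if "x \<in> S" for x
    using Suc.prems[OF that] by auto
  moreover have "Ck_on n S (\<lambda>x. frechet_derivative f (at x) v)" for v
  proof (rule Suc.IH)
    fix x assume "x \<in> S"
    from Suc.prems[OF this]
    show "\<exists>T. open T \<and> x \<in> T \<and> Ck_on n T (\<lambda>x. frechet_derivative f (at x) v)" by auto
  qed
  ultimately show ?case by simp
qed

lemma Ck_on_const: "open S \<Longrightarrow> Ck_on n S (\<lambda>x. a)"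
proof (induction n arbitrary: a)
  case (Suc n)
  show ?case by (rule Ck_on_SucI[where D = "\<lambda>x v. 0"]) (use Suc in auto)
qed simp

lemma Ck_on_bounded_linear:
  assumes "bounded_linear L" "open S"
  shows "Ck_on n S f \<Longrightarrow> Ck_on n S (\<lambda>x. L (f x))"
proof (induction n arbitrary: f)
  case 0
  then show ?case using bounded_linear.continuous_on[OF assms(1)] by auto
next
  case (Suc n)
  show ?case
  proof (rule Ck_on_SucI[where D = "\<lambda>x v. L (frechet_derivative f (at x) v)"])
    show "((\<lambda>x. L (f x)) has_derivative (\<lambda>v. L (frechet_derivative f (at x) v))) (at x)"
      if "x \<in> S" for x
      using bounded_linear.has_derivative[OF assms(1) Ck_on_SucD(1)[OF Suc.prems that]] .
  qed (use assms Suc in auto)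
qed

lemma Ck_on_add: "open S \<Longrightarrow> Ck_on n S f \<Longrightarrow> Ck_on n S g \<Longrightarrow> Ck_on n S (\<lambda>x. f x + g x)"
proof (induction n arbitrary: f g)
  case (Suc n)
  show ?case
    by (rule Ck_on_SucI[where
          D = "\<lambda>x v. frechet_derivative f (at x) v + frechet_derivative g (at x) v"])
      (use Suc in \<open>auto intro!: has_derivative_add simp flip: frechet_derivative_works\<close>)
qed (auto intro: continuous_on_add)

lemma (in bounded_bilinear) Ck_on:
  assumes "open S"
  shows "Ck_on n S f \<Longrightarrow> Ck_on n S g \<Longrightarrow> Ck_on n S (\<lambda>x. prod (f x) (g x))"
proof (induction n arbitrary: f g)
  case 0
  then show ?case by (auto intro: continuous_on)
next
  case (Suc n)
  show ?case
  proof (rule Ck_on_SucI[where D = "\<lambda>x v. prod (f x) (frechet_derivative g (at x) v)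
      + prod (frechet_derivative f (at x) v) (g x)"])
    show "((\<lambda>x. prod (f x) (g x)) has_derivative (\<lambda>v. prod (f x) (frechet_derivative g (at x) v)
      + prod (frechet_derivative f (at x) v) (g x))) (at x)" if "x \<in> S" for x
      using FDERIV[OF Ck_on_SucD(1)[OF Suc.prems(1) that] Ck_on_SucD(1)[OF Suc.prems(2) that]] .
    show "Ck_on n S (\<lambda>x. prod (f x) (frechet_derivative g (at x) v)
      + prod (frechet_derivative f (at x) v) (g x))" for v
      using Ck_on_SucD(2)[OF Suc.prems(1)] Ck_on_SucD(2)[OF Suc.prems(2)]
        Ck_on_Suc_imp[OF Suc.prems(1)] Ck_on_Suc_imp[OF Suc.prems(2)]
      by (intro Ck_on_add Suc.IH assms)
  qed (fact assms)
qed

lemma Ck_on_sum: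
  "open S \<Longrightarrow> (\<And>i. i \<in> I \<Longrightarrow> Ck_on n S (f i)) \<Longrightarrow> Ck_on n S (\<lambda>x. \<Sum>i\<in>I. f i x)"
  by (induction I rule: infinite_finite_induct) (auto intro: Ck_on_const Ck_on_add)

text \<open>The chain rule differentiates \<open>f\<close> in the direction of the derivative of
  \<open>g\<close>, which moves with the point, while \<open>Ck_on\<close> only controls fixed
  directions. Expanding the direction in \<open>Basis\<close> leaves fixed directions with varying
  scalar coefficients; hence the Euclidean target of \<open>g\<close>.\<close>

lemma Ck_on_compose:
  fixes g :: "'a::real_normed_vector \<Rightarrow> 'b::euclidean_space" and f :: "'b \<Rightarrow> 'c::real_normed_vector"
  assumes "open S"
  shows "Ck_on n T f \<Longrightarrow> Ck_on n S g \<Longrightarrow> g ` S \<subseteq> T \<Longrightarrow> Ck_on n S (\<lambda>x. f (g x))"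
proof (induction n arbitrary: f g)
  case 0
  then show ?case by (auto intro: continuous_on_compose2)
next
  case (Suc n)
  show ?case
  proof (rule Ck_on_SucI[where D = "\<lambda>x v. \<Sum>b\<in>Basis. inner (frechet_derivative g (at x) v) b *\<^sub>R
          frechet_derivative f (at (g x)) b"])
    fix x assume x: "x \<in> S"
    have g: "(g has_derivative frechet_derivative g (at x)) (at x)"
      by (rule Ck_on_SucD(1)[OF Suc.prems(2) x])
    have "g x \<in> T" using x Suc.prems(3) by auto
    from Ck_on_SucD(1)[OF Suc.prems(1) this]
    have f: "(f has_derivative frechet_derivative f (at (g x))) (at (g x))" .
    interpret linear "frechet_derivative f (at (g x))"
      using f by (rule has_derivative_linear)
    have "frechet_derivative f (at (g x)) w =
        (\<Sum>b\<in>Basis. inner w b *\<^sub>R frechet_derivative f (at (g x)) b)" for w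
      by (subst (1) euclidean_representation[symmetric]) (simp add: sum scaleR)
    then have "frechet_derivative f (at (g x)) \<circ> frechet_derivative g (at x) =
        (\<lambda>v. \<Sum>b\<in>Basis. inner (frechet_derivative g (at x) v) b *\<^sub>R
          frechet_derivative f (at (g x)) b)"
      unfolding o_def by (rule ext)
    with diff_chain_at[OF g f] show "((\<lambda>x. f (g x)) has_derivative
        (\<lambda>v. \<Sum>b\<in>Basis. inner (frechet_derivative g (at x) v) b *\<^sub>R
          frechet_derivative f (at (g x)) b)) (at x)"
      by (simp only: o_def[of f g])
  next
    fix v
    have "Ck_on n S (\<lambda>x. inner (frechet_derivative g (at x) v) b)" for b
      by (rule Ck_on_bounded_linear[OF bounded_linear_inner_left assms]) (use Suc.prems in simp)
    moreover have "Ck_on n S (\<lambda>x. frechet_derivative f (at (g x)) b)" for b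
      using Ck_on_SucD(2)[OF Suc.prems(1)] Ck_on_Suc_imp[OF Suc.prems(2)] Suc.prems(3)
      by (rule Suc.IH)
    ultimately show "Ck_on n S (\<lambda>x. \<Sum>b\<in>Basis. inner (frechet_derivative g (at x) v) b *\<^sub>R
          frechet_derivative f (at (g x)) b)"
      by (intro Ck_on_sum[OF assms]) (rule bounded_bilinear.Ck_on[OF bounded_bilinear_scaleR assms])
  qed (fact assms)
qed

text \<open>The derivative of the inverse contains the inverse again, but it is needed there with
  one order of smoothness less, which the induction hypothesis supplies.\<close>

lemma Ck_on_inverse:
  fixes f :: "'a::real_normed_vector \<Rightarrow> 'b::real_normed_field"
  assumes "open S"
  shows "Ck_on n S f \<Longrightarrow> (\<And>x. x \<in> S \<Longrightarrow> f x \<noteq> 0) \<Longrightarrow> Ck_on n S (\<lambda>x. inverse (f x))"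
proof (induction n)
  case 0
  then show ?case by (auto intro: continuous_on_inverse)
next
  case (Suc n)
  show ?case
  proof (rule Ck_on_SucI[where D = "\<lambda>x v. - (inverse (f x) * frechet_derivative f (at x) v
        * inverse (f x))"])
    show "((\<lambda>x. inverse (f x)) has_derivative (\<lambda>v. - (inverse (f x) *
        frechet_derivative f (at x) v * inverse (f x)))) (at x)" if "x \<in> S" for x
      by (rule Deriv.has_derivative_inverse[OF Suc.prems(2)[OF that] Ck_on_SucD(1)[OF Suc.prems(1) that]])
    have inv: "Ck_on n S (\<lambda>x. inverse (f x))"
      by (rule Suc.IH[OF Ck_on_Suc_imp[OF Suc.prems(1)] Suc.prems(2)])
    note mult = bounded_bilinear.Ck_on[OF bounded_bilinear_mult assms]
    show "Ck_on n S (\<lambda>x. - (inverse (f x) * frechet_derivative f (at x) v * inverse (f x)))" for v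
      by (rule Ck_on_bounded_linear[OF bounded_linear_minus[OF bounded_linear_ident] assms])
        (rule mult[OF mult[OF inv Ck_on_SucD(2)[OF Suc.prems(1)]] inv])
  qed (fact assms)
qed

section \<open>Closure properties of infinitely differentiable maps\<close>

lemma smooth_on_cong:
  "open S \<Longrightarrow> (\<And>x. x \<in> S \<Longrightarrow> f x = g x) \<Longrightarrow> smooth_on S f \<longleftrightarrow> smooth_on S g"
  unfolding smooth_on_def using Ck_on_cong by blast

lemma smooth_on_subset: "smooth_on S f \<Longrightarrow> T \<subseteq> S \<Longrightarrow> smooth_on T f"
  unfolding smooth_on_def using Ck_on_subset by blast

lemma smooth_on_local:
  "(\<And>x. x \<in> S \<Longrightarrow> \<exists>T. open T \<and> x \<in> T \<and> smooth_on T f) \<Longrightarrow> smooth_on S f"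
  unfolding smooth_on_def by (meson Ck_on_local)

lemma smooth_on_const: "open S \<Longrightarrow> smooth_on S (\<lambda>x. a)"
  unfolding smooth_on_def by (simp add: Ck_on_const)

lemma smooth_on_bounded_linear:
  "bounded_linear L \<Longrightarrow> open S \<Longrightarrow> smooth_on S f \<Longrightarrow> smooth_on S (\<lambda>x. L (f x))"
  unfolding smooth_on_def by (simp add: Ck_on_bounded_linear)

lemma smooth_on_add:
  "open S \<Longrightarrow> smooth_on S f \<Longrightarrow> smooth_on S g \<Longrightarrow> smooth_on S (\<lambda>x. f x + g x)"
  unfolding smooth_on_def by (simp add: Ck_on_add)

lemma smooth_on_sum:
  "open S \<Longrightarrow> (\<And>i. i \<in> I \<Longrightarrow> smooth_on S (f i)) \<Longrightarrow> smooth_on S (\<lambda>x. \<Sum>i\<in>I. f i x)"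
  unfolding smooth_on_def by (simp add: Ck_on_sum)

lemma (in bounded_bilinear) smooth_on:
  "open S \<Longrightarrow> smooth_on S f \<Longrightarrow> smooth_on S g \<Longrightarrow> smooth_on S (\<lambda>x. prod (f x) (g x))"
  unfolding smooth_on_def by (simp add: Ck_on)

lemma smooth_on_compose:
  fixes g :: "'a::real_normed_vector \<Rightarrow> 'b::euclidean_space"
  shows "open S \<Longrightarrow> smooth_on T f \<Longrightarrow> smooth_on S g \<Longrightarrow> g ` S \<subseteq> T \<Longrightarrow> smooth_on S (\<lambda>x. f (g x))"
  unfolding smooth_on_def by (auto intro: Ck_on_compose)

lemma smooth_on_inverse:
  fixes f :: "'a::real_normed_vector \<Rightarrow> 'b::real_normed_field"
  shows "open S \<Longrightarrow> smooth_on S f \<Longrightarrow> (\<And>x. x \<in> S \<Longrightarrow> f x \<noteq> 0) \<Longrightarrow> smooth_on S (\<lambda>x. inverse (f x))"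
  unfolding smooth_on_def by (simp add: Ck_on_inverse)

lemma smooth_on_ident: "open S \<Longrightarrow> smooth_on S (\<lambda>x. x)"
proof -
  assume S: "open S"
  have "Ck_on n S (\<lambda>x. x)" for n
    by (cases n) (use S in \<open>auto intro!: Ck_on_SucI[where D = "\<lambda>x v. v"] Ck_on_const
        simp del: Ck_on.simps(2)\<close>)
  then show ?thesis by (simp add: smooth_on_def)
qed

lemma smooth_on_frechet_derivative:
  "smooth_on S f \<Longrightarrow> smooth_on S (\<lambda>x. frechet_derivative f (at x) v)"
  unfolding smooth_on_def by (metis Ck_on.simps(2))

lemma smooth_on_has_derivative:
  "smooth_on S f \<Longrightarrow> x \<in> S \<Longrightarrow> (f has_derivative frechet_derivative f (at x)) (at x)"
  unfolding smooth_on_def using Ck_on_SucD(1) by blast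

lemma bounded_linear_axis: "bounded_linear (axis k :: 'b::euclidean_space \<Rightarrow> 'b ^ 'n)"
  unfolding linear_conv_bounded_linear[symmetric]
  by (rule linearI) (auto simp: axis_def vec_eq_iff)

lemma smooth_on_vec:
  fixes f :: "'a::real_normed_vector \<Rightarrow> 'b::euclidean_space ^ 'n"
  assumes "open S"
  shows "smooth_on S f \<longleftrightarrow> (\<forall>i. smooth_on S (\<lambda>x. f x $ i))"
proof
  assume f: "\<forall>i. smooth_on S (\<lambda>x. f x $ i)"
  have "f = (\<lambda>x. \<Sum>i\<in>UNIV. axis i (f x $ i))"
    by (auto simp: fun_eq_iff vec_eq_iff axis_def if_distrib cong: if_cong)
  moreover have "smooth_on S (\<lambda>x. \<Sum>i\<in>UNIV. axis i (f x $ i))"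
    by (intro smooth_on_sum assms smooth_on_bounded_linear[OF bounded_linear_axis])
      (use f in auto)
  ultimately show "smooth_on S f" by simp
qed (auto intro: smooth_on_bounded_linear[OF bounded_linear_vec_nth assms])

lemma smooth_on_mat:
  fixes f :: "'a::real_normed_vector \<Rightarrow> 'b::euclidean_space ^ 'n ^ 'm"
  assumes "open S"
  shows "smooth_on S f \<longleftrightarrow> (\<forall>i j. smooth_on S (\<lambda>x. f x $ i $ j))"
  using assms by (simp add: smooth_on_vec)

text \<open>The derivative of \<open>t^{-k} exp (-1/t)\<close> is a combination of functions of the same shape,
  which makes smoothness at \<open>0\<close> a simple induction.\<close>

definition flat :: "nat \<Rightarrow> real \<Rightarrow> real" where
  "flat k t = (if t > 0 then inverse t ^ k * exp (- inverse t) else 0)"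

text \<open>Substituting \<open>s = 1 / t\<close> turns the limit from the right into the decay of
  \<open>s^k / exp s\<close> at infinity; on the left the function is 0.\<close>

lemma flat_tendsto_0: "(flat k \<longlongrightarrow> 0) (at 0)"
proof -
  have "((\<lambda>t. inverse t ^ k * exp (- inverse t)) \<longlongrightarrow> 0) (at_right (0::real))"
    using filterlim_compose[OF tendsto_power_div_exp_0[of k] filterlim_inverse_at_top_right]
    by (simp add: exp_minus divide_inverse)
  moreover have "eventually (\<lambda>t. inverse t ^ k * exp (- inverse t) = flat k t) (at_right 0)"
    by (auto simp: eventually_at_filter flat_def)
  ultimately have "(flat k \<longlongrightarrow> 0) (at_right 0)"
    using Lim_transform_eventually by blast
  moreover have "(flat k \<longlongrightarrow> 0) (at_left 0)"
    by (rule Lim_transform_eventually[OF tendsto_const]) (auto simp: eventually_at_filter flat_def)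
  ultimately show ?thesis by (simp add: filterlim_split_at)
qed

lemma flat_has_derivative:
  "(flat k has_real_derivative (flat (k + 2) t - real k * flat (k + 1) t)) (at t)"
proof -
  consider "t > 0" | "t < 0" | "t = 0" by linarith
  then show ?thesis
  proof cases
    case 1
    have "((\<lambda>t. inverse t ^ k * exp (- inverse t)) has_real_derivative
        (flat (k + 2) t - real k * flat (k + 1) t)) (at t)"
      using 1 by (cases k) (auto intro!: derivative_eq_intros
          simp: flat_def power2_eq_square field_simps, metis One_nat_def power_eq_if)
    then show ?thesis
      by (rule has_field_derivative_transform_within_open[where S = "{0<..}"])
        (use 1 in \<open>auto simp: flat_def\<close>)
  next
    case 2
    have "((\<lambda>t. 0) has_real_derivative (flat (k + 2) t - real k * flat (k + 1) t)) (at t)"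
      using 2 by (auto simp: flat_def)
    then show ?thesis
      by (rule has_field_derivative_transform_within_open[where S = "{..<0}"])
        (use 2 in \<open>auto simp: flat_def\<close>)
  next
    case 3
    \<comment> \<open>Division by \<open>y\<close> only raises the exponent, so the difference
      quotient at 0 is \<open>flat (k + 1)\<close> itself and its limit is already known.\<close>
    have "flat (k + 1) y = (flat k y - flat k 0) / (y - 0)" for y
      by (auto simp: flat_def divide_inverse)
    then have "(\<lambda>y. (flat k y - flat k 0) / (y - 0)) \<midarrow>0\<rightarrow> 0"
      using flat_tendsto_0[of "k + 1"] by presburger
    with 3 show ?thesis by (auto simp: has_field_derivative_iff flat_def)
  qed
qed

lemma smooth_on_flat: "smooth_on UNIV (flat k)"
proof -
  have "Ck_on n UNIV (flat k)" for n
  proof (induction n arbitrary: k)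
    case 0
    have "isCont (flat k) x" for x
      using flat_has_derivative DERIV_isCont by blast
    then show ?case by (simp add: continuous_on_eq_continuous_at)
  next
    case (Suc n)
    show ?case
    proof (rule Ck_on_SucI[where D = "\<lambda>t v. (flat (k + 2) t + (- real k) * flat (k + 1) t) * v"])
      show "(flat k has_derivative (*) (flat (k + 2) x + - real k * flat (k + 1) x)) (at x)" for x
        using flat_has_derivative[of k x] by (simp add: has_field_derivative_def)
      show "Ck_on n UNIV (\<lambda>x. (flat (k + 2) x + - real k * flat (k + 1) x) * v)" for v
        by (intro bounded_bilinear.Ck_on[OF bounded_bilinear_mult] Ck_on_add Ck_on_const Suc.IH)
          auto
    qed simp
  qed
  then show ?thesis by (simp add: smooth_on_def)
qed

text \<open>The quotient \<open>p\<close> divides a term that vanishes for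
  \<open>t \<ge> e\<^sup>2\<close> by its sum with a term that vanishes for
  \<open>t \<le> e\<^sup>2 / 2\<close>. These two ranges do not meet, so the denominator has no
  zero. Inserting the squared distance, which unlike the distance is smooth at \<open>a\<close>,
  gives the bump function.\<close>

lemma smooth_bump_euclidean:
  fixes a :: "'a::euclidean_space"
  assumes "e > 0"
  shows "\<exists>(b :: 'a \<Rightarrow> real) d. smooth_on UNIV b \<and> d > 0 \<and>
    (\<forall>z\<in>ball a d. b z = 1) \<and> (\<forall>z. z \<notin> cball a e \<longrightarrow> b z = 0)"
proof -
  define q where "q z = inner (z + - a) (z + - a)" for z
  have q: "q z = (dist a z)\<^sup>2" for z
    unfolding q_def dist_norm norm_minus_commute[of a z] by (simp add: power2_norm_eq_inner)
  define p where "p t = flat 0 (e\<^sup>2 + (-1) * t) * inverse (flat 0 (e\<^sup>2 + (-1) * t) + flat 0 (t + - (e\<^sup>2 / 2)))"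
    for t
  have "flat 0 t \<ge> 0" "flat 0 t = 0 \<longleftrightarrow> t \<le> 0" for t by (auto simp: flat_def)
  note fl = this
  have pos: "flat 0 (e\<^sup>2 + (-1) * t) + flat 0 (t + - (e\<^sup>2 / 2)) \<noteq> 0" for t
  proof
    assume "flat 0 (e\<^sup>2 + (-1) * t) + flat 0 (t + - (e\<^sup>2 / 2)) = 0"
    then have "e\<^sup>2 + (-1) * t \<le> 0" "t + - (e\<^sup>2 / 2) \<le> 0"
      using fl by (metis add_nonneg_eq_0_iff)+
    then show False using zero_less_power[OF assms, of 2] by linarith
  qed
  note smooth_diff = smooth_on_add[OF open_UNIV _ smooth_on_const[OF open_UNIV]]
  note smooth_diff' = smooth_on_add[OF open_UNIV smooth_on_const[OF open_UNIV]]
  note smooth_times = bounded_bilinear.smooth_on[OF bounded_bilinear_mult open_UNIV]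
  note id = smooth_on_ident[OF open_UNIV]
  have q': "smooth_on UNIV q" unfolding q_def
    by (rule bounded_bilinear.smooth_on[OF bounded_bilinear_inner open_UNIV smooth_diff[OF id]
          smooth_diff[OF id]])
  have flat': "smooth_on UNIV (\<lambda>t. flat 0 (g t))" if "smooth_on UNIV g" for g :: "real \<Rightarrow> real"
    by (rule smooth_on_compose[OF open_UNIV smooth_on_flat that]) simp
  have "smooth_on UNIV (\<lambda>t. e\<^sup>2 + (-1) * t)"
    by (rule smooth_diff'[OF smooth_times[OF smooth_on_const[OF open_UNIV] id]])
  note 1 = flat'[OF this]
  note 2 = flat'[OF smooth_diff[OF id], of "- (e\<^sup>2 / 2)"]
  have "smooth_on UNIV p" unfolding p_def
    by (rule smooth_times[OF 1 smooth_on_inverse[OF open_UNIV smooth_on_add[OF open_UNIV 1 2] pos]])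
  from smooth_on_compose[OF open_UNIV this q'] have "smooth_on UNIV (\<lambda>z. p (q z))"
    by simp
  \<comment> \<open>The radius \<open>e / 2\<close> keeps the squared distance below
    \<open>e\<^sup>2 / 2\<close>, where the second term of the denominator vanishes and the quotient
    is 1.\<close>
  moreover have "p (q z) = 1" if "z \<in> ball a (e / 2)" for z
  proof -
    have "(dist a z)\<^sup>2 \<le> (e / 2)\<^sup>2" using that by (intro power_mono) auto
    then have "q z \<le> e\<^sup>2 / 4" by (simp add: q power_divide)
    also have "\<dots> \<le> e\<^sup>2 / 2" by simp
    finally have "q z \<le> e\<^sup>2 / 2" .
    then have "flat 0 (q z + - (e\<^sup>2 / 2)) = 0" using fl by auto
    with pos[of "q z"] show ?thesis by (simp add: p_def)
  qed
  moreover have "p (q z) = 0" if "z \<notin> cball a e" for z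
  proof -
    have "e\<^sup>2 \<le> (dist a z)\<^sup>2" using that assms by (intro power_mono) auto
    then show ?thesis using fl by (simp add: p_def q)
  qed
  ultimately show ?thesis
    using assms by (intro exI[of _ "\<lambda>z. p (q z)"] exI[of _ "e / 2"]) simp
qed

section \<open>Functions on complex manifolds\<close>

locale complex_manifold =
  fixes A :: "('m::{t2_space, second_countable_topology}, 'n::finite) chart set"
  assumes atlas: "complex_atlas A"
begin

lemma open_chart: "c \<in> A \<Longrightarrow> open (fst c)"
  using atlas by (auto simp: complex_atlas_def)

lemma chart_homeomorphism:
  "c \<in> A \<Longrightarrow> homeomorphism (fst c) (snd c ` fst c) (snd c) (inv_into (fst c) (snd c))"
  using atlas by (auto simp: complex_atlas_def)

lemma chart_cover: "\<exists>c\<in>A. x \<in> fst c"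
  using atlas by (auto simp: complex_atlas_def)

lemma chart_inv: "c \<in> A \<Longrightarrow> x \<in> fst c \<Longrightarrow> inv_into (fst c) (snd c) (snd c x) = x"
  using chart_homeomorphism by (auto simp: homeomorphism_def)

lemma in_chart_apply: "c \<in> A \<Longrightarrow> x \<in> fst c \<Longrightarrow> in_chart c f (snd c x) = f x"
  by (simp add: in_chart_def chart_inv)

lemma open_chart_image:
  assumes "c \<in> A" "open V"
  shows "open (snd c ` (V \<inter> fst c))"
proof -
  have "openin (top_of_set (snd c ` fst c)) (snd c ` (V \<inter> fst c))"
    by (rule homeomorphism_imp_open_map[OF chart_homeomorphism[OF assms(1)]])
      (use openin_open_Int[OF assms(2), of "fst c"] in \<open>simp only: Int_commute[of V]\<close>)
  moreover have "open (snd c ` fst c)"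
    using atlas assms(1) by (auto simp: complex_atlas_def)
  ultimately show ?thesis using openin_open_trans by blast
qed

lemma smooth_fun_cong:
  assumes "open V" "\<And>x. x \<in> V \<Longrightarrow> f x = g x"
  shows "smooth_fun A V f \<longleftrightarrow> smooth_fun A V g"
proof -
  have "smooth_on (snd c ` (V \<inter> fst c)) (in_chart c f) \<longleftrightarrow>
      smooth_on (snd c ` (V \<inter> fst c)) (in_chart c g)" if "c \<in> A" for c
    by (rule smooth_on_cong[OF open_chart_image[OF that assms(1)]])
      (auto simp: in_chart_apply[OF that] assms(2))
  then show ?thesis by (simp add: smooth_fun_def)
qed

lemma smooth_fun_const: "open V \<Longrightarrow> smooth_fun A V (\<lambda>x. a)"
  unfolding smooth_fun_def in_chart_def
  by (intro ballI smooth_on_const[OF open_chart_image]) simp_all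

lemma smooth_fun_add:
  "open V \<Longrightarrow> smooth_fun A V f \<Longrightarrow> smooth_fun A V g \<Longrightarrow> smooth_fun A V (\<lambda>x. f x + g x)"
  unfolding smooth_fun_def in_chart_def
  by (intro ballI smooth_on_add[OF open_chart_image]) simp_all

lemma smooth_fun_sum:
  "open V \<Longrightarrow> (\<And>i. i \<in> I \<Longrightarrow> smooth_fun A V (f i)) \<Longrightarrow> smooth_fun A V (\<lambda>x. \<Sum>i\<in>I. f i x)"
  unfolding smooth_fun_def in_chart_def
  by (intro ballI smooth_on_sum[OF open_chart_image]) simp_all

lemma smooth_fun_mult:
  fixes f g :: "'m \<Rightarrow> 'b::real_normed_algebra"
  shows "open V \<Longrightarrow> smooth_fun A V f \<Longrightarrow> smooth_fun A V g \<Longrightarrow> smooth_fun A V (\<lambda>x. f x * g x)"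
  unfolding smooth_fun_def in_chart_def
  by (intro ballI bounded_bilinear.smooth_on[OF bounded_bilinear_mult open_chart_image]) simp_all

lemma smooth_fun_bounded_linear:
  "bounded_linear L \<Longrightarrow> open V \<Longrightarrow> smooth_fun A V f \<Longrightarrow> smooth_fun A V (\<lambda>x. L (f x))"
  unfolding smooth_fun_def in_chart_def
  by (intro ballI, rule smooth_on_bounded_linear[OF _ open_chart_image]) simp_all

lemma smooth_fun_subset: "smooth_fun A V f \<Longrightarrow> W \<subseteq> V \<Longrightarrow> smooth_fun A W f"
  unfolding smooth_fun_def using smooth_on_subset[OF _ image_mono[OF Int_mono[OF _ order_refl]]] by blast

lemma smooth_fun_local:
  assumes "\<And>x. x \<in> V \<Longrightarrow> \<exists>W. open W \<and> x \<in> W \<and> smooth_fun A W f"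
  shows "smooth_fun A V f"
  unfolding smooth_fun_def
proof (intro ballI smooth_on_local)
  fix c z assume c: "c \<in> A" and "z \<in> snd c ` (V \<inter> fst c)"
  then obtain x where x: "x \<in> V" "x \<in> fst c" "z = snd c x" by auto
  obtain W where W: "open W" "x \<in> W" "smooth_fun A W f" using assms x by blast
  from W(3)[unfolded smooth_fun_def] c have "smooth_on (snd c ` (W \<inter> fst c)) (in_chart c f)" ..
  moreover have "z \<in> snd c ` (W \<inter> fst c)" using x W by simp
  ultimately show "\<exists>T. open T \<and> z \<in> T \<and> smooth_on T (in_chart c f)"
    using c open_chart_image[OF c W(1)] by (intro exI[of _ "snd c ` (W \<inter> fst c)"]) (simp add: smooth_fun_def)
qed

lemma smooth_fun_mat:
  fixes f :: "'m \<Rightarrow> 'b::euclidean_space ^ 'k ^ 'l"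
  assumes "open V"
  shows "smooth_fun A V f \<longleftrightarrow> (\<forall>i j. smooth_fun A V (\<lambda>x. f x $ i $ j))"
proof -
  have "smooth_on (snd c ` (V \<inter> fst c)) (in_chart c f) \<longleftrightarrow>
      (\<forall>i j. smooth_on (snd c ` (V \<inter> fst c)) (in_chart c (\<lambda>x. f x $ i $ j)))" if "c \<in> A" for c
    unfolding in_chart_def by (rule smooth_on_mat[OF open_chart_image[OF that assms]])
  then show ?thesis unfolding smooth_fun_def by blast
qed

lemma smooth_on_transition:
  assumes "c \<in> A" "c' \<in> A"
  shows "smooth_on (snd c ` (fst c \<inter> fst c')) (in_chart c (snd c'))"
proof -
  have "smooth_on (snd c ` (fst c \<inter> fst c')) (in_chart c (\<lambda>x. snd c' x $ i))" for i
    using atlas assms by (auto simp: complex_atlas_def Let_def)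
  then have "smooth_on (snd c ` (fst c \<inter> fst c')) (\<lambda>z. in_chart c (snd c') z $ i)" for i
    by (simp add: in_chart_def)
  moreover have "open (snd c ` (fst c \<inter> fst c'))"
    using open_chart_image[OF assms(1) open_chart[OF assms(2)]] by (simp add: Int_commute)
  ultimately show ?thesis by (simp add: smooth_on_vec)
qed

text \<open>\<open>smooth_fun\<close> tests every chart of the atlas; composing with the smooth
  change of coordinates shows that a single chart containing \<open>V\<close> decides.\<close>

lemma smooth_fun_chart_iff:
  assumes "c \<in> A" "open V" "V \<subseteq> fst c"
  shows "smooth_fun A V f \<longleftrightarrow> smooth_on (snd c ` V) (in_chart c f)"
proof
  assume f: "smooth_on (snd c ` V) (in_chart c f)"
  show "smooth_fun A V f"
    unfolding smooth_fun_def
  proof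
    fix c' assume c': "c' \<in> A"
    let ?S = "snd c' ` (V \<inter> fst c')"
    have S: "open ?S" by (rule open_chart_image[OF c' assms(2)])
    have sm: "smooth_on ?S (\<lambda>z. in_chart c f (in_chart c' (snd c) z))"
    proof (rule smooth_on_compose[OF S f smooth_on_subset[OF smooth_on_transition[OF c' assms(1)]]])
      show "?S \<subseteq> snd c' ` (fst c' \<inter> fst c)" using assms by auto
      show "in_chart c' (snd c) ` ?S \<subseteq> snd c ` V" by (auto simp: in_chart_apply[OF c'])
    qed
    have eq: "in_chart c f (in_chart c' (snd c) z) = in_chart c' f z" if "z \<in> ?S" for z
      using that assms(3) by (auto simp: in_chart_apply[OF c'] in_chart_apply[OF assms(1)] subset_eq)
    show "smooth_on ?S (in_chart c' f)"
      by (rule iffD1[OF smooth_on_cong[OF S eq] sm])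
  qed
qed (use assms in \<open>auto simp: smooth_fun_def Int_absorb2\<close>)

section \<open>Wirtinger derivatives in a chart\<close>

lemma smooth_fun_has_derivative:
  assumes "c \<in> A" "smooth_fun A V f" "x \<in> V \<inter> fst c"
  shows "(in_chart c f has_derivative frechet_derivative (in_chart c f) (at (snd c x))) (at (snd c x))"
  using assms by (auto simp: smooth_fun_def intro: smooth_on_has_derivative)

lemma in_chart_chart_deriv:
  "c \<in> A \<Longrightarrow> z \<in> snd c ` fst c \<Longrightarrow> in_chart c (chart_deriv c w f) z = wirtinger w (in_chart c f) z"
  by (auto simp: in_chart_apply chart_deriv_def)

lemma smooth_on_wirtinger:
  assumes "open S" "smooth_on S f"
  shows "smooth_on S (wirtinger w f)"
proof -
  note D = smooth_on_frechet_derivative[OF assms(2)]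
  note mult = smooth_on_bounded_linear[OF bounded_linear_mult_right assms(1)]
  \<comment> \<open>Both kinds of Wirtinger derivative are instances, with \<open>a\<close> minus or
    plus the imaginary unit.\<close>
  have "smooth_on S (\<lambda>z. (1/2) * (frechet_derivative f (at z) (axis k 1) +
      a * frechet_derivative f (at z) (axis k \<i>)))" for k a
    by (rule mult[OF smooth_on_add[OF assms(1) D mult[OF D]]])
  note D = this
  show ?thesis
  proof (cases w)
    case (Inl k)
    then show ?thesis using D[of k "-\<i>"] by (simp add: wirtinger_def[abs_def] Let_def)
  next
    case (Inr k)
    then show ?thesis using D[of k "\<i>"] by (simp add: wirtinger_def[abs_def] Let_def)
  qed
qed

lemma chart_deriv_smooth:
  assumes "c \<in> A" "open V" "smooth_fun A V f"
  shows "smooth_fun A (V \<inter> fst c) (chart_deriv c w f)"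
proof -
  have S: "open (snd c ` (V \<inter> fst c))" by (rule open_chart_image[OF assms(1,2)])
  have "smooth_on (snd c ` (V \<inter> fst c)) (wirtinger w (in_chart c f))"
    using smooth_on_wirtinger[OF S] assms by (auto simp: smooth_fun_def)
  then have "smooth_on (snd c ` (V \<inter> fst c)) (in_chart c (chart_deriv c w f))"
    by (subst smooth_on_cong[OF S]) (auto intro: in_chart_chart_deriv[OF assms(1)])
  then show ?thesis
    using assms open_chart[OF assms(1)] by (subst smooth_fun_chart_iff[OF assms(1)]) auto
qed

lemma chart_deriv_cong:
  assumes "c \<in> A" "open V" "x \<in> V \<inter> fst c" "\<And>y. y \<in> V \<inter> fst c \<Longrightarrow> f y = g y"
  shows "chart_deriv c w f x = chart_deriv c w g x"
proof -
  have "frechet_derivative (in_chart c f) (at (snd c x)) = frechet_derivative (in_chart c g) (at (snd c x))"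
    by (rule frechet_derivative_cong_open[OF open_chart_image[OF assms(1,2)]])
      (use assms(3,4) in \<open>auto simp: in_chart_apply[OF assms(1)]\<close>)
  then show ?thesis by (simp add: chart_deriv_def wirtinger_def)
qed

lemma chart_deriv_const: "chart_deriv c w (\<lambda>x. a) x = 0"
  by (simp add: chart_deriv_def wirtinger_def in_chart_def Let_def split: sum.split)

context
  fixes c V x and f g :: "'m \<Rightarrow> complex"
  assumes c: "c \<in> A" and f: "smooth_fun A V f" and g: "smooth_fun A V g"
    and x: "x \<in> V \<inter> fst c"
begin

lemma chart_deriv_add:
  "chart_deriv c w (\<lambda>y. f y + g y) x = chart_deriv c w f x + chart_deriv c w g x"
proof -
  have "in_chart c (\<lambda>y. f y + g y) = (\<lambda>z. in_chart c f z + in_chart c g z)"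
    by (simp add: in_chart_def)
  with frechet_derivative_at[OF has_derivative_add[OF smooth_fun_has_derivative[OF c f x]
        smooth_fun_has_derivative[OF c g x]], symmetric]
  show ?thesis
    by (cases w) (simp_all add: chart_deriv_def wirtinger_def Let_def algebra_simps
        add_divide_distrib diff_divide_distrib)
qed

lemma chart_deriv_mult:
  "chart_deriv c w (\<lambda>y. f y * g y) x = chart_deriv c w f x * g x + f x * chart_deriv c w g x"
proof -
  have "in_chart c (\<lambda>y. f y * g y) = (\<lambda>z. in_chart c f z * in_chart c g z)"
    by (simp add: in_chart_def)
  with frechet_derivative_at[OF has_derivative_mult[OF smooth_fun_has_derivative[OF c f x]
        smooth_fun_has_derivative[OF c g x]], symmetric] x
  show ?thesis
    by (cases w) (simp_all add: chart_deriv_def wirtinger_def Let_def in_chart_apply[OF c]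
        algebra_simps add_divide_distrib diff_divide_distrib)
qed

text \<open>Conjugation is real linear and exchanges the two kinds of Wirtinger derivative. This
  later makes the conjugate transpose of a holomorphic transition matrix antiholomorphic.\<close>

lemma chart_deriv_cnj:
  "chart_deriv c (Inl k) (\<lambda>y. cnj (f y)) x = cnj (chart_deriv c (Inr k) f x)"
proof -
  have "in_chart c (\<lambda>y. cnj (f y)) = (\<lambda>z. cnj (in_chart c f z))"
    by (simp add: in_chart_def)
  with frechet_derivative_at[OF bounded_linear.has_derivative[OF bounded_linear_cnj
        smooth_fun_has_derivative[OF c f x]], symmetric]
  show ?thesis
    by (simp add: chart_deriv_def wirtinger_def Let_def)
qed

end

lemma chart_deriv_sum:
  assumes "c \<in> A" "open V" "\<And>i. i \<in> I \<Longrightarrow> smooth_fun A V (f i)" "x \<in> V \<inter> fst c"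
  shows "chart_deriv c w (\<lambda>y. \<Sum>i\<in>I. f i y) x = (\<Sum>i\<in>I. chart_deriv c w (f i) x)"
  using assms(3)
proof (induction I rule: infinite_finite_induct)
  case (insert i I)
  then show ?case
    by (simp add: chart_deriv_add[OF assms(1) _ smooth_fun_sum[OF assms(2)] assms(4)])
qed (simp_all add: chart_deriv_const)

lemma chart_derivs_smooth:
  assumes "c \<in> A" "open V" "smooth_fun A V f"
  shows "smooth_fun A (V \<inter> fst c) (chart_derivs c I f)"
proof (induction I)
  case Nil
  then show ?case using smooth_fun_subset[OF assms(3)] by simp
next
  case (Cons w I)
  have "open (V \<inter> fst c)" using assms open_chart[OF assms(1)] by blast
  from chart_deriv_smooth[OF assms(1) this Cons] show ?case by (simp add: Int_assoc)
qed

lemma chart_derivs_cong: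
  assumes "c \<in> A" "open V" "\<And>y. y \<in> V \<inter> fst c \<Longrightarrow> f y = g y"
  shows "x \<in> V \<inter> fst c \<Longrightarrow> chart_derivs c I f x = chart_derivs c I g x"
proof (induction I arbitrary: x)
  case (Cons w I)
  from chart_deriv_cong[OF assms(1,2) Cons.prems Cons.IH] show ?case by simp
qed (use assms(3) in simp)

lemma chart_derivs_sum:
  assumes "c \<in> A" "open V" "\<And>i. i \<in> K \<Longrightarrow> smooth_fun A V (f i)"
  shows "x \<in> V \<inter> fst c \<Longrightarrow>
    chart_derivs c I (\<lambda>y. \<Sum>i\<in>K. f i y) x = (\<Sum>i\<in>K. chart_derivs c I (f i) x)"
proof (induction I arbitrary: x)
  case (Cons w I)
  have V: "open (V \<inter> fst c)" using assms(1,2) open_chart by blast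
  have "chart_derivs c (w # I) (\<lambda>y. \<Sum>i\<in>K. f i y) x =
      chart_deriv c w (\<lambda>y. \<Sum>i\<in>K. chart_derivs c I (f i) y) x"
    unfolding chart_derivs.simps
    by (rule chart_deriv_cong[OF assms(1,2) Cons.prems Cons.IH])
  also have "\<dots> = (\<Sum>i\<in>K. chart_derivs c (w # I) (f i) x)"
    unfolding chart_derivs.simps using Cons.prems
    by (intro chart_deriv_sum[OF assms(1) V] chart_derivs_smooth assms) auto
  finally show ?case .
qed simp

text \<open>A Euclidean bump function is pulled back by a chart and extended by 0. It vanishes off
  the preimage \<open>K\<close> of a closed ball; \<open>K\<close> is compact, hence closed because
  the manifold is Hausdorff, so the extension is smooth also on the open complement of
  \<open>K\<close>.\<close>

lemma bump_function:
  assumes "open V" "x \<in> V"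
  shows "\<exists>(b :: 'm \<Rightarrow> complex) K W. smooth_fun A UNIV b \<and> closed K \<and> K \<subseteq> V \<and>
    open W \<and> x \<in> W \<and> W \<subseteq> V \<and> (\<forall>y\<in>W. b y = 1) \<and> (\<forall>y. y \<notin> K \<longrightarrow> b y = 0)"
proof -
  obtain c where c: "c \<in> A" "x \<in> fst c" using chart_cover by blast
  let ?inv = "inv_into (fst c) (snd c)"
  have "open (snd c ` (V \<inter> fst c))" by (rule open_chart_image[OF c(1) assms(1)])
  moreover have "snd c x \<in> snd c ` (V \<inter> fst c)" using c assms by blast
  ultimately obtain e where e: "e > 0" "cball (snd c x) e \<subseteq> snd c ` (V \<inter> fst c)"
    unfolding open_contains_cball by blast
  obtain \<phi> d where \<phi>: "smooth_on UNIV \<phi>" "d > 0"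
    "\<forall>z\<in>ball (snd c x) d. \<phi> z = (1::real)" "\<forall>z. z \<notin> cball (snd c x) e \<longrightarrow> \<phi> z = 0"
    using smooth_bump_euclidean[OF e(1), of "snd c x"] by (elim exE conjE)
  define K where "K = ?inv ` cball (snd c x) e"
  define b where "b y = (if y \<in> fst c then complex_of_real (\<phi> (snd c y)) else 0)" for y
  have KV: "K \<subseteq> V \<inter> fst c"
  proof
    fix y assume "y \<in> K"
    then obtain z where "z \<in> cball (snd c x) e" "y = ?inv z" by (auto simp: K_def)
    with e(2) obtain y' where "y' \<in> V \<inter> fst c" "z = snd c y'" by blast
    with \<open>y = ?inv z\<close> chart_inv[OF c(1)] show "y \<in> V \<inter> fst c" by simp
  qed
  have "continuous_on (snd c ` fst c) ?inv"
    using chart_homeomorphism[OF c(1)] by (simp add: homeomorphism_def)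
  then have "compact K"
    unfolding K_def using e(2) by (intro compact_continuous_image compact_cball)
      (blast intro: continuous_on_subset)
  then have K: "closed K" by (rule compact_imp_closed)
  have b0: "b y = 0" if "y \<notin> K" for y
  proof (cases "y \<in> fst c")
    case True
    then have "snd c y \<notin> cball (snd c x) e"
      using that chart_inv[OF c(1) True] imageI[of "snd c y" _ ?inv] unfolding K_def by auto
    with True \<phi>(4) show ?thesis by (simp add: b_def)
  qed (simp add: b_def)
  have "smooth_fun A UNIV b"
  proof (rule smooth_fun_local)
    fix y
    show "\<exists>W. open W \<and> y \<in> W \<and> smooth_fun A W b"
    proof (cases "y \<in> fst c")
      case True
      have S: "open (snd c ` fst c)" using open_chart_image[OF c(1) open_UNIV] by simp
      have "smooth_on (snd c ` fst c) (\<lambda>z. complex_of_real (\<phi> z))"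
        by (rule smooth_on_bounded_linear[OF bounded_linear_of_real S smooth_on_subset[OF \<phi>(1)]])
          simp
      then have "smooth_on (snd c ` fst c) (in_chart c b)"
        by (subst smooth_on_cong[OF S]) (auto simp: in_chart_apply[OF c(1)] b_def)
      then have "smooth_fun A (fst c) b"
        using open_chart[OF c(1)] by (subst smooth_fun_chart_iff[OF c(1)]) auto
      with True open_chart[OF c(1)] show ?thesis by blast
    next
      case False
      then have "y \<in> - K" using KV by auto
      moreover have "open (- K)" using K by auto
      moreover have "smooth_fun A (- K) b"
        by (subst smooth_fun_cong[OF \<open>open (- K)\<close>, of _ "\<lambda>_. 0"])
          (use b0 smooth_fun_const[OF \<open>open (- K)\<close>] in auto)
      ultimately show ?thesis by blast
    qed
  qed
  note b = this
  \<comment> \<open>The chart map is continuous on its domain only, so the preimage of the ball on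
    which \<phi> is 1 is open relative to \<open>fst c\<close>; \<open>W0\<close> is an open set of
    the manifold that cuts it out.\<close>
  obtain W0 where W0: "open W0" "W0 \<inter> fst c = fst c \<inter> snd c -` ball (snd c x) d"
  proof -
    have "continuous_on (fst c) (snd c)"
      using chart_homeomorphism[OF c(1)] by (simp add: homeomorphism_def)
    with open_ball[of "snd c x" d] have "\<exists>W. open W \<and> W \<inter> fst c = snd c -` ball (snd c x) d \<inter> fst c"
      unfolding continuous_on_open_invariant by blast
    then show ?thesis using that by (auto simp: Int_commute)
  qed
  have "open (W0 \<inter> fst c \<inter> V)" using W0 open_chart[OF c(1)] assms by blast
  moreover have "x \<in> W0 \<inter> fst c \<inter> V" using W0 c assms \<phi>(2) by auto
  moreover have "b y = 1" if "y \<in> W0 \<inter> fst c \<inter> V" for y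
    using that W0 \<phi>(3) by (auto simp: b_def)
  ultimately show ?thesis
    using b K KV b0 by (intro exI[of _ b] exI[of _ K] exI[of _ "W0 \<inter> fst c \<inter> V"]) simp
qed

text \<open>The neighbourhood \<open>W\<close> and the extension operator do not depend on
  \<open>f\<close>: a formal series has infinitely many coefficients, and all their extensions must
  agree with them on one open set.\<close>

lemma smooth_extension:
  assumes "open V" "x \<in> V"
  shows "\<exists>W ext. open W \<and> x \<in> W \<and> W \<subseteq> V \<and> (\<forall>f :: 'm \<Rightarrow> complex.
    smooth_fun A V f \<longrightarrow> smooth_fun A UNIV (ext f) \<and> (\<forall>y\<in>W. ext f y = f y))"
proof -
  obtain b :: "'m \<Rightarrow> complex" and K W where b: "smooth_fun A UNIV b" "closed K" "K \<subseteq> V"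
    "open W" "x \<in> W" "W \<subseteq> V" "\<forall>y\<in>W. b y = 1" "\<forall>y. y \<notin> K \<longrightarrow> b y = 0"
    using bump_function[OF assms] by (elim exE conjE)
  have "smooth_fun A UNIV (\<lambda>y. b y * f y)" if f: "smooth_fun A V f" for f
  proof (rule smooth_fun_local)
    fix y
    show "\<exists>W. open W \<and> y \<in> W \<and> smooth_fun A W (\<lambda>y. b y * f y)"
    proof (cases "y \<in> V")
      case True
      have "smooth_fun A V b" by (rule smooth_fun_subset[OF b(1)]) simp
      from smooth_fun_mult[OF assms(1) this f] True assms(1) show ?thesis by (intro exI[of _ V]) simp
    next
      case False
      have K: "open (- K)" using b(2) by auto
      moreover have "smooth_fun A (- K) (\<lambda>y. b y * f y)"
        by (subst smooth_fun_cong[OF K, of _ "\<lambda>_. 0"]) (use b(8) smooth_fun_const[OF K] in auto)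
      moreover have "y \<in> - K" using False b(3) by auto
      ultimately show ?thesis by (intro exI[of _ "- K"]) simp
    qed
  qed
  with b show ?thesis by (intro exI[of _ W] exI[of _ "\<lambda>f y. b y * f y"]) simp
qed

end

section \<open>Localization of the star product\<close>

lemma sum_triangle:
  fixes g :: "nat \<Rightarrow> nat \<Rightarrow> 'a::comm_monoid_add"
  shows "(\<Sum>i\<le>n. \<Sum>j\<le>n - i. g i j) = (\<Sum>(i, j)\<in>{(i, j). i + j \<le> n}. g i j)"
proof -
  have "{(i, j). i + j \<le> n} = Sigma {..n} (\<lambda>i. {..n - i})" by auto
  then show ?thesis by (simp add: sum.Sigma)
qed

lemma sum_triangle_swap:
  fixes g :: "nat \<Rightarrow> nat \<Rightarrow> 'a::comm_monoid_add"
  shows "(\<Sum>i\<le>n. \<Sum>j\<le>n - i. g i j) = (\<Sum>j\<le>n. \<Sum>i\<le>n - j. g i j)"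
  unfolding sum_triangle
  by (rule sum.reindex_bij_witness[where i = prod.swap and j = prod.swap]) auto

text \<open>Both sides sum over all triples of natural numbers with sum \<open>n\<close>; they
  differ in the two indices that are kept free.\<close>

lemma sum_triangle_rotate:
  fixes g :: "nat \<Rightarrow> nat \<Rightarrow> nat \<Rightarrow> 'a::comm_monoid_add"
  shows "(\<Sum>j\<le>n. \<Sum>i\<le>n - j. g (n - j - i) i j) = (\<Sum>r\<le>n. \<Sum>i\<le>n - r. g r i (n - r - i))"
  unfolding sum_triangle
  by (rule sum.reindex_bij_witness[where i = "\<lambda>(r, i). (n - r - i, i)"
        and j = "\<lambda>(j, i). (n - j - i, i)"]) auto

text \<open>Again a sum over triples with sum \<open>n\<close>: grouping by the sum of the first two
  entries is replaced by grouping by the first entry.\<close>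

lemma sum_triangle_diff:
  fixes g :: "nat \<Rightarrow> nat \<Rightarrow> nat \<Rightarrow> 'a::comm_monoid_add"
  shows "(\<Sum>m\<le>n. \<Sum>i\<le>m. g i (m - i) (n - m)) = (\<Sum>i\<le>n. \<Sum>k\<le>n - i. g i k (n - i - k))"
proof -
  have "(\<Sum>m\<le>n. \<Sum>i\<le>m. g i (m - i) (n - m)) =
      (\<Sum>m\<le>n. \<Sum>i\<le>m. g i (m - i) (n - i - (m - i)))"
    by (intro sum.cong) auto
  also have "\<dots> = (\<Sum>i\<le>n. \<Sum>k\<le>n - i. g i k (n - i - k))"
    unfolding sum_triangle
    by (rule sum.triangle_reindex_eq[of "\<lambda>i k. g i k (n - i - k)", symmetric])
  finally show ?thesis .
qed

lemma sum_antidiagonal_flip: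
  fixes g :: "nat \<Rightarrow> nat \<Rightarrow> 'a::comm_monoid_add"
  shows "(\<Sum>i\<le>n. g i (n - i)) = (\<Sum>j\<le>n. g (n - j) j)"
  by (rule sum.reindex_bij_witness[where i = "\<lambda>j. n - j" and j = "\<lambda>j. n - j"]) auto

locale star_manifold = complex_manifold A
  for A :: "('m::{t2_space, second_countable_topology}, 'n::finite) chart set" +
  fixes br :: "('m \<Rightarrow> complex) \<Rightarrow> ('m \<Rightarrow> complex) \<Rightarrow> 'm \<Rightarrow> complex"
    and C :: "nat \<Rightarrow> ('m \<Rightarrow> complex) \<Rightarrow> ('m \<Rightarrow> complex) \<Rightarrow> 'm \<Rightarrow> complex"
  assumes star: "star_product A br C" and sep: "separation_of_variables A C"
begin

section \<open>Coefficient operators of the star product on open subsets\<close>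

lemma C_bidiff: "bidiff_op A (C r)"
  using star by (simp add: star_product_def)

definition C_coeffs :: "('m, 'n) chart \<Rightarrow> nat \<Rightarrow> nat \<Rightarrow>
    (('n + 'n) list \<Rightarrow> ('n + 'n) list \<Rightarrow> 'm \<Rightarrow> complex) \<Rightarrow> bool" where
  "C_coeffs c r k a \<longleftrightarrow> (\<forall>I J. smooth_fun A (fst c) (a I J)) \<and>
    (\<forall>V f g. open V \<longrightarrow> smooth_fun A V f \<longrightarrow> smooth_fun A V g \<longrightarrow>
      (\<forall>x\<in>V \<inter> fst c. C r f g x = (\<Sum>I | length I \<le> k. \<Sum>J | length J \<le> k.
         a I J x * chart_derivs c I f x * chart_derivs c J g x)))"

text \<open>\<open>bidiff_op\<close> gives one order for all charts, but coefficients chart by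
  chart. Fixing the order as a function of \<open>r\<close> alone is what later yields orders
  independent of chart and trivialization.\<close>

definition C_order :: "nat \<Rightarrow> nat" where
  "C_order r = (SOME k. \<forall>c\<in>A. \<exists>a. C_coeffs c r k a)"

lemma C_coeffs_exist:
  assumes "c \<in> A"
  shows "\<exists>a. C_coeffs c r (C_order r) a"
proof -
  have "\<exists>k. \<forall>c\<in>A. \<exists>a. C_coeffs c r k a"
    using C_bidiff[of r] unfolding bidiff_op_def C_coeffs_def .
  from someI_ex[OF this] show ?thesis
    unfolding C_order_def[symmetric] using assms by (rule bspec)
qed

lemma C_coeffsD:
  assumes "C_coeffs c r k a"
  shows "smooth_fun A (fst c) (a I J)"
    and "open V \<Longrightarrow> smooth_fun A V f \<Longrightarrow> smooth_fun A V g \<Longrightarrow> x \<in> V \<inter> fst c \<Longrightarrow>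
      C r f g x = (\<Sum>I | length I \<le> k. \<Sum>J | length J \<le> k.
         a I J x * chart_derivs c I f x * chart_derivs c J g x)"
  using assms unfolding C_coeffs_def by blast+

text \<open>Differential operators depend only on germs. All four functions are assumed smooth
  because a coefficient operator is prescribed only on functions that are smooth near the
  point.\<close>

lemma C_cong:
  assumes "open V" "x \<in> V" "smooth_fun A V f" "smooth_fun A V g"
    and "smooth_fun A V f'" "smooth_fun A V g'"
    and "\<And>y. y \<in> V \<Longrightarrow> f y = f' y" "\<And>y. y \<in> V \<Longrightarrow> g y = g' y"
  shows "C r f g x = C r f' g' x"
proof -
  obtain c where c: "c \<in> A" "x \<in> fst c" using chart_cover by blast
  obtain k a where "C_coeffs c r k a" using C_coeffs_exist[OF c(1)] by blast
  note a = C_coeffsD[OF this]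
  have x: "x \<in> V \<inter> fst c" using c assms by simp
  have "chart_derivs c I f x = chart_derivs c I f' x" "chart_derivs c I g x = chart_derivs c I g' x"
    for I
    by (rule chart_derivs_cong[OF c(1) assms(1) _ x]; use assms in simp)+
  then show ?thesis
    using a(2)[OF assms(1,3,4) x] a(2)[OF assms(1,5,6) x] by simp
qed

lemma C_smooth:
  assumes "open V" "smooth_fun A V f" "smooth_fun A V g"
  shows "smooth_fun A V (C r f g)"
proof (rule smooth_fun_local)
  fix x assume "x \<in> V"
  obtain c where c: "c \<in> A" "x \<in> fst c" using chart_cover by blast
  let ?W = "V \<inter> fst c"
  have W: "open ?W" using open_chart[OF c(1)] assms(1) by auto
  obtain k a where "C_coeffs c r k a" using C_coeffs_exist[OF c(1)] by blast
  note a = C_coeffsD[OF this]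
  have aW: "smooth_fun A ?W (a I J)" for I J
    using smooth_fun_subset[OF a(1)] by simp
  have "smooth_fun A ?W (\<lambda>x. \<Sum>I | length I \<le> k. \<Sum>J | length J \<le> k.
         a I J x * chart_derivs c I f x * chart_derivs c J g x)"
    by (intro smooth_fun_sum[OF W] smooth_fun_mult[OF W] aW chart_derivs_smooth[OF c(1)] assms)
  then have "smooth_fun A ?W (C r f g)"
    by (rule iffD1[OF smooth_fun_cong[OF W], rotated]) (use a(2)[OF assms] in simp)
  with W \<open>x \<in> V\<close> c show "\<exists>W. open W \<and> x \<in> W \<and> smooth_fun A W (C r f g)"
    by (intro exI[of _ ?W]) simp
qed

lemma C_sum_left:
  assumes "open V" "x \<in> V" "\<And>i. i \<in> K \<Longrightarrow> smooth_fun A V (f i)" "smooth_fun A V g"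
  shows "C r (\<lambda>y. \<Sum>i\<in>K. f i y) g x = (\<Sum>i\<in>K. C r (f i) g x)"
proof -
  obtain c where c: "c \<in> A" "x \<in> fst c" using chart_cover by blast
  have x: "x \<in> V \<inter> fst c" using c assms by simp
  obtain k a where "C_coeffs c r k a" using C_coeffs_exist[OF c(1)] by blast
  note a = C_coeffsD[OF this]
  note a = a(2)[OF assms(1) _ assms(4) x]
  have sm: "smooth_fun A V (\<lambda>y. \<Sum>i\<in>K. f i y)"
    by (intro smooth_fun_sum assms)
  have ds: "chart_derivs c I (\<lambda>y. \<Sum>i\<in>K. f i y) x = (\<Sum>i\<in>K. chart_derivs c I (f i) x)" for I
    by (rule chart_derivs_sum[OF c(1) assms(1) assms(3) x])
  have "C r (\<lambda>y. \<Sum>i\<in>K. f i y) g x = (\<Sum>I | length I \<le> k. \<Sum>J | length J \<le> k.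
      \<Sum>i\<in>K. a I J x * chart_derivs c I (f i) x * chart_derivs c J g x)"
    unfolding a[OF sm] ds by (simp add: sum_distrib_left sum_distrib_right)
  also have "\<dots> = (\<Sum>I | length I \<le> k. \<Sum>i\<in>K. \<Sum>J | length J \<le> k.
      a I J x * chart_derivs c I (f i) x * chart_derivs c J g x)"
    by (intro sum.cong refl sum.swap)
  also have "\<dots> = (\<Sum>i\<in>K. \<Sum>I | length I \<le> k. \<Sum>J | length J \<le> k.
      a I J x * chart_derivs c I (f i) x * chart_derivs c J g x)"
    by (rule sum.swap)
  also have "\<dots> = (\<Sum>i\<in>K. C r (f i) g x)"
    by (intro sum.cong refl a[symmetric] assms(3))
  finally show ?thesis .
qed

lemma C_sum_right:
  assumes "open V" "x \<in> V" "\<And>i. i \<in> K \<Longrightarrow> smooth_fun A V (g i)" "smooth_fun A V f"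
  shows "C r f (\<lambda>y. \<Sum>i\<in>K. g i y) x = (\<Sum>i\<in>K. C r f (g i) x)"
proof -
  obtain c where c: "c \<in> A" "x \<in> fst c" using chart_cover by blast
  have x: "x \<in> V \<inter> fst c" using c assms by simp
  obtain k a where "C_coeffs c r k a" using C_coeffs_exist[OF c(1)] by blast
  note a = C_coeffsD[OF this]
  note a = a(2)[OF assms(1,4) _ x]
  have sm: "smooth_fun A V (\<lambda>y. \<Sum>i\<in>K. g i y)"
    by (intro smooth_fun_sum assms)
  have ds: "chart_derivs c I (\<lambda>y. \<Sum>i\<in>K. g i y) x = (\<Sum>i\<in>K. chart_derivs c I (g i) x)" for I
    by (rule chart_derivs_sum[OF c(1) assms(1) assms(3) x])
  have "C r f (\<lambda>y. \<Sum>i\<in>K. g i y) x = (\<Sum>I | length I \<le> k. \<Sum>J | length J \<le> k.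
      \<Sum>i\<in>K. a I J x * chart_derivs c I f x * chart_derivs c J (g i) x)"
    unfolding a[OF sm] ds by (simp add: sum_distrib_left sum_distrib_right)
  also have "\<dots> = (\<Sum>I | length I \<le> k. \<Sum>i\<in>K. \<Sum>J | length J \<le> k.
      a I J x * chart_derivs c I f x * chart_derivs c J (g i) x)"
    by (intro sum.cong refl sum.swap)
  also have "\<dots> = (\<Sum>i\<in>K. \<Sum>I | length I \<le> k. \<Sum>J | length J \<le> k.
      a I J x * chart_derivs c I f x * chart_derivs c J (g i) x)"
    by (rule sum.swap)
  also have "\<dots> = (\<Sum>i\<in>K. C r f (g i) x)"
    by (intro sum.cong refl a[symmetric] assms(3))
  finally show ?thesis .
qed

lemma C_zero_left: "open V \<Longrightarrow> x \<in> V \<Longrightarrow> smooth_fun A V g \<Longrightarrow> C r (\<lambda>y. 0) g x = 0"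
  using C_sum_left[of V x "{}" _ g] by simp

lemma C_zero_right: "open V \<Longrightarrow> x \<in> V \<Longrightarrow> smooth_fun A V f \<Longrightarrow> C r f (\<lambda>y. 0) x = 0"
  using C_sum_right[of V x "{}" _ f] by simp

text \<open>The axiom concerns global functions. The extensions given by
  \<open>smooth_extension\<close> have the same germs at \<open>x\<close>, so by
  \<open>C_cong\<close> they compute the local value.\<close>

lemma C_0:
  assumes "open V" "x \<in> V" "smooth_fun A V f" "smooth_fun A V g"
  shows "C 0 f g x = f x * g x"
proof -
  obtain W ext where W: "open W" "x \<in> W" "W \<subseteq> V" and ext: "\<forall>f :: 'm \<Rightarrow> complex.
    smooth_fun A V f \<longrightarrow> smooth_fun A UNIV (ext f) \<and> (\<forall>y\<in>W. ext f y = f y)"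
    using smooth_extension[OF assms(1,2)] by (elim exE conjE)
  have f: "smooth_fun A UNIV (ext f)" "\<And>y. y \<in> W \<Longrightarrow> f y = ext f y"
    and g: "smooth_fun A UNIV (ext g)" "\<And>y. y \<in> W \<Longrightarrow> g y = ext g y"
    using ext assms(3,4) by auto
  have "C 0 f g x = C 0 (ext f) (ext g) x"
    by (rule C_cong[OF W(1,2) _ _ _ _ f(2) g(2)])
      (use W(3) assms(3,4) f(1) g(1) smooth_fun_subset subset_UNIV in metis)+
  also have "\<dots> = f x * g x"
    using star f g W(2) by (simp add: star_product_def)
  finally show ?thesis .
qed

section \<open>Formal series over open subsets\<close>

lemma formal_smooth_fconst: "open V \<Longrightarrow> smooth_fun A V f \<Longrightarrow> formal_smooth A V (fconst f)"
  unfolding formal_smooth_def fconst_def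
proof
  fix r assume "open V" "smooth_fun A V f"
  then show "smooth_fun A V (\<lambda>x. if r = 0 then f x else 0)"
    using smooth_fun_const by (cases "r = 0") simp_all
qed

lemma formal_smooth_subset: "formal_smooth A V f \<Longrightarrow> W \<subseteq> V \<Longrightarrow> formal_smooth A W f"
  unfolding formal_smooth_def using smooth_fun_subset by blast

lemma formal_smoothD: "formal_smooth A V f \<Longrightarrow> smooth_fun A V (f r)"
  by (simp add: formal_smooth_def)

lemma formal_smooth_cong:
  assumes "open V" "\<And>r x. x \<in> V \<Longrightarrow> f r x = g r x"
  shows "formal_smooth A V f \<longleftrightarrow> formal_smooth A V g"
  using smooth_fun_cong[OF assms(1), of "f r" "g r" for r] assms(2) by (simp add: formal_smooth_def)

lemma star_cong:
  assumes "open V" "x \<in> V" "formal_smooth A V f" "formal_smooth A V g"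
    and "formal_smooth A V f'" "formal_smooth A V g'"
    and "\<And>r y. y \<in> V \<Longrightarrow> f r y = f' r y" "\<And>r y. y \<in> V \<Longrightarrow> g r y = g' r y"
  shows "star C f g n x = star C f' g' n x"
  unfolding star_def
  by (intro sum.cong refl C_cong[OF assms(1,2)] formal_smoothD assms(3-8))

lemma star_smooth:
  assumes "open V" "formal_smooth A V f" "formal_smooth A V g"
  shows "formal_smooth A V (star C f g)"
  unfolding formal_smooth_def star_def
  by (intro allI smooth_fun_sum C_smooth formal_smoothD assms)

lemma star_sum_left:
  assumes "open V" "x \<in> V" "\<And>k. k \<in> K \<Longrightarrow> formal_smooth A V (f k)" "formal_smooth A V g"
  shows "star C (\<lambda>r y. \<Sum>k\<in>K. f k r y) g n x = (\<Sum>k\<in>K. star C (f k) g n x)"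
proof -
  have "C r (\<lambda>y. \<Sum>k\<in>K. f k i y) (g j) x = (\<Sum>k\<in>K. C r (f k i) (g j) x)" for r i j
    by (intro C_sum_left[OF assms(1,2)] formal_smoothD assms(3,4))
  then show ?thesis
    unfolding star_def by (simp add: sum.swap[of _ K])
qed

lemma star_sum_right:
  assumes "open V" "x \<in> V" "\<And>k. k \<in> K \<Longrightarrow> formal_smooth A V (g k)" "formal_smooth A V f"
  shows "star C f (\<lambda>r y. \<Sum>k\<in>K. g k r y) n x = (\<Sum>k\<in>K. star C f (g k) n x)"
proof -
  have "C r (f i) (\<lambda>y. \<Sum>k\<in>K. g k j y) x = (\<Sum>k\<in>K. C r (f i) (g k j) x)" for r i j
    by (intro C_sum_right[OF assms(1,2)] formal_smoothD assms(3,4))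
  then show ?thesis
    unfolding star_def by (simp add: sum.swap[of _ K])
qed

lemma star_fconst_left:
  assumes "open V" "x \<in> V" "formal_smooth A V g"
  shows "star C (fconst f) g n x = (\<Sum>r\<le>n. C r f (g (n - r)) x)"
proof -
  have "C r (fconst f i) (g j) x = (if i = 0 then C r f (g j) x else 0)" for r i j
    using C_zero_left[OF assms(1,2) formal_smoothD[OF assms(3)]] by (simp add: fconst_def)
  then show ?thesis
    by (simp add: star_def)
qed

lemma star_fconst_right:
  assumes "open V" "x \<in> V" "formal_smooth A V f"
  shows "star C f (fconst g) n x = (\<Sum>r\<le>n. C r (f (n - r)) g x)"
proof -
  have "C r (f i) (fconst g j) x = (if j = 0 then C r (f i) g x else 0)" for r i j
    using C_zero_right[OF assms(1,2) formal_smoothD[OF assms(3)]] by (simp add: fconst_def)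
  then have "star C f (fconst g) n x =
      (\<Sum>r\<le>n. \<Sum>i\<le>n - r. if i = n - r then C r (f i) g x else 0)"
    unfolding star_def by (intro sum.cong) auto
  then show ?thesis by simp
qed

text \<open>Linearity over \<nu>: each coefficient \<open>f i\<close> enters as a series of its own,
  shifted by \<open>i\<close>. This reduces products of series to products with a single coefficient
  on the left.\<close>

lemma star_expand_left:
  assumes "open V" "x \<in> V" "formal_smooth A V g"
  shows "star C f g n x = (\<Sum>i\<le>n. star C (fconst (f i)) g (n - i) x)"
  unfolding star_fconst_left[OF assms]
  unfolding star_def diff_diff_left
  by (subst sum_triangle_swap) (simp add: add.commute)

lemma star_expand_right:
  assumes "open V" "x \<in> V" "formal_smooth A V f"
  shows "star C f g n x = (\<Sum>j\<le>n. star C f (fconst (g j)) (n - j) x)"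
proof -
  have "star C f g n x = (\<Sum>r\<le>n. \<Sum>j\<le>n - r. C r (f (n - r - j)) (g j) x)"
    unfolding star_def
    by (intro sum.cong refl sum_antidiagonal_flip)
  also have "\<dots> = (\<Sum>j\<le>n. \<Sum>r\<le>n - j. C r (f (n - j - r)) (g j) x)"
    by (subst sum_triangle_swap) (simp add: add.commute)
  finally show ?thesis by (simp add: star_fconst_right[OF assms])
qed

text \<open>Linearity over \<nu> for a first factor that is a sum of shifted formal series
  \<open>p i\<close>. The factor \<open>(F u) * v\<close> of the local product takes this shape once
  \<open>F\<close> is split into its coefficients.\<close>

lemma star_shift_left:
  assumes "open V" "x \<in> V" "\<And>i. formal_smooth A V (p i)" "formal_smooth A V g"
    and "formal_smooth A V f" "\<And>m y. y \<in> V \<Longrightarrow> f m y = (\<Sum>i\<le>m. p i (m - i) y)"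
  shows "star C f g n x = (\<Sum>i\<le>n. star C (p i) g (n - i) x)"
proof -
  have "C r (f m) (g j) x = (\<Sum>i\<le>m. C r (p i (m - i)) (g j) x)" for r m j
  proof -
    have "C r (f m) (g j) x = C r (\<lambda>y. \<Sum>i\<le>m. p i (m - i) y) (g j) x"
      by (intro C_cong[OF assms(1,2)] smooth_fun_sum formal_smoothD assms refl)
    also have "\<dots> = (\<Sum>i\<le>m. C r (p i (m - i)) (g j) x)"
      by (intro C_sum_left[OF assms(1,2)] formal_smoothD assms)
    finally show ?thesis .
  qed
  then have "star C f g n x =
      (\<Sum>r\<le>n. \<Sum>m\<le>n - r. \<Sum>i\<le>m. C r (p i (m - i)) (g (n - r - m)) x)"
    by (simp add: star_def)
  also have "\<dots> = (\<Sum>r\<le>n. \<Sum>i\<le>n - r. \<Sum>k\<le>n - r - i. C r (p i k) (g (n - r - i - k)) x)"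
    by (intro sum.cong refl sum_triangle_diff)
  also have "\<dots> = (\<Sum>i\<le>n. \<Sum>r\<le>n - i. \<Sum>k\<le>n - r - i. C r (p i k) (g (n - r - i - k)) x)"
    by (rule sum_triangle_swap)
  also have "\<dots> = (\<Sum>i\<le>n. star C (p i) g (n - i) x)"
    by (simp add: star_def ac_simps)
  finally show ?thesis .
qed

text \<open>As for \<open>C_0\<close>, but the inner products have to agree with those of the
  extensions on a whole neighbourhood, since the outer product differentiates them; the common
  \<open>W\<close> of \<open>smooth_extension\<close> provides it.\<close>

lemma star_assoc:
  assumes "open V" "x \<in> V" "formal_smooth A V f" "formal_smooth A V g" "formal_smooth A V h"
  shows "star C (star C f g) h n x = star C f (star C g h) n x"
proof -
  obtain W ext where W: "open W" "x \<in> W" "W \<subseteq> V" and ext: "\<forall>f :: 'm \<Rightarrow> complex.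
    smooth_fun A V f \<longrightarrow> smooth_fun A UNIV (ext f) \<and> (\<forall>y\<in>W. ext f y = f y)"
    using smooth_extension[OF assms(1,2)] by (elim exE conjE)
  have ext': "formal_smooth A UNIV (\<lambda>r. ext (F r))" "formal_smooth A W F"
    "formal_smooth A W (\<lambda>r. ext (F r))" "\<And>r y. y \<in> W \<Longrightarrow> F r y = ext (F r) y"
    if F: "formal_smooth A V F" for F
  proof -
    show 1: "formal_smooth A UNIV (\<lambda>r. ext (F r))"
      using F ext by (simp add: formal_smooth_def)
    show "formal_smooth A W F" by (rule formal_smooth_subset[OF F W(3)])
    show "formal_smooth A W (\<lambda>r. ext (F r))" by (rule formal_smooth_subset[OF 1]) simp
    show "F r y = ext (F r) y" if "y \<in> W" for r y
      using ext F that by (simp add: formal_smooth_def)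
  qed
  note f = ext'[OF assms(3)] and g = ext'[OF assms(4)] and h = ext'[OF assms(5)]
  have fg: "star C f g r y = star C (\<lambda>r. ext (f r)) (\<lambda>r. ext (g r)) r y" if "y \<in> W" for r y
    by (rule star_cong[OF W(1) that f(2) g(2) f(3) g(3) f(4) g(4)])
  have gh: "star C g h r y = star C (\<lambda>r. ext (g r)) (\<lambda>r. ext (h r)) r y" if "y \<in> W" for r y
    by (rule star_cong[OF W(1) that g(2) h(2) g(3) h(3) g(4) h(4)])
  note sm = star_smooth[OF W(1)]
  have "star C (star C f g) h n x =
      star C (star C (\<lambda>r. ext (f r)) (\<lambda>r. ext (g r))) (\<lambda>r. ext (h r)) n x"
    by (rule star_cong[OF W(1,2) sm[OF f(2) g(2)] h(2) sm[OF f(3) g(3)] h(3) fg h(4)])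
  also have "\<dots> = star C (\<lambda>r. ext (f r)) (star C (\<lambda>r. ext (g r)) (\<lambda>r. ext (h r))) n x"
    using star f(1) g(1) h(1) by (simp add: star_product_def)
  also have "\<dots> = star C f (star C g h) n x"
    by (rule star_cong[OF W(1,2) f(2) sm[OF g(2) h(2)] f(3) sm[OF g(3) h(3)] f(4) gh, symmetric])
  finally show ?thesis .
qed

text \<open>For series with a single coefficient the star product at order \<open>n\<close> is just
  \<open>C n\<close>; separation of variables therefore says that all higher coefficient operators
  vanish on such a pair.\<close>

lemma C_separation:
  assumes "open V" "x \<in> V" "smooth_fun A V f" "smooth_fun A V g"
    and "holomorphic_fun A V f \<or> antiholomorphic_fun A V g"
  shows "C n f g x = (if n = 0 then f x * g x else 0)"
proof -
  have "star C (fconst f) (fconst g) n x = (\<Sum>r\<le>n. C r f (fconst g (n - r)) x)"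
    by (rule star_fconst_left[OF assms(1,2) formal_smooth_fconst[OF assms(1,4)]])
  also have "\<dots> = (\<Sum>r\<le>n. if r = n then C r f g x else 0)"
    using C_zero_right[OF assms(1-3)] by (intro sum.cong) (auto simp: fconst_def)
  also have "\<dots> = C n f g x" by simp
  finally have "C n f g x = fconst (\<lambda>y. f y * g y) n x"
    using sep[unfolded separation_of_variables_def, rule_format, OF assms(1,3,4,5,2)] by simp
  then show ?thesis by (simp add: fconst_def)
qed

lemma star_holomorphic_left:
  assumes "open V" "x \<in> V" "holomorphic_fun A V f" "formal_smooth A V g"
  shows "star C (fconst f) g n x = f x * g n x"
proof -
  have "smooth_fun A V f" using assms(3) by (simp add: holomorphic_fun_def)
  then have "C r f (g j) x = (if r = 0 then f x * g j x else 0)" for r j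
    using C_separation[OF assms(1,2) _ formal_smoothD[OF assms(4)]] assms(3) by blast
  then show ?thesis by (simp add: star_fconst_left[OF assms(1,2,4)])
qed

lemma star_antiholomorphic_right:
  assumes "open V" "x \<in> V" "antiholomorphic_fun A V g" "formal_smooth A V f"
  shows "star C f (fconst g) n x = f n x * g x"
proof -
  have "smooth_fun A V g" using assms(3) by (simp add: antiholomorphic_fun_def)
  then have "C r (f j) g x = (if r = 0 then f j x * g x else 0)" for r j
    using C_separation[OF assms(1,2) formal_smoothD[OF assms(4)]] assms(3) by blast
  then show ?thesis by (simp add: star_fconst_right[OF assms(1,2,4)])
qed

lemma holomorphic_fun_const: "open V \<Longrightarrow> holomorphic_fun A V (\<lambda>x. a)"
  by (simp add: holomorphic_fun_def smooth_fun_const chart_deriv_const)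

lemma antiholomorphic_fun_const: "open V \<Longrightarrow> antiholomorphic_fun A V (\<lambda>x. a)"
  by (simp add: antiholomorphic_fun_def smooth_fun_const chart_deriv_const)

lemma antiholomorphic_fun_cnj:
  assumes "open V" "holomorphic_fun A V f"
  shows "antiholomorphic_fun A V (\<lambda>x. cnj (f x))"
proof -
  have f: "smooth_fun A V f" using assms(2) by (simp add: holomorphic_fun_def)
  have "smooth_fun A V (\<lambda>x. cnj (f x))"
    by (rule smooth_fun_bounded_linear[OF bounded_linear_cnj assms(1) f])
  moreover have "chart_deriv c (Inl k) (\<lambda>y. cnj (f y)) x = 0" if "c \<in> A" "x \<in> V \<inter> fst c" for c k x
    using chart_deriv_cnj[OF that(1) f f that(2)] assms(2) that by (simp add: holomorphic_fun_def)
  ultimately show ?thesis by (simp add: antiholomorphic_fun_def)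
qed

section \<open>The matrix star product over open subsets\<close>

lemma formal_smooth_mat:
  fixes F :: "nat \<Rightarrow> 'm \<Rightarrow> complex^'k^'l"
  assumes "open V"
  shows "formal_smooth A V F \<longleftrightarrow> (\<forall>i j. formal_smooth A V (\<lambda>r y. F r y $ i $ j))"
  unfolding formal_smooth_def smooth_fun_mat[OF assms] by blast

lemma formal_smooth_entry:
  fixes F :: "nat \<Rightarrow> 'm \<Rightarrow> complex^'k^'l"
  shows "open V \<Longrightarrow> formal_smooth A V F \<Longrightarrow> formal_smooth A V (\<lambda>r y. F r y $ i $ j)"
  using formal_smooth_mat by blast

lemma smooth_fun_matrix_mult:
  fixes F :: "'m \<Rightarrow> complex^'k^'l" and G :: "'m \<Rightarrow> complex^'j^'k"
  assumes "open V" "smooth_fun A V F" "smooth_fun A V G"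
  shows "smooth_fun A V (\<lambda>x. F x ** G x)"
proof -
  have "smooth_fun A V (\<lambda>x. F x $ i $ k)" "smooth_fun A V (\<lambda>x. G x $ k $ j)" for i j k
    using assms(2,3) smooth_fun_mat[OF assms(1)] by blast+
  then show ?thesis
    unfolding smooth_fun_mat[OF assms(1)] matrix_matrix_mult_def vec_lambda_beta
    by (intro allI smooth_fun_sum[OF assms(1)] smooth_fun_mult[OF assms(1)])
qed

lemma formal_smooth_matrix_mult_right:
  fixes F :: "nat \<Rightarrow> 'm \<Rightarrow> complex^'k^'l" and u :: "'m \<Rightarrow> complex^'j^'k"
  assumes "open V" "formal_smooth A V F" "smooth_fun A V u"
  shows "formal_smooth A V (\<lambda>r x. F r x ** u x)"
  unfolding formal_smooth_def
  by (intro allI smooth_fun_matrix_mult[OF assms(1) formal_smoothD[OF assms(2)] assms(3)])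

lemma fconst_entry: "(\<lambda>r y. fconst F r y $ i $ j) = fconst (\<lambda>y. F y $ i $ j)"
  by (auto simp: fconst_def fun_eq_iff)

lemma mstar_cong:
  fixes F G F' G' :: "nat \<Rightarrow> 'm \<Rightarrow> complex^'d^'d"
  assumes "open V" "x \<in> V" "formal_smooth A V F" "formal_smooth A V G"
    and "\<And>r y. y \<in> V \<Longrightarrow> F r y = F' r y" "\<And>r y. y \<in> V \<Longrightarrow> G r y = G' r y"
  shows "mstar C F G n x = mstar C F' G' n x"
proof -
  have F': "formal_smooth A V F'" by (rule iffD1[OF formal_smooth_cong[OF assms(1,5)] assms(3)])
  have G': "formal_smooth A V G'" by (rule iffD1[OF formal_smooth_cong[OF assms(1,6)] assms(4)])
  note e = formal_smooth_entry[OF assms(1)]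
  have "star C (\<lambda>r y. F r y $ i $ k) (\<lambda>r y. G r y $ k $ j) n x =
      star C (\<lambda>r y. F' r y $ i $ k) (\<lambda>r y. G' r y $ k $ j) n x" for i j k
    by (rule star_cong[OF assms(1,2) e[OF assms(3)] e[OF assms(4)] e[OF F'] e[OF G']])
      (simp_all add: assms(5,6))
  then show ?thesis by (simp add: mstar_def)
qed

lemma mstar_smooth:
  fixes F G :: "nat \<Rightarrow> 'm \<Rightarrow> complex^'d^'d"
  assumes "open V" "formal_smooth A V F" "formal_smooth A V G"
  shows "formal_smooth A V (mstar C F G)"
proof -
  note e = formal_smooth_entry[OF assms(1)]
  have "smooth_fun A V (star C (\<lambda>r y. F r y $ i $ k) (\<lambda>r y. G r y $ k $ j) n)" for i j k n
    by (rule formal_smoothD[OF star_smooth[OF assms(1) e[OF assms(2)] e[OF assms(3)]]])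
  then show ?thesis
    unfolding formal_smooth_def smooth_fun_mat[OF assms(1)] mstar_def vec_lambda_beta
    by (intro allI smooth_fun_sum[OF assms(1)])
qed

lemma mstar_assoc:
  fixes F G H :: "nat \<Rightarrow> 'm \<Rightarrow> complex^'d^'d"
  assumes "open V" "x \<in> V" "formal_smooth A V F" "formal_smooth A V G" "formal_smooth A V H"
  shows "mstar C (mstar C F G) H n x = mstar C F (mstar C G H) n x"
proof -
  let ?f = "\<lambda>i k r y. F r y $ i $ k" and ?g = "\<lambda>i k r y. G r y $ i $ k"
    and ?h = "\<lambda>i k r y. H r y $ i $ k"
  note f = formal_smooth_entry[OF assms(1,3)]
    and g = formal_smooth_entry[OF assms(1,4)]
    and h = formal_smooth_entry[OF assms(1,5)]
  note sm = star_smooth[OF assms(1)]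
  have "mstar C (mstar C F G) H n x $ i $ j = mstar C F (mstar C G H) n x $ i $ j" for i j
  proof -
    have "mstar C (mstar C F G) H n x $ i $ j =
        (\<Sum>l\<in>UNIV. star C (\<lambda>r y. \<Sum>k\<in>UNIV. star C (?f i k) (?g k l) r y) (?h l j) n x)"
      by (simp add: mstar_def)
    also have "\<dots> = (\<Sum>l\<in>UNIV. \<Sum>k\<in>UNIV. star C (star C (?f i k) (?g k l)) (?h l j) n x)"
      by (intro sum.cong refl star_sum_left[OF assms(1,2)] sm f g h)
    also have "\<dots> = (\<Sum>l\<in>UNIV. \<Sum>k\<in>UNIV. star C (?f i k) (star C (?g k l) (?h l j)) n x)"
      by (intro sum.cong refl star_assoc[OF assms(1,2)] f g h)
    also have "\<dots> = (\<Sum>k\<in>UNIV. \<Sum>l\<in>UNIV. star C (?f i k) (star C (?g k l) (?h l j)) n x)"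
      by (rule sum.swap)
    also have "\<dots> = (\<Sum>k\<in>UNIV. star C (?f i k) (\<lambda>r y. \<Sum>l\<in>UNIV. star C (?g k l) (?h l j) r y) n x)"
      by (intro sum.cong refl star_sum_right[OF assms(1,2), symmetric] sm f g h)
    also have "\<dots> = mstar C F (mstar C G H) n x $ i $ j"
      by (simp add: mstar_def)
    finally show ?thesis .
  qed
  then show ?thesis by (simp add: vec_eq_iff)
qed

lemma mstar_holomorphic_left:
  fixes a :: "'m \<Rightarrow> complex^'d^'d"
  assumes "open V" "x \<in> V" "\<And>i j. holomorphic_fun A V (\<lambda>y. a y $ i $ j)" "formal_smooth A V F"
  shows "mstar C (fconst a) F n x = a x ** F n x"
  unfolding mstar_def fconst_entry matrix_matrix_mult_def
  using star_holomorphic_left[OF assms(1,2,3) formal_smooth_entry[OF assms(1,4)]] by simp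

lemma mstar_antiholomorphic_right:
  fixes b :: "'m \<Rightarrow> complex^'d^'d"
  assumes "open V" "x \<in> V" "\<And>i j. antiholomorphic_fun A V (\<lambda>y. b y $ i $ j)" "formal_smooth A V F"
  shows "mstar C F (fconst b) n x = F n x ** b x"
  unfolding mstar_def fconst_entry matrix_matrix_mult_def
  using star_antiholomorphic_right[OF assms(1,2,3) formal_smooth_entry[OF assms(1,4)]] by simp

lemma mstar_0:
  fixes F G :: "nat \<Rightarrow> 'm \<Rightarrow> complex^'d^'d"
  assumes "open V" "x \<in> V" "formal_smooth A V F" "formal_smooth A V G"
  shows "mstar C F G 0 x = F 0 x ** G 0 x"
  unfolding mstar_def matrix_matrix_mult_def star_def
  using C_0[OF assms(1,2) formal_smoothD[OF formal_smooth_entry[OF assms(1,3)]]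
      formal_smoothD[OF formal_smooth_entry[OF assms(1,4)]]] by simp

lemma mstar_expand_left:
  fixes F G :: "nat \<Rightarrow> 'm \<Rightarrow> complex^'d^'d"
  assumes "open V" "x \<in> V" "formal_smooth A V G"
  shows "mstar C F G n x = (\<Sum>i\<le>n. mstar C (fconst (F i)) G (n - i) x)"
  unfolding vec_eq_iff
proof (intro allI)
  fix i j
  have "mstar C F G n x $ i $ j = (\<Sum>k\<in>UNIV. \<Sum>m\<le>n.
      star C (fconst (\<lambda>y. F m y $ i $ k)) (\<lambda>r y. G r y $ k $ j) (n - m) x)"
    unfolding mstar_def vec_lambda_beta
    by (intro sum.cong refl star_expand_left[OF assms(1,2) formal_smooth_entry[OF assms(1,3)]])
  also have "\<dots> = (\<Sum>m\<le>n. mstar C (fconst (F m)) G (n - m) x) $ i $ j"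
    by (subst sum.swap) (simp add: mstar_def fconst_entry)
  finally show "mstar C F G n x $ i $ j = (\<Sum>m\<le>n. mstar C (fconst (F m)) G (n - m) x) $ i $ j" .
qed

lemma mstar_expand_right:
  fixes F G :: "nat \<Rightarrow> 'm \<Rightarrow> complex^'d^'d"
  assumes "open V" "x \<in> V" "formal_smooth A V F"
  shows "mstar C F G n x = (\<Sum>i\<le>n. mstar C F (fconst (G i)) (n - i) x)"
  unfolding vec_eq_iff
proof (intro allI)
  fix i j
  have "mstar C F G n x $ i $ j = (\<Sum>k\<in>UNIV. \<Sum>m\<le>n.
      star C (\<lambda>r y. F r y $ i $ k) (fconst (\<lambda>y. G m y $ k $ j)) (n - m) x)"
    unfolding mstar_def vec_lambda_beta
    by (intro sum.cong refl star_expand_right[OF assms(1,2) formal_smooth_entry[OF assms(1,3)]])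
  also have "\<dots> = (\<Sum>m\<le>n. mstar C F (fconst (G m)) (n - m) x) $ i $ j"
    by (subst sum.swap) (simp add: mstar_def fconst_entry)
  finally show "mstar C F G n x $ i $ j = (\<Sum>m\<le>n. mstar C F (fconst (G m)) (n - m) x) $ i $ j" .
qed

lemma mstar_shift_left:
  fixes F G :: "nat \<Rightarrow> 'm \<Rightarrow> complex^'d^'d"
  assumes "open V" "x \<in> V" "\<And>i. formal_smooth A V (P i)" "formal_smooth A V G"
    and "formal_smooth A V F" "\<And>m y. y \<in> V \<Longrightarrow> F m y = (\<Sum>i\<le>m. P i (m - i) y)"
  shows "mstar C F G n x = (\<Sum>i\<le>n. mstar C (P i) G (n - i) x)"
  unfolding vec_eq_iff
proof (intro allI)
  fix i j
  note e = formal_smooth_entry[OF assms(1)]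
  have "star C (\<lambda>r y. F r y $ i $ k) (\<lambda>r y. G r y $ k $ j) n x =
      (\<Sum>m\<le>n. star C (\<lambda>r y. P m r y $ i $ k) (\<lambda>r y. G r y $ k $ j) (n - m) x)" for k
    by (rule star_shift_left[OF assms(1,2) e[OF assms(3)] e[OF assms(4)] e[OF assms(5)]])
      (simp add: assms(6))
  then have "mstar C F G n x $ i $ j = (\<Sum>k\<in>UNIV. \<Sum>m\<le>n.
      star C (\<lambda>r y. P m r y $ i $ k) (\<lambda>r y. G r y $ k $ j) (n - m) x)"
    by (simp add: mstar_def)
  also have "\<dots> = (\<Sum>m\<le>n. mstar C (P m) G (n - m) x) $ i $ j"
    by (subst sum.swap) (simp add: mstar_def)
  finally show "mstar C F G n x $ i $ j = (\<Sum>m\<le>n. mstar C (P m) G (n - m) x) $ i $ j" .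
qed

text \<open>Cutting off to \<open>0\<close> outside \<open>V\<close> turns identities on \<open>V\<close> into equations between functions,
  so that they can be used inside products.\<close>

definition cutoff :: "'m set \<Rightarrow> (nat \<Rightarrow> 'm \<Rightarrow> complex^'d^'d) \<Rightarrow> nat \<Rightarrow> 'm \<Rightarrow> complex^'d^'d" where
  "cutoff V F = (\<lambda>n x. if x \<in> V then F n x else 0)"

definition mstar_on ::
  "'m set \<Rightarrow> (nat \<Rightarrow> 'm \<Rightarrow> complex^'d^'d) \<Rightarrow> (nat \<Rightarrow> 'm \<Rightarrow> complex^'d^'d) \<Rightarrow> nat \<Rightarrow> 'm \<Rightarrow> complex^'d^'d"
  where "mstar_on V F G = cutoff V (mstar C F G)"

lemma cutoff_eqI: "(\<And>n x. x \<in> V \<Longrightarrow> F n x = G n x) \<Longrightarrow> cutoff V F = cutoff V G"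
  by (auto simp: cutoff_def fun_eq_iff)

lemma cutoff_eqD: "cutoff V F = cutoff V G \<Longrightarrow> x \<in> V \<Longrightarrow> F n x = G n x"
  by (metis cutoff_def)

lemma cutoff_apply: "x \<in> V \<Longrightarrow> cutoff V F n x = F n x"
  by (simp add: cutoff_def)

lemma cutoff_cutoff: "cutoff V (cutoff V F) = cutoff V F"
  by (auto simp: cutoff_def fun_eq_iff)

lemma formal_smooth_cutoff:
  "open V \<Longrightarrow> formal_smooth A V (cutoff V F) \<longleftrightarrow> formal_smooth A V F"
  by (rule formal_smooth_cong) (auto simp: cutoff_def)

context
  fixes V :: "'m set"
  assumes V: "open V"
begin

lemma mstar_on_smooth:
  "formal_smooth A V F \<Longrightarrow> formal_smooth A V G \<Longrightarrow> formal_smooth A V (mstar_on V F G)"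
  unfolding mstar_on_def formal_smooth_cutoff[OF V] by (rule mstar_smooth[OF V])

lemma mstar_on_cong:
  assumes "formal_smooth A V F" "formal_smooth A V G"
    and "cutoff V F = cutoff V F'" "cutoff V G = cutoff V G'"
  shows "mstar_on V F G = mstar_on V F' G'"
  unfolding mstar_on_def
  by (rule cutoff_eqI, rule mstar_cong[OF V _ assms(1,2)]) (use cutoff_eqD assms(3,4) in blast)+

lemma mstar_on_cutoff_left:
  "formal_smooth A V F \<Longrightarrow> formal_smooth A V G \<Longrightarrow> mstar_on V (cutoff V F) G = mstar_on V F G"
  by (rule mstar_on_cong) (simp_all add: formal_smooth_cutoff[OF V] cutoff_cutoff)

lemma mstar_on_cutoff_right:
  "formal_smooth A V F \<Longrightarrow> formal_smooth A V G \<Longrightarrow> mstar_on V F (cutoff V G) = mstar_on V F G"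
  by (rule mstar_on_cong) (simp_all add: formal_smooth_cutoff[OF V] cutoff_cutoff)

lemma mstar_on_assoc:
  assumes "formal_smooth A V F" "formal_smooth A V G" "formal_smooth A V H"
  shows "mstar_on V (mstar_on V F G) H = mstar_on V F (mstar_on V G H)"
proof -
  note s = mstar_smooth[OF V]
  have "mstar_on V (mstar_on V F G) H = mstar_on V (mstar C F G) H"
    unfolding mstar_on_def[of V F G] by (rule mstar_on_cutoff_left[OF s[OF assms(1,2)] assms(3)])
  also have "\<dots> = mstar_on V F (mstar C G H)"
    unfolding mstar_on_def by (rule cutoff_eqI, rule mstar_assoc[OF V _ assms])
  also have "\<dots> = mstar_on V F (mstar_on V G H)"
    unfolding mstar_on_def[of V G H]
    by (rule mstar_on_cutoff_right[OF assms(1) s[OF assms(2,3)], symmetric])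
  finally show ?thesis .
qed

lemma mstar_on_holomorphic_left:
  assumes "\<And>i j. holomorphic_fun A V (\<lambda>y. a y $ i $ j)" "formal_smooth A V F"
  shows "mstar_on V (fconst a) F = cutoff V (\<lambda>n x. a x ** F n x)"
  unfolding mstar_on_def by (rule cutoff_eqI, rule mstar_holomorphic_left[OF V _ assms])

lemma mstar_on_antiholomorphic_right:
  assumes "\<And>i j. antiholomorphic_fun A V (\<lambda>y. b y $ i $ j)" "formal_smooth A V F"
  shows "mstar_on V F (fconst b) = cutoff V (\<lambda>n x. F n x ** b x)"
  unfolding mstar_on_def by (rule cutoff_eqI, rule mstar_antiholomorphic_right[OF V _ assms])

text \<open>Constants are holomorphic, so the unit law on \<open>V\<close> is an instance of
  separation of variables.\<close>

lemma mstar_on_one_left: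
  assumes "formal_smooth A V F"
  shows "mstar_on V (fconst (\<lambda>_. mat 1)) F = cutoff V F"
  using mstar_on_holomorphic_left[OF holomorphic_fun_const[OF V] assms, of "mat 1"] by simp

lemma mstar_on_one_right:
  assumes "formal_smooth A V F"
  shows "mstar_on V F (fconst (\<lambda>_. mat 1)) = cutoff V F"
  using mstar_on_antiholomorphic_right[OF antiholomorphic_fun_const[OF V] assms, of "mat 1"] by simp

end

end

section \<open>The product on one trivialization\<close>

lemma sum_matrix_mult_right: "(\<Sum>i\<in>I. f i) ** (M :: complex^'k^'l) = (\<Sum>i\<in>I. f i ** M)"
  by (simp add: vec_eq_iff matrix_matrix_mult_def sum_distrib_right sum.swap[of _ _ I])

context star_manifold
begin

lemma star_inverse_subset:
  "star_inverse A C V u v \<Longrightarrow> W \<subseteq> V \<Longrightarrow> star_inverse A C W u v"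
  unfolding star_inverse_def using formal_smooth_subset by blast

context
  fixes V :: "'m set" and u :: "'m \<Rightarrow> complex^'d^'d" and v :: "nat \<Rightarrow> 'm \<Rightarrow> complex^'d^'d"
  assumes V: "open V" and u: "smooth_fun A V u" and v: "star_inverse A C V u v"
begin

lemma star_inverse_smooth: "formal_smooth A V v"
  using v by (simp add: star_inverse_def)

lemma fconst_u_smooth: "formal_smooth A V (fconst u)"
  by (rule formal_smooth_fconst[OF V u])

text \<open>At order 0 star multiplication is pointwise, so \<open>v 0\<close> is the pointwise
  inverse of \<open>u\<close>; invertibility of \<open>u\<close> and smoothness of its inverse are
  read off from \<open>v\<close>.\<close>

lemma star_inverse_0:
  assumes "x \<in> V"
  shows "u x ** v 0 x = mat 1" "v 0 x ** u x = mat 1"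
  using mstar_0[OF V assms fconst_u_smooth star_inverse_smooth]
    mstar_0[OF V assms star_inverse_smooth fconst_u_smooth] v assms
  by (simp_all add: star_inverse_def fconst_def)

lemma matrix_inv_eq:
  assumes "x \<in> V"
  shows "matrix_inv (u x) = v 0 x"
proof -
  have "u x ** matrix_inv (u x) = mat 1"
    unfolding matrix_inv_def by (rule someI2[of _ "v 0 x"]) (simp_all add: star_inverse_0[OF assms])
  then show ?thesis
    by (metis star_inverse_0(2)[OF assms] matrix_mul_assoc matrix_mul_lid matrix_mul_rid)
qed

lemma matrix_inv_u:
  assumes "x \<in> V"
  shows "M ** u x ** matrix_inv (u x) = (M :: complex^'d^'d)" "M ** matrix_inv (u x) ** u x = M"
  by (simp_all add: matrix_inv_eq[OF assms] star_inverse_0[OF assms] flip: matrix_mul_assoc)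

lemma matrix_inv_smooth: "smooth_fun A V (\<lambda>x. matrix_inv (u x))"
  by (subst smooth_fun_cong[OF V matrix_inv_eq]) (auto intro: formal_smoothD[OF star_inverse_smooth])

lemma mstar_on_u_v:
  "mstar_on V (fconst u) v = cutoff V (fconst (\<lambda>_. mat 1))"
  "mstar_on V v (fconst u) = cutoff V (fconst (\<lambda>_. mat 1))"
  using v by (auto intro!: cutoff_eqI simp: mstar_on_def star_inverse_def)

abbreviation mult_u :: "(nat \<Rightarrow> 'm \<Rightarrow> complex^'d^'d) \<Rightarrow> nat \<Rightarrow> 'm \<Rightarrow> complex^'d^'d" where
  "mult_u F \<equiv> \<lambda>r x. F r x ** u x"

lemma mult_u_smooth: "formal_smooth A V F \<Longrightarrow> formal_smooth A V (mult_u F)"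
  by (rule formal_smooth_matrix_mult_right[OF V _ u])

lemmas smooth_intros = mstar_on_smooth[OF V] mult_u_smooth star_inverse_smooth fconst_u_smooth
lemmas mstar_on_assoc_V = mstar_on_assoc[OF V]

lemma local_product_eq:
  assumes "formal_smooth A V F" "formal_smooth A V G" "x \<in> V"
  shows "local_product C u v F G n x =
    mstar_on V (mstar_on V (mult_u F) v) (mult_u G) n x ** matrix_inv (u x)"
proof -
  have "mstar_on V (mstar_on V (mult_u F) v) (mult_u G) =
      mstar_on V (mstar C (mult_u F) v) (mult_u G)"
    unfolding mstar_on_def[of V "mult_u F"]
    by (intro mstar_on_cutoff_left[OF V] mstar_smooth[OF V] smooth_intros assms)
  then show ?thesis
    using assms(3) by (simp add: local_product_def mstar_on_def cutoff_apply)
qed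

lemma local_product_smooth:
  assumes "formal_smooth A V F" "formal_smooth A V G"
  shows "formal_smooth A V (local_product C u v F G)"
  unfolding local_product_def
  by (intro formal_smooth_matrix_mult_right[OF V _ matrix_inv_smooth] mstar_smooth[OF V] smooth_intros assms)

text \<open>Multiplication by \<open>u\<close> absorbs the last factor of the local product: in the
  variables \<open>f = F u\<close> and \<open>g = G u\<close> the product is simply
  \<open>f * v * g\<close>.\<close>

lemma mult_u_local_product:
  assumes "formal_smooth A V F" "formal_smooth A V G"
  shows "cutoff V (mult_u (local_product C u v F G)) =
    mstar_on V (mstar_on V (mult_u F) v) (mult_u G)"
proof -
  have "cutoff V (mult_u (local_product C u v F G)) =
      cutoff V (mstar_on V (mstar_on V (mult_u F) v) (mult_u G))"
    by (rule cutoff_eqI) (simp add: local_product_eq[OF assms] matrix_inv_u)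
  then show ?thesis unfolding mstar_on_def cutoff_cutoff .
qed

lemma local_product_cong:
  assumes "formal_smooth A V F" "formal_smooth A V G" "x \<in> V"
    and "\<And>r y. y \<in> V \<Longrightarrow> F r y = F' r y" "\<And>r y. y \<in> V \<Longrightarrow> G r y = G' r y"
  shows "local_product C u v F G n x = local_product C u v F' G' n x"
proof -
  have "mstar C (mult_u F) v r y = mstar C (mult_u F') v r y" if "y \<in> V" for r y
    by (rule mstar_cong[OF V that]) (auto intro: smooth_intros assms(1) simp: assms(4))
  moreover have "formal_smooth A V (mstar C (mult_u F) v)"
    by (intro mstar_smooth[OF V] smooth_intros assms)
  ultimately have "mstar C (mstar C (mult_u F) v) (mult_u G) n x =
      mstar C (mstar C (mult_u F') v) (mult_u G') n x"
    by (intro mstar_cong[OF V assms(3)] smooth_intros assms) (simp_all add: assms(5))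
  then show ?thesis by (simp add: local_product_def)
qed

text \<open>After multiplication by \<open>u\<close>, both bracketings become
  \<open>f * v * g * v * h\<close> with \<open>f = F u\<close>, \<open>g = G u\<close> and
  \<open>h = H u\<close>.\<close>

lemma local_product_assoc:
  assumes "formal_smooth A V F" "formal_smooth A V G" "formal_smooth A V H" "x \<in> V"
  shows "local_product C u v (local_product C u v F G) H n x =
    local_product C u v F (local_product C u v G H) n x"
proof -
  note lp = local_product_smooth
  let ?p = "mstar_on V" and ?f = "mult_u F" and ?g = "mult_u G" and ?h = "mult_u H"
  have "?p (mult_u (local_product C u v F G)) v = ?p (?p (?p ?f v) ?g) v"
    by (subst mult_u_local_product[OF assms(1,2), symmetric])
      (intro mstar_on_cutoff_left[OF V, symmetric] smooth_intros lp assms)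
  moreover have "?p (?p ?f v) (mult_u (local_product C u v G H)) = ?p (?p ?f v) (?p (?p ?g v) ?h)"
    by (subst mult_u_local_product[OF assms(2,3), symmetric])
      (intro mstar_on_cutoff_right[OF V, symmetric] smooth_intros lp assms)
  moreover have "?p (?p (?p (?p ?f v) ?g) v) ?h = ?p (?p ?f v) (?p (?p ?g v) ?h)"
    by (simp add: mstar_on_assoc_V smooth_intros assms)
  ultimately show ?thesis
    by (simp add: local_product_eq lp assms)
qed

text \<open>At order 0 the middle factors \<open>u\<close> and \<open>v\<close> cancel pointwise, as
  does the last \<open>u\<close> against \<open>matrix_inv\<close>; what remains is the matrix
  product.\<close>

lemma local_product_0:
  assumes "formal_smooth A V F" "formal_smooth A V G" "x \<in> V"
  shows "local_product C u v F G 0 x = F 0 x ** G 0 x"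
proof -
  have "mstar C (mstar C (mult_u F) v) (mult_u G) 0 x = F 0 x ** u x ** v 0 x ** (G 0 x ** u x)"
    by (subst mstar_0[OF V assms(3)] mstar_0[OF V assms(3)]; (intro mstar_smooth[OF V] smooth_intros assms)?)+
      (rule refl)
  also have "\<dots> = F 0 x ** G 0 x ** u x"
    by (simp add: star_inverse_0[OF assms(3)] matrix_mul_assoc flip: matrix_mul_assoc[of "F 0 x" "u x"])
  finally show ?thesis by (simp add: local_product_def matrix_inv_u[OF assms(3)])
qed

lemma mult_u_fconst: "mult_u (fconst F) = fconst (\<lambda>x. F x ** u x)"
  by (auto simp: fconst_def fun_eq_iff)

text \<open>The local product is bilinear over \<nu>, hence determined by its values on series with
  a single coefficient; \<open>section_star\<close> has the same shape. For a single coefficient of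
  \<open>F\<close> the left factor \<open>(F u) * v\<close> is still a full series, which is why
  \<open>mstar_shift_left\<close> is used for it.\<close>

lemma local_product_expand:
  assumes "formal_smooth A V F" "formal_smooth A V G" "x \<in> V"
  shows "local_product C u v F G n x =
    (\<Sum>r\<le>n. \<Sum>i\<le>n - r. local_product C u v (fconst (F i)) (fconst (G (n - r - i))) r x)"
proof -
  let ?T = "\<lambda>F. mstar C (mult_u F) v"
  have fc: "formal_smooth A V (fconst (H i))" if "formal_smooth A V H"
    for i and H :: "nat \<Rightarrow> 'm \<Rightarrow> complex^'d^'d"
    by (rule formal_smooth_fconst[OF V formal_smoothD[OF that]])
  have T: "formal_smooth A V (?T H)" if "formal_smooth A V H" for H
    by (intro mstar_smooth[OF V] smooth_intros that)
  have T_expand: "?T F m y = (\<Sum>i\<le>m. ?T (fconst (F i)) (m - i) y)" if "y \<in> V" for m y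
    using mstar_expand_left[OF V that star_inverse_smooth, of "mult_u F"] by (simp add: mult_u_fconst)
  have "mstar C (?T F) (mult_u G) n x =
      (\<Sum>j\<le>n. mstar C (?T F) (mult_u (fconst (G j))) (n - j) x)"
    unfolding mult_u_fconst by (rule mstar_expand_right[OF V assms(3) T[OF assms(1)]])
  also have "\<dots> = (\<Sum>j\<le>n. \<Sum>i\<le>n - j.
      mstar C (?T (fconst (F i))) (mult_u (fconst (G j))) (n - j - i) x)"
    by (intro sum.cong refl mstar_shift_left[OF V assms(3) T[OF fc[OF assms(1)]] _ T[OF assms(1)] T_expand]
        mult_u_smooth fc assms(2))
  also have "\<dots> = (\<Sum>r\<le>n. \<Sum>i\<le>n - r.
      mstar C (?T (fconst (F i))) (mult_u (fconst (G (n - r - i)))) r x)"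
    by (rule sum_triangle_rotate)
  finally show ?thesis
    by (simp add: local_product_def sum_matrix_mult_right)
qed

section \<open>The isomorphism with the matrix algebra on one trivialization\<close>

definition to_matrix :: "(nat \<Rightarrow> 'm \<Rightarrow> complex^'d^'d) \<Rightarrow> nat \<Rightarrow> 'm \<Rightarrow> complex^'d^'d" where
  "to_matrix F = mstar C (mult_u F) v"

definition from_matrix :: "(nat \<Rightarrow> 'm \<Rightarrow> complex^'d^'d) \<Rightarrow> nat \<Rightarrow> 'm \<Rightarrow> complex^'d^'d" where
  "from_matrix F = (\<lambda>n x. mstar C F (fconst u) n x ** matrix_inv (u x))"

lemma to_matrix_smooth: "formal_smooth A V F \<Longrightarrow> formal_smooth A V (to_matrix F)"
  unfolding to_matrix_def by (intro mstar_smooth[OF V] smooth_intros)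

lemma from_matrix_smooth: "formal_smooth A V F \<Longrightarrow> formal_smooth A V (from_matrix F)"
  unfolding from_matrix_def
  by (intro formal_smooth_matrix_mult_right[OF V _ matrix_inv_smooth] mstar_smooth[OF V] smooth_intros)

lemma from_matrix_to_matrix:
  assumes "formal_smooth A V F" "x \<in> V"
  shows "from_matrix (to_matrix F) n x = F n x"
proof -
  let ?f = "mult_u F"
  have "mstar_on V (mstar C ?f v) (fconst u) = mstar_on V (mstar_on V ?f v) (fconst u)"
    unfolding mstar_on_def[of V ?f]
    by (intro mstar_on_cutoff_left[OF V, symmetric] mstar_smooth[OF V] smooth_intros assms)
  also have "\<dots> = mstar_on V ?f (cutoff V (fconst (\<lambda>_. mat 1)))"
    by (simp add: mstar_on_assoc_V smooth_intros assms mstar_on_u_v)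
  also have "\<dots> = cutoff V ?f"
    by (simp add: mstar_on_cutoff_right[OF V] mstar_on_one_right[OF V] smooth_intros assms
        formal_smooth_fconst[OF V] smooth_fun_const[OF V])
  finally have "mstar C (mstar C ?f v) (fconst u) n x = ?f n x"
    unfolding mstar_on_def by (rule cutoff_eqD[OF _ assms(2)])
  then show ?thesis
    by (simp add: from_matrix_def to_matrix_def matrix_inv_u[OF assms(2)])
qed

lemma to_matrix_from_matrix:
  assumes "formal_smooth A V F" "x \<in> V"
  shows "to_matrix (from_matrix F) n x = F n x"
proof -
  have "cutoff V (mult_u (from_matrix F)) = mstar_on V F (fconst u)"
    unfolding mstar_on_def by (rule cutoff_eqI) (simp add: from_matrix_def matrix_inv_u)
  then have "mstar_on V (mult_u (from_matrix F)) v = mstar_on V (mstar_on V F (fconst u)) v"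
    using mstar_on_cutoff_left[OF V mult_u_smooth[OF from_matrix_smooth[OF assms(1)]]
        star_inverse_smooth] by simp
  also have "\<dots> = mstar_on V F (cutoff V (fconst (\<lambda>_. mat 1)))"
    by (simp add: mstar_on_assoc_V smooth_intros assms mstar_on_u_v)
  also have "\<dots> = cutoff V F"
    by (simp add: mstar_on_cutoff_right[OF V] mstar_on_one_right[OF V] smooth_intros assms
        formal_smooth_fconst[OF V] smooth_fun_const[OF V])
  finally show ?thesis
    unfolding mstar_on_def to_matrix_def by (rule cutoff_eqD[OF _ assms(2)])
qed

text \<open>With \<open>f = F u\<close> and \<open>g = G u\<close>, the product
  \<open>(f * v * g) * v\<close> regroups as \<open>(f * v) * (g * v)\<close>.\<close>

lemma to_matrix_local_product:
  assumes "formal_smooth A V F" "formal_smooth A V G" "x \<in> V"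
  shows "to_matrix (local_product C u v F G) n x = mstar C (to_matrix F) (to_matrix G) n x"
proof -
  let ?p = "mstar_on V" and ?f = "mult_u F" and ?g = "mult_u G"
  have "?p (mult_u (local_product C u v F G)) v = ?p (?p (?p ?f v) ?g) v"
    by (subst mult_u_local_product[OF assms(1,2), symmetric])
      (intro mstar_on_cutoff_left[OF V, symmetric] smooth_intros local_product_smooth assms)
  also have "\<dots> = ?p (cutoff V (mstar C ?f v)) (cutoff V (mstar C ?g v))"
    by (simp add: mstar_on_assoc_V smooth_intros assms flip: mstar_on_def)
  also have "\<dots> = ?p (mstar C ?f v) (mstar C ?g v)"
    by (intro mstar_on_cong[OF V])
      (simp_all add: formal_smooth_cutoff[OF V] cutoff_cutoff mstar_smooth[OF V] smooth_intros assms)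
  finally show ?thesis
    unfolding to_matrix_def mstar_on_def by (rule cutoff_eqD[OF _ assms(3)])
qed

end

text \<open>The hypotheses abstract the overlap of two trivializations: \<open>a'\<close> inverts
  \<open>a\<close> pointwise and \<open>b\<close> is the antiholomorphic factor. Since
  \<open>a'\<close> is holomorphic, it is also a left inverse of \<open>a\<close> for the star
  product; this is what allows \<open>a\<close> to be cancelled in star equations.\<close>

lemma local_product_transition:
  fixes a a' b :: "'m \<Rightarrow> complex^'d^'d"
  assumes V: "open V" and u1: "smooth_fun A V u1" and u2: "smooth_fun A V u2"
    and v1: "star_inverse A C V u1 v1" and v2: "star_inverse A C V u2 v2"
    and a: "\<And>i j. holomorphic_fun A V (\<lambda>x. a x $ i $ j)"
    and a': "\<And>i j. holomorphic_fun A V (\<lambda>x. a' x $ i $ j)"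
    and b: "\<And>i j. antiholomorphic_fun A V (\<lambda>x. b x $ i $ j)"
    and aa': "\<And>x. x \<in> V \<Longrightarrow> a' x ** a x = mat 1"
    and u: "\<And>x. x \<in> V \<Longrightarrow> u1 x = a x ** u2 x ** b x"
    and F1: "formal_smooth A V F1" and F2: "formal_smooth A V F2"
    and G1: "formal_smooth A V G1" and G2: "formal_smooth A V G2"
    and F: "\<And>r x. x \<in> V \<Longrightarrow> F1 r x = a x ** F2 r x ** a' x"
    and G: "\<And>r x. x \<in> V \<Longrightarrow> G1 r x = a x ** G2 r x ** a' x"
    and x: "x \<in> V"
  shows "local_product C u1 v1 F1 G1 n x = a x ** local_product C u2 v2 F2 G2 n x ** a' x"
proof -
  let ?p = "mstar_on V" and ?a = "fconst a" and ?a' = "fconst a'" and ?b = "fconst b"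
  have fs: "formal_smooth A V (fconst c)" if "\<And>i j. smooth_fun A V (\<lambda>x. c x $ i $ j)"
    for c :: "'m \<Rightarrow> complex^'d^'d"
    using that by (intro formal_smooth_fconst[OF V]) (simp add: smooth_fun_mat[OF V])
  have sa: "formal_smooth A V ?a" and sa': "formal_smooth A V ?a'" and sb: "formal_smooth A V ?b"
    using a a' b by (auto intro!: fs simp: holomorphic_fun_def antiholomorphic_fun_def)
  note sv1 = star_inverse_smooth[OF V u1 v1] and sv2 = star_inverse_smooth[OF V u2 v2]
  note su1 = fconst_u_smooth[OF V u1 v1] and su2 = fconst_u_smooth[OF V u2 v2]
  note one = mstar_on_one_left[OF V] mstar_on_one_right[OF V]
  have s1: "formal_smooth A V (fconst (\<lambda>_. mat 1 :: complex^'d^'d))"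
    by (intro formal_smooth_fconst[OF V] smooth_fun_const[OF V])
  note sm = mstar_on_smooth[OF V] sa sa' sb sv1 sv2 su1 su2 s1
  note assoc = mstar_on_assoc[OF V]
  have idem: "cutoff V (?p X Y) = ?p X Y" for X Y
    by (simp add: mstar_on_def cutoff_cutoff)
  \<comment> \<open>By separation of variables, multiplying pointwise by \<open>a\<close> on the
    left and \<open>b\<close> on the right is star multiplication. This is applied to the Gram
    matrix and to both arguments of the product.\<close>
  have sandwich: "cutoff V X = ?p ?a (?p Y ?b)"
    if Y: "formal_smooth A V Y" and X: "\<And>r x. x \<in> V \<Longrightarrow> X r x = a x ** Y r x ** b x" for X Y
  proof -
    have "?p ?a (?p Y ?b) = cutoff V (\<lambda>n x. a x ** ?p Y ?b n x)"
      by (rule mstar_on_holomorphic_left[OF V a mstar_on_smooth[OF V Y sb]])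
    also have "\<dots> = cutoff V X"
      by (rule cutoff_eqI)
        (simp add: mstar_on_antiholomorphic_right[OF V b Y] cutoff_apply X matrix_mul_assoc)
    finally show ?thesis by simp
  qed
  have a'a: "?p ?a' ?a = cutoff V (fconst (\<lambda>_. mat 1))"
    unfolding mstar_on_holomorphic_left[OF V a' sa]
    by (rule cutoff_eqI) (simp add: fconst_def aa')
  have a'a_left: "?p ?a' (?p ?a X) = cutoff V X" if X: "formal_smooth A V X" for X
    by (simp add: assoc[OF sa' sa X, symmetric] a'a mstar_on_cutoff_left[OF V s1 X] one X)
  have ub: "cutoff V (fconst u1) = ?p ?a (?p (fconst u2) ?b)"
    by (rule sandwich[OF su2]) (simp add: fconst_def u)
  \<comment> \<open>Candidate for \<open>v2\<close>. Since \<open>a * u2 * b = u1\<close>, the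
    product \<open>a * u2 * w\<close> is \<open>u1 * v1 * a = a\<close>; cancelling \<open>a\<close>
    shows that \<open>w\<close> is a right inverse of \<open>u2\<close>, hence equal to the
    two-sided inverse \<open>v2\<close> on \<open>V\<close>.\<close>
  define w where "w = ?p ?b (?p v1 ?a)"
  have sw: "formal_smooth A V w" unfolding w_def by (intro sm)
  have "?p ?a (?p (fconst u2) w) = ?p (?p (cutoff V (fconst u1)) v1) ?a"
    unfolding ub w_def by (simp add: assoc sm)
  also have "\<dots> = cutoff V ?a"
    by (simp add: mstar_on_cutoff_left[OF V] mstar_on_u_v[OF V u1 v1] one sm)
  finally have "cutoff V (?p (fconst u2) w) = ?p ?a' (cutoff V ?a)"
    using a'a_left[OF mstar_on_smooth[OF V su2 sw]] by simp
  then have u2w: "?p (fconst u2) w = cutoff V (fconst (\<lambda>_. mat 1))"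
    by (simp add: idem mstar_on_cutoff_right[OF V] sm a'a)
  have "cutoff V v2 = ?p v2 (?p (fconst u2) w)"
    by (simp add: u2w mstar_on_cutoff_right[OF V] one sm)
  also have "\<dots> = cutoff V w"
    by (simp add: assoc[symmetric] mstar_on_u_v[OF V u2 v2] mstar_on_cutoff_left[OF V] one sm sw)
  finally have v2w: "cutoff V v2 = cutoff V w" .
  define f1 g1 f2 g2 where "f1 = (\<lambda>r x. F1 r x ** u1 x)" and "g1 = (\<lambda>r x. G1 r x ** u1 x)"
    and "f2 = (\<lambda>r x. F2 r x ** u2 x)" and "g2 = (\<lambda>r x. G2 r x ** u2 x)"
  have s: "formal_smooth A V f1" "formal_smooth A V g1" "formal_smooth A V f2" "formal_smooth A V g2"
    unfolding f1_def g1_def f2_def g2_def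
    by (intro formal_smooth_matrix_mult_right[OF V] F1 F2 G1 G2 u1 u2)+
  \<comment> \<open>The factor \<open>a'\<close> on the right of \<open>F1\<close> or
    \<open>G1\<close> meets the \<open>a\<close> on the left of \<open>u1\<close> and cancels, so
    that only \<open>b\<close> remains on the right.\<close>
  have conj: "a x ** H ** a' x ** u1 x = a x ** (H ** u2 x) ** b x" if "x \<in> V" for x H
  proof -
    have "a x ** H ** a' x ** u1 x = a x ** H ** (a' x ** a x) ** u2 x ** b x"
      by (simp add: u[OF that] matrix_mul_assoc)
    then show ?thesis by (simp add: aa'[OF that] matrix_mul_assoc)
  qed
  have f1: "cutoff V f1 = ?p ?a (?p f2 ?b)"
    by (rule sandwich[OF s(3)]) (simp add: f1_def f2_def F conj)
  have g1: "cutoff V g1 = ?p ?a (?p g2 ?b)"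
    by (rule sandwich[OF s(4)]) (simp add: g1_def g2_def G conj)
  have "?p (?p f1 v1) g1 = ?p (?p (cutoff V f1) v1) (cutoff V g1)"
    by (simp add: mstar_on_cutoff_left[OF V] mstar_on_cutoff_right[OF V] s sm)
  also have "\<dots> = ?p ?a (?p (?p (?p f2 w) g2) ?b)"
    unfolding f1 g1 w_def by (simp add: assoc sm s)
  also have "?p f2 w = ?p f2 v2"
    by (rule mstar_on_cong[OF V s(3) sw refl v2w[symmetric]])
  finally have fg: "?p (?p f1 v1) g1 = ?p ?a (?p (?p (?p f2 v2) g2) ?b)" .
  have "?p (?p f1 v1) g1 n x = a x ** ?p (?p f2 v2) g2 n x ** b x"
    unfolding fg
    by (subst mstar_on_holomorphic_left[OF V a], intro sm s,
        subst mstar_on_antiholomorphic_right[OF V b], intro sm s)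
      (simp add: cutoff_apply[OF x] matrix_mul_assoc)
  \<comment> \<open>The pointwise inverse at the end of the local product converts the remaining
    \<open>b\<close> back into \<open>a'\<close>, which restores conjugation by
    \<open>a\<close>.\<close>
  moreover have "b x ** matrix_inv (u1 x) = matrix_inv (u2 x) ** a' x"
  proof -
    have "u1 x ** matrix_inv (u1 x) = mat 1"
      using matrix_inv_u(1)[OF V u1 v1 x, of "mat 1"] by simp
    then have "a' x ** a x ** u2 x ** b x ** matrix_inv (u1 x) = a' x"
      unfolding u[OF x] by (simp flip: matrix_mul_assoc)
    then have "u2 x ** (b x ** matrix_inv (u1 x)) = a' x"
      by (simp add: aa'[OF x] matrix_mul_assoc)
    then have "matrix_inv (u2 x) ** u2 x ** (b x ** matrix_inv (u1 x)) = matrix_inv (u2 x) ** a' x"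
      by (simp flip: matrix_mul_assoc)
    then show ?thesis using matrix_inv_u(2)[OF V u2 v2 x, of "mat 1"] by simp
  qed
  ultimately show ?thesis
    unfolding local_product_eq[OF V u1 v1 F1 G1 x] local_product_eq[OF V u2 v2 F2 G2 x]
      f1_def[symmetric] g1_def[symmetric] f2_def[symmetric] g2_def[symmetric]
    by (metis matrix_mul_assoc)
qed

end

section \<open>Linear algebra in the fibres\<close>

context
  fixes E :: "('m, 'e) vbundle" and V :: "'m set" and \<psi> :: "'e \<Rightarrow> complex^'d::finite" and x :: 'm
  assumes triv: "trivialization E V \<psi>" and x: "x \<in> V"
begin

lemma trivialization_bij: "bij_betw \<psi> (fibre E x) UNIV"
  using triv x by (simp add: trivialization_def)

lemma trivialization_add:
  "e \<in> fibre E x \<Longrightarrow> e' \<in> fibre E x \<Longrightarrow> badd E e e' \<in> fibre E x"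
  "e \<in> fibre E x \<Longrightarrow> e' \<in> fibre E x \<Longrightarrow> \<psi> (badd E e e') = \<psi> e + \<psi> e'"
  using triv x by (simp_all add: trivialization_def)

lemma trivialization_scale:
  "e \<in> fibre E x \<Longrightarrow> bscale E a e \<in> fibre E x"
  "e \<in> fibre E x \<Longrightarrow> \<psi> (bscale E a e) = a *s \<psi> e"
  using triv x by (simp_all add: trivialization_def)

lemma inv_trivialization:
  "inv_into (fibre E x) \<psi> y \<in> fibre E x"
  "\<psi> (inv_into (fibre E x) \<psi> y) = y"
  "e \<in> fibre E x \<Longrightarrow> inv_into (fibre E x) \<psi> (\<psi> e) = e"
  using trivialization_bij
  by (auto simp: bij_betw_def intro: inv_into_into f_inv_into_f inv_into_f_f)

lemma inv_trivialization_eqI: "e \<in> fibre E x \<Longrightarrow> \<psi> e = y \<Longrightarrow> inv_into (fibre E x) \<psi> y = e"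
  using inv_trivialization(3) by blast

lemma frame_in_fibre: "frame E \<psi> x i \<in> fibre E x"
  by (simp add: frame_def inv_trivialization)

lemma trivialization_frame: "\<psi> (frame E \<psi> x i) = axis i 1"
  by (simp add: frame_def inv_trivialization)

text \<open>\<open>L\<close> is any additive and homogeneous function on the fibre because, besides
  dual vectors, the coordinates of a second trivialization and the metric in its first argument are
  expanded this way.\<close>

lemma frame_expansion:
  assumes add: "\<And>e e'. e \<in> fibre E x \<Longrightarrow> e' \<in> fibre E x \<Longrightarrow> L (badd E e e') = L e + L e'"
    and scale: "\<And>a e. e \<in> fibre E x \<Longrightarrow> L (bscale E a e) = a * L e"
    and e: "e \<in> fibre E x"
  shows "L e = (\<Sum>i\<in>UNIV. \<psi> e $ i * (L (frame E \<psi> x i) :: complex))"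
proof -
  let ?f = "inv_into (fibre E x) \<psi>"
  have f_add: "?f (y + z) = badd E (?f y) (?f z)" for y z
    by (rule inv_trivialization_eqI) (simp_all add: trivialization_add inv_trivialization)
  have f_scale: "?f (a *s y) = bscale E a (?f y)" for a y
    by (rule inv_trivialization_eqI) (simp_all add: trivialization_scale inv_trivialization)
  \<comment> \<open>A bundle has no named zero vectors; the zero of the fibre is \<open>?f 0\<close>
    and is reached by scaling with 0.\<close>
  have "L (?f 0) = L (?f (0 *s 0))" by simp
  also have "\<dots> = 0" unfolding f_scale by (simp add: scale inv_trivialization)
  finally have zero: "L (?f 0) = 0" .
  have sum: "L (?f (\<Sum>i\<in>I. c i *s y i)) = (\<Sum>i\<in>I. c i * L (?f (y i)))" if "finite I"
    for I :: "'d set" and c y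
    using that
    by (induction I) (simp_all add: zero f_add f_scale add scale inv_trivialization trivialization_scale)
  have "L e = L (?f (\<Sum>i\<in>UNIV. \<psi> e $ i *s axis i 1))"
    by (simp add: basis_expansion inv_trivialization e)
  also have "\<dots> = (\<Sum>i\<in>UNIV. \<psi> e $ i * L (frame E \<psi> x i))"
    by (subst sum) (simp_all add: frame_def)
  finally show ?thesis .
qed

lemma dual_fibre_expansion:
  assumes "s \<in> dual_fibre E x" "e \<in> fibre E x"
  shows "s e = (\<Sum>i\<in>UNIV. \<psi> e $ i * s (frame E \<psi> x i))"
  by (rule frame_expansion) (use assms in \<open>simp_all add: dual_fibre_def\<close>)

lemma dual_fibre_sum:
  assumes "finite I" "\<And>i. i \<in> I \<Longrightarrow> s i \<in> dual_fibre E x"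
  shows "(\<lambda>e. \<Sum>i\<in>I. c i * s i e) \<in> dual_fibre E x"
proof -
  have "(\<Sum>i\<in>I. c i * s i (badd E e e')) = (\<Sum>i\<in>I. c i * s i e) + (\<Sum>i\<in>I. c i * s i e')"
    if "e \<in> fibre E x" "e' \<in> fibre E x" for e e'
  proof -
    have "(\<Sum>i\<in>I. c i * s i (badd E e e')) = (\<Sum>i\<in>I. c i * s i e + c i * s i e')"
      using assms that by (intro sum.cong) (auto simp: dual_fibre_def distrib_left)
    then show ?thesis by (simp add: sum.distrib)
  qed
  moreover have "(\<Sum>i\<in>I. c i * s i (bscale E a e)) = a * (\<Sum>i\<in>I. c i * s i e)"
    if "e \<in> fibre E x" for a e
    unfolding sum_distrib_left
    using assms that by (intro sum.cong) (auto simp: dual_fibre_def)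
  moreover have "(\<Sum>i\<in>I. c i * s i e) = 0" if "e \<notin> fibre E x" for e
    using assms that by (intro sum.neutral) (auto simp: dual_fibre_def)
  ultimately show ?thesis by (simp add: dual_fibre_def)
qed

text \<open>The frame dual to \<open>frame E \<psi> x\<close>. Its extension by 0 outside the fibre
  follows the convention of \<open>dual_fibre\<close>.\<close>

definition coord :: "'d \<Rightarrow> 'e \<Rightarrow> complex" where
  "coord j = (\<lambda>e. if e \<in> fibre E x then \<psi> e $ j else 0)"

lemma coord_dual_fibre: "coord j \<in> dual_fibre E x"
  by (simp add: dual_fibre_def coord_def trivialization_add trivialization_scale)

lemma dual_endos_sum:
  assumes T: "T \<in> dual_endos E x" and I: "finite I" and s: "\<And>i. i \<in> I \<Longrightarrow> s i \<in> dual_fibre E x"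
  shows "T (\<lambda>e. \<Sum>i\<in>I. c i * s i e) = (\<lambda>e. \<Sum>i\<in>I. c i * T (s i) e)"
  using I s
proof (induction I)
  note T' = T[unfolded dual_endos_def mem_Collect_eq]
  note T_add = T'[THEN conjunct2, THEN conjunct1, rule_format]
  note T_scale = T'[THEN conjunct2, THEN conjunct2, THEN conjunct1, rule_format]
  case empty
  have "(\<lambda>e. 0) \<in> dual_fibre E x" by (simp add: dual_fibre_def)
  from T_scale[OF this, of 0] show ?case by simp
next
  note T' = T[unfolded dual_endos_def mem_Collect_eq]
  note T_add = T'[THEN conjunct2, THEN conjunct1, rule_format]
  note T_scale = T'[THEN conjunct2, THEN conjunct2, THEN conjunct1, rule_format]
  case (insert i I)
  have 1: "(\<lambda>e. c i * s i e) \<in> dual_fibre E x"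
    using dual_fibre_sum[of "{i}" s c] insert.prems by simp
  have 2: "(\<lambda>e. \<Sum>i\<in>I. c i * s i e) \<in> dual_fibre E x"
    by (rule dual_fibre_sum) (use insert in auto)
  have "T (\<lambda>e. c i * s i e + (\<Sum>i\<in>I. c i * s i e)) =
      (\<lambda>e. T (\<lambda>e. c i * s i e) e + T (\<lambda>e. \<Sum>i\<in>I. c i * s i e) e)"
    by (rule T_add[OF 1 2])
  moreover have "T (\<lambda>e. c i * s i e) = (\<lambda>e. c i * T (s i) e)"
    by (rule T_scale) (use insert.prems in simp)
  ultimately show ?case using insert by simp
qed

lemma endo_matrix_coord: "endo_matrix E \<psi> x T $ i $ j = T (coord j) (frame E \<psi> x i)"
  by (simp add: endo_matrix_def coord_def)

text \<open>A dual vector is expanded in the dual frame and \<open>T\<close> is linear there. On all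
  other arguments both sides are 0 by the conventions of \<open>dual_endos\<close> and
  \<open>dual_fibre\<close>, so they are equal as total functions.\<close>

lemma matrix_endo_endo_matrix:
  assumes T: "T \<in> dual_endos E x"
  shows "matrix_endo E \<psi> x (endo_matrix E \<psi> x T) = T"
proof (intro ext)
  fix s e
  have zero: "s \<notin> dual_fibre E x \<Longrightarrow> T s e = 0"
    and dual: "s \<in> dual_fibre E x \<Longrightarrow> T s \<in> dual_fibre E x"
    using T by (auto simp: dual_endos_def)
  show "matrix_endo E \<psi> x (endo_matrix E \<psi> x T) s e = T s e"
  proof (cases "s \<in> dual_fibre E x \<and> e \<in> fibre E x")
    case True
    have "s = (\<lambda>e. \<Sum>j\<in>UNIV. s (frame E \<psi> x j) * coord j e)"
    proof
      fix e
      show "s e = (\<Sum>j\<in>UNIV. s (frame E \<psi> x j) * coord j e)"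
      proof (cases "e \<in> fibre E x")
        case in_fibre: True
        then show ?thesis
          using dual_fibre_expansion[OF _ in_fibre, of s] True by (simp add: coord_def mult.commute)
      next
        case False
        then show ?thesis using True by (simp add: coord_def dual_fibre_def)
      qed
    qed
    then have "T s = T (\<lambda>e. \<Sum>j\<in>UNIV. s (frame E \<psi> x j) * coord j e)"
      by (rule arg_cong)
    also have "\<dots> = (\<lambda>e. \<Sum>j\<in>UNIV. s (frame E \<psi> x j) * T (coord j) e)"
      by (rule dual_endos_sum[OF T finite coord_dual_fibre])
    finally have Ts: "T s = (\<lambda>e. \<Sum>j\<in>UNIV. s (frame E \<psi> x j) * T (coord j) e)" .
    have "T s e = (\<Sum>i\<in>UNIV. \<psi> e $ i * T s (frame E \<psi> x i))"
      using dual_fibre_expansion dual True by blast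
    also have "\<dots> = (\<Sum>i\<in>UNIV. \<psi> e $ i * (\<Sum>j\<in>UNIV. s (frame E \<psi> x j) * T (coord j) (frame E \<psi> x i)))"
      by (subst Ts) simp
    finally show ?thesis
      using True by (simp add: matrix_endo_def matrix_vector_mult_def endo_matrix_coord mult.commute)
  next
    case False
    have "T s e = 0"
    proof (cases "s \<in> dual_fibre E x")
      case True
      then have "T s \<in> dual_fibre E x" "e \<notin> fibre E x" using dual False by auto
      then show ?thesis by (simp add: dual_fibre_def)
    qed (rule zero)
    with False show ?thesis by (auto simp: matrix_endo_def)
  qed
qed

lemma matrix_endo_apply:
  "s \<in> dual_fibre E x \<Longrightarrow> e \<in> fibre E x \<Longrightarrow> matrix_endo E \<psi> x M s e =
    (\<Sum>i\<in>UNIV. \<psi> e $ i * (\<Sum>j\<in>UNIV. M $ i $ j * s (frame E \<psi> x j)))"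
  by (simp add: matrix_endo_def matrix_vector_mult_def)

lemma matrix_endo_dual_fibre: "matrix_endo E \<psi> x M s \<in> dual_fibre E x"
proof (cases "s \<in> dual_fibre E x")
  case True
  have "matrix_endo E \<psi> x M s e = 0" if "e \<notin> fibre E x" for e
    using that by (simp add: matrix_endo_def)
  moreover have "matrix_endo E \<psi> x M s (badd E e e') = matrix_endo E \<psi> x M s e + matrix_endo E \<psi> x M s e'"
    if "e \<in> fibre E x" "e' \<in> fibre E x" for e e'
    using that by (simp add: matrix_endo_apply[OF True] trivialization_add distrib_right sum.distrib)
  moreover have "matrix_endo E \<psi> x M s (bscale E a e) = a * matrix_endo E \<psi> x M s e"
    if "e \<in> fibre E x" for a e
    unfolding matrix_endo_apply[OF True that]
      matrix_endo_apply[OF True trivialization_scale(1)[OF that]]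
    by (simp add: trivialization_scale(2)[OF that] sum_distrib_left mult.assoc)
  ultimately show ?thesis by (simp add: dual_fibre_def)
next
  case False
  then have "matrix_endo E \<psi> x M s = (\<lambda>e. 0)" by (simp add: matrix_endo_def)
  then show ?thesis by (simp add: dual_fibre_def)
qed

lemma matrix_endo_dual_endos: "matrix_endo E \<psi> x M \<in> dual_endos E x"
proof -
  have add: "(\<lambda>e. s e + t e) \<in> dual_fibre E x" if "s \<in> dual_fibre E x" "t \<in> dual_fibre E x" for s t
    using that by (simp add: dual_fibre_def distrib_left)
  have scale: "(\<lambda>e. a * s e) \<in> dual_fibre E x" if "s \<in> dual_fibre E x" for a s
    using that by (simp add: dual_fibre_def distrib_left)
  have "matrix_endo E \<psi> x M (\<lambda>e. s e + t e) = (\<lambda>e. matrix_endo E \<psi> x M s e + matrix_endo E \<psi> x M t e)"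
    if "s \<in> dual_fibre E x" "t \<in> dual_fibre E x" for s t
    using that add[OF that]
    by (auto simp: matrix_endo_def fun_eq_iff matrix_vector_mult_def distrib_left sum.distrib)
  moreover have "matrix_endo E \<psi> x M (\<lambda>e. a * s e) = (\<lambda>e. a * matrix_endo E \<psi> x M s e)"
    if "s \<in> dual_fibre E x" for a s
    using that scale[OF that]
    by (auto simp: matrix_endo_def fun_eq_iff matrix_vector_mult_def sum_distrib_left ac_simps)
  ultimately show ?thesis
    using matrix_endo_dual_fibre by (simp add: dual_endos_def) (simp add: matrix_endo_def)
qed

lemma matrix_endo_mult: "matrix_endo E \<psi> x (M ** N) = matrix_endo E \<psi> x M \<circ> matrix_endo E \<psi> x N"
proof (intro ext)
  fix s e
  have 1: "(\<chi> j. matrix_endo E \<psi> x N s (frame E \<psi> x j)) = N *v (\<chi> j. s (frame E \<psi> x j))"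
    if "s \<in> dual_fibre E x"
    using that frame_in_fibre
    by (simp add: matrix_endo_def trivialization_frame axis_def vec_eq_iff if_distrib
        if_distribR cong: if_cong)
  \<comment> \<open>Outside the dual fibre the inner endomorphism returns the zero functional, and
    \<open>M\<close> maps its coordinates to 0.\<close>
  have 2: "(\<chi> j. matrix_endo E \<psi> x N s (frame E \<psi> x j)) = 0" if "s \<notin> dual_fibre E x"
    using that by (simp add: matrix_endo_def vec_eq_iff)
  show "matrix_endo E \<psi> x (M ** N) s e = (matrix_endo E \<psi> x M \<circ> matrix_endo E \<psi> x N) s e"
    using matrix_endo_dual_fibre[of N s] 1 2
    by (cases "s \<in> dual_fibre E x")
      (simp_all add: matrix_endo_def[of E \<psi> x M] matrix_endo_def[of E \<psi> x "M ** N"]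
        matrix_vector_mul_assoc)
qed

end

lemma matrix_endo_sum:
  "matrix_endo E \<psi> x (\<Sum>k\<in>K. M k) s e = (\<Sum>k\<in>K. matrix_endo E \<psi> x (M k) s e)"
  by (induction K rule: infinite_finite_induct)
    (auto simp: matrix_endo_def matrix_vector_mult_add_rdistrib distrib_left sum.distrib)

text \<open>The matrix \<open>a\<close> expressing the frame of \<psi> through that of \<phi>, one
  row per frame vector; with rows rather than columns the Gram matrices satisfy
  \<open>u = a u' b\<close>.\<close>

definition transition :: "('m, 'e) vbundle \<Rightarrow> ('e \<Rightarrow> complex^'d::finite) \<Rightarrow> ('e \<Rightarrow> complex^'d) \<Rightarrow>
    'm \<Rightarrow> complex^'d^'d" where
  "transition E \<psi> \<phi> x = (\<chi> i j. \<phi> (frame E \<psi> x i) $ j)"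

context
  fixes E :: "('m::topological_space, 'e) vbundle" and V W :: "'m set" and \<psi> \<phi> :: "'e \<Rightarrow> complex^'d::finite" and x :: 'm
  assumes \<psi>: "trivialization E V \<psi>" "x \<in> V" and \<phi>: "trivialization E W \<phi>" "x \<in> W"
begin

text \<open>Base change, computed on the dual frame. For equal trivializations it says that
  \<open>endo_matrix\<close> inverts \<open>matrix_endo\<close>; for different ones it gives the
  gluing law of representatives.\<close>

lemma endo_matrix_matrix_endo:
  "endo_matrix E \<psi> x (matrix_endo E \<phi> x M) = transition E \<psi> \<phi> x ** M ** transition E \<phi> \<psi> x"
proof -
  have "endo_matrix E \<psi> x (matrix_endo E \<phi> x M) $ i $ j =
      (\<Sum>k\<in>UNIV. \<phi> (frame E \<psi> x i) $ k * (\<Sum>l\<in>UNIV. M $ k $ l * \<psi> (frame E \<phi> x l) $ j))" for i j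
    unfolding endo_matrix_coord[OF \<psi>]
    by (simp add: matrix_endo_apply[OF \<phi>] coord_dual_fibre[OF \<psi>] frame_in_fibre[OF \<psi>])
      (simp add: coord_def[OF \<psi>] frame_in_fibre[OF \<phi>])
  then show ?thesis
    unfolding matrix_mul_assoc[symmetric]
    by (simp add: vec_eq_iff transition_def matrix_matrix_mult_def)
qed

lemma transition_inverse: "transition E \<psi> \<phi> x ** transition E \<phi> \<psi> x = mat 1"
proof -
  have "(\<Sum>k\<in>UNIV. \<phi> (frame E \<psi> x i) $ k * \<psi> (frame E \<phi> x k) $ j) = \<psi> (frame E \<psi> x i) $ j" for i j
    by (rule frame_expansion[OF \<phi>, symmetric])
      (simp_all add: trivialization_add[OF \<psi>] trivialization_scale[OF \<psi>] frame_in_fibre[OF \<psi>])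
  then show ?thesis
    by (auto simp: vec_eq_iff transition_def matrix_matrix_mult_def trivialization_frame[OF \<psi>]
        axis_def mat_def)
qed

text \<open>Expansion in a frame is available in the first argument of \<open>h\<close>; Hermitian
  symmetry carries it to the second and produces the conjugates. So the right factor is the
  conjugate transpose of the left one, and antiholomorphic whenever \<open>transition\<close> is
  holomorphic.\<close>

lemma gram_transition:
  assumes "hermitian_metric A E U \<Psi> h"
  shows "gram E h \<psi> x = transition E \<psi> \<phi> x ** gram E h \<phi> x ** (\<chi> i j. cnj (transition E \<psi> \<phi> x $ j $ i))"
proof -
  have add: "h (badd E e e') e'' = h e e'' + h e' e''"
    if "e \<in> fibre E x" "e' \<in> fibre E x" "e'' \<in> fibre E x" for e e' e''
    using assms that unfolding hermitian_metric_def by blast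
  have scale: "h (bscale E a e) e' = a * h e e'" if "e \<in> fibre E x" "e' \<in> fibre E x" for a e e'
    using assms that unfolding hermitian_metric_def by blast
  have cnj: "h e' e = cnj (h e e')" if "e \<in> fibre E x" "e' \<in> fibre E x" for e e'
    using assms that unfolding hermitian_metric_def by blast
  let ?e = "frame E \<psi> x" and ?f = "frame E \<phi> x"
  have e: "?e i \<in> fibre E x" and f: "?f i \<in> fibre E x" for i
    by (rule frame_in_fibre[OF \<psi>], rule frame_in_fibre[OF \<phi>])
  have expand: "h (?e i) y = (\<Sum>k\<in>UNIV. \<phi> (?e i) $ k * h (?f k) y)" if "y \<in> fibre E x" for i y
    by (rule frame_expansion[OF \<phi>]) (simp_all add: add scale that e)
  have "h (?f k) (?e j) = (\<Sum>l\<in>UNIV. h (?f k) (?f l) * cnj (\<phi> (?e j) $ l))" for j k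
  proof -
    have "h (?f k) (?e j) = cnj (h (?e j) (?f k))" by (rule cnj[OF e f])
    also have "\<dots> = (\<Sum>l\<in>UNIV. cnj (\<phi> (?e j) $ l) * cnj (h (?f l) (?f k)))"
      by (simp add: expand[OF f])
    also have "\<dots> = (\<Sum>l\<in>UNIV. h (?f k) (?f l) * cnj (\<phi> (?e j) $ l))"
      by (intro sum.cong refl) (simp add: cnj[OF f f, symmetric] mult.commute)
    finally show ?thesis .
  qed
  then have "h (?e i) (?e j) = (\<Sum>k\<in>UNIV. \<phi> (?e i) $ k *
      (\<Sum>l\<in>UNIV. h (?f k) (?f l) * cnj (\<phi> (?e j) $ l)))" for i j
    by (simp add: expand[OF e])
  then show ?thesis
    unfolding matrix_mul_assoc[symmetric]
    by (simp add: vec_eq_iff transition_def gram_def matrix_matrix_mult_def)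
qed

end

lemma transition_self: "trivialization E V \<psi> \<Longrightarrow> x \<in> V \<Longrightarrow> transition E \<psi> \<psi> x = mat 1"
  by (auto simp: transition_def trivialization_frame vec_eq_iff axis_def mat_def)

lemma endo_matrix_matrix_endo_self:
  fixes E :: "('m::topological_space, 'e) vbundle"
  shows "trivialization E V \<psi> \<Longrightarrow> x \<in> V \<Longrightarrow> endo_matrix E \<psi> x (matrix_endo E \<psi> x M) = M"
  using endo_matrix_matrix_endo[of E V \<psi> x V \<psi> M] by (simp add: transition_self)

section \<open>Differential operators\<close>

lemma finite_words: "finite {I :: 'a::finite list. length I \<le> k}"
  using finite_lists_length_le[of "UNIV :: 'a set" k] by simp

lemma sum_UNIV_prod: "(\<Sum>t\<in>UNIV. f t) = (\<Sum>p\<in>UNIV. \<Sum>q\<in>UNIV. f (p, q))"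
  unfolding UNIV_Times_UNIV[symmetric] by (simp add: sum.cartesian_product)

context star_manifold
begin

text \<open>Operators with scalar values on matrices of functions, with coefficients over
  \<open>W\<close>. The matrix entry is one index of pair type, which keeps the sums short;
  \<open>sum_UNIV_prod\<close> later restores two separate sums.\<close>

definition diff_op_coeffs :: "('m, 'n) chart \<Rightarrow> 'm set \<Rightarrow> nat \<Rightarrow> (('m \<Rightarrow> complex^'d^'d) \<Rightarrow> 'm \<Rightarrow> complex) \<Rightarrow>
    (('n + 'n) list \<Rightarrow> 'd \<times> 'd \<Rightarrow> 'm \<Rightarrow> complex) \<Rightarrow> bool"
  where "diff_op_coeffs c W k P a \<longleftrightarrow> (\<forall>I t. smooth_fun A W (a I t)) \<and>
    (\<forall>V F. open V \<longrightarrow> smooth_fun A V F \<longrightarrow> (\<forall>x\<in>V \<inter> W. P F x =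
      (\<Sum>I | length I \<le> k. \<Sum>t\<in>UNIV. a I t x * chart_derivs c I (\<lambda>y. F y $ fst t $ snd t) x)))"

definition diff_op :: "('m, 'n) chart \<Rightarrow> 'm set \<Rightarrow> nat \<Rightarrow> (('m \<Rightarrow> complex^'d^'d) \<Rightarrow> 'm \<Rightarrow> complex) \<Rightarrow> bool"
  where "diff_op c W k P \<longleftrightarrow> (\<exists>a. diff_op_coeffs c W k P a)"

lemma diff_op_coeffsD:
  assumes "diff_op_coeffs c W k P a"
  shows "smooth_fun A W (a I t)"
    and "open V \<Longrightarrow> smooth_fun A V F \<Longrightarrow> x \<in> V \<inter> W \<Longrightarrow> P F x =
      (\<Sum>I | length I \<le> k. \<Sum>t\<in>UNIV. a I t x * chart_derivs c I (\<lambda>y. F y $ fst t $ snd t) x)"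
  using assms unfolding diff_op_coeffs_def by blast+

definition bidiff_op_coeffs :: "('m, 'n) chart \<Rightarrow> 'm set \<Rightarrow> nat \<Rightarrow>
    (('m \<Rightarrow> complex^'d^'d) \<Rightarrow> ('m \<Rightarrow> complex^'d^'d) \<Rightarrow> 'm \<Rightarrow> complex) \<Rightarrow>
    (('n + 'n) list \<Rightarrow> ('n + 'n) list \<Rightarrow> 'd \<times> 'd \<Rightarrow> 'd \<times> 'd \<Rightarrow> 'm \<Rightarrow> complex) \<Rightarrow> bool"
  where "bidiff_op_coeffs c W k R a \<longleftrightarrow> (\<forall>I J t t'. smooth_fun A W (a I J t t')) \<and>
    (\<forall>V F G. open V \<longrightarrow> smooth_fun A V F \<longrightarrow> smooth_fun A V G \<longrightarrow> (\<forall>x\<in>V \<inter> W. R F G x =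
      (\<Sum>I | length I \<le> k. \<Sum>J | length J \<le> k. \<Sum>t\<in>UNIV. \<Sum>t'\<in>UNIV. a I J t t' x *
        chart_derivs c I (\<lambda>y. F y $ fst t $ snd t) x *
        chart_derivs c J (\<lambda>y. G y $ fst t' $ snd t') x)))"

definition bidiff_op_on :: "('m, 'n) chart \<Rightarrow> 'm set \<Rightarrow> nat \<Rightarrow>
    (('m \<Rightarrow> complex^'d^'d) \<Rightarrow> ('m \<Rightarrow> complex^'d^'d) \<Rightarrow> 'm \<Rightarrow> complex) \<Rightarrow> bool"
  where "bidiff_op_on c W k R \<longleftrightarrow> (\<exists>a. bidiff_op_coeffs c W k R a)"

lemma bidiff_op_coeffsD:
  assumes "bidiff_op_coeffs c W k R a"
  shows "smooth_fun A W (a I J t t')"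
    and "open V \<Longrightarrow> smooth_fun A V F \<Longrightarrow> smooth_fun A V G \<Longrightarrow> x \<in> V \<inter> W \<Longrightarrow> R F G x =
      (\<Sum>I | length I \<le> k. \<Sum>J | length J \<le> k. \<Sum>t\<in>UNIV. \<Sum>t'\<in>UNIV. a I J t t' x *
        chart_derivs c I (\<lambda>y. F y $ fst t $ snd t) x *
        chart_derivs c J (\<lambda>y. G y $ fst t' $ snd t') x)"
  using assms unfolding bidiff_op_coeffs_def by blast+

lemma smooth_fun_entry:
  fixes F :: "'m \<Rightarrow> complex^'k^'l"
  shows "open V \<Longrightarrow> smooth_fun A V F \<Longrightarrow> smooth_fun A V (\<lambda>y. F y $ p $ q)"
  using smooth_fun_mat by blast

context
  fixes c W
  assumes c: "c \<in> A" and W: "open W" "W \<subseteq> fst c"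
begin

lemma chart_derivs_entry_smooth:
  fixes F :: "'m \<Rightarrow> complex^'k^'l"
  assumes "open V" "smooth_fun A V F"
  shows "smooth_fun A (V \<inter> W) (chart_derivs c I (\<lambda>y. F y $ p $ q))"
  by (rule smooth_fun_subset[OF chart_derivs_smooth[OF c assms(1) smooth_fun_entry[OF assms]]])
    (use W in auto)

lemma diff_op_cong:
  fixes P Q :: "('m \<Rightarrow> complex^'d^'d) \<Rightarrow> 'm \<Rightarrow> complex"
  assumes "diff_op c W k P"
    and "\<And>V F x. open V \<Longrightarrow> smooth_fun A V F \<Longrightarrow> x \<in> V \<inter> W \<Longrightarrow> P F x = Q F x"
  shows "diff_op c W k Q"
proof -
  obtain a where "diff_op_coeffs c W k P a" using assms(1) unfolding diff_op_def ..
  note a = diff_op_coeffsD[OF this]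
  show ?thesis
    unfolding diff_op_def diff_op_coeffs_def
    by (intro exI[of _ a] conjI a(1) allI impI ballI,
        rule trans[OF assms(2)[symmetric] a(2)])
qed

lemma bidiff_op_on_cong:
  fixes P Q :: "('m \<Rightarrow> complex^'d^'d) \<Rightarrow> ('m \<Rightarrow> complex^'d^'d) \<Rightarrow> 'm \<Rightarrow> complex"
  assumes "bidiff_op_on c W k P"
    and "\<And>V F G x. open V \<Longrightarrow> smooth_fun A V F \<Longrightarrow> smooth_fun A V G \<Longrightarrow> x \<in> V \<inter> W \<Longrightarrow>
      P F G x = Q F G x"
  shows "bidiff_op_on c W k Q"
proof -
  obtain a where "bidiff_op_coeffs c W k P a" using assms(1) unfolding bidiff_op_on_def ..
  note a = bidiff_op_coeffsD[OF this]
  show ?thesis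
    unfolding bidiff_op_on_def bidiff_op_coeffs_def
    by (intro exI[of _ a] conjI a(1) allI impI ballI,
        rule trans[OF assms(2)[symmetric] a(2)])
qed

lemma diff_op_smooth:
  fixes P :: "('m \<Rightarrow> complex^'d^'d) \<Rightarrow> 'm \<Rightarrow> complex"
  assumes "diff_op c W k P" "open V" "smooth_fun A V F"
  shows "smooth_fun A (V \<inter> W) (P F)"
proof -
  obtain a where "diff_op_coeffs c W k P a" using assms(1) unfolding diff_op_def ..
  note a = diff_op_coeffsD[OF this]
  have VW: "open (V \<inter> W)" using assms W by auto
  have "smooth_fun A (V \<inter> W) (a I t)" for I t
    by (rule smooth_fun_subset[OF a(1)]) simp
  then have "smooth_fun A (V \<inter> W) (\<lambda>x. \<Sum>I | length I \<le> k. \<Sum>t\<in>UNIV.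
      a I t x * chart_derivs c I (\<lambda>y. F y $ fst t $ snd t) x)"
    by (intro smooth_fun_sum[OF VW] smooth_fun_mult[OF VW] chart_derivs_entry_smooth assms)
  then show ?thesis
    by (rule iffD1[OF smooth_fun_cong[OF VW], rotated]) (simp add: a(2)[ OF assms(2,3)])
qed

lemma diff_op_entry: "diff_op c W 0 (\<lambda>F x. F x $ p $ q)"
  unfolding diff_op_def diff_op_coeffs_def
  by (rule exI[of _ "\<lambda>I t x. if t = (p, q) then 1 else 0"])
    (auto simp: if_distrib if_distribR smooth_fun_const[OF W(1)] cong: if_cong)

text \<open>Operators can be added once they have a common order; to raise the order, the
  coefficients of longer words are set to 0.\<close>

lemma diff_op_mono:
  fixes P :: "('m \<Rightarrow> complex^'d^'d) \<Rightarrow> 'm \<Rightarrow> complex"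
  assumes "diff_op c W k P" "k \<le> k'"
  shows "diff_op c W k' P"
proof -
  obtain a where "diff_op_coeffs c W k P a" using assms(1) unfolding diff_op_def ..
  note a = diff_op_coeffsD[OF this]
  define a' where "a' I t = (if length I \<le> k then a I t else (\<lambda>x. 0))" for I t
  have "smooth_fun A W (a' I t)" for I t
    using a(1) smooth_fun_const[OF W(1), of "0::complex"] by (simp add: a'_def)
  moreover have "(\<Sum>I | length I \<le> k. \<Sum>t\<in>UNIV. a I t x * chart_derivs c I (f t) x) =
      (\<Sum>I | length I \<le> k'. \<Sum>t\<in>UNIV. a' I t x * chart_derivs c I (f t) x)" for f x
    by (rule sum.mono_neutral_cong_left) (use assms(2) finite_words in \<open>auto simp: a'_def\<close>)
  ultimately show ?thesis
    unfolding diff_op_def diff_op_coeffs_def using a(2) by (intro exI[of _ a']) simp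
qed

lemma diff_op_mult:
  fixes P :: "('m \<Rightarrow> complex^'d^'d) \<Rightarrow> 'm \<Rightarrow> complex"
  assumes "diff_op c W k P" "smooth_fun A W f"
  shows "diff_op c W k (\<lambda>F x. f x * P F x)"
proof -
  obtain a where "diff_op_coeffs c W k P a" using assms(1) unfolding diff_op_def ..
  note a = diff_op_coeffsD[OF this]
  show ?thesis
    unfolding diff_op_def diff_op_coeffs_def
  proof (intro exI[of _ "\<lambda>I t x. f x * a I t x"] conjI allI impI ballI)
    show "smooth_fun A W (\<lambda>x. f x * a I t x)" for I t
      by (rule smooth_fun_mult[OF W(1) assms(2) a(1)])
  qed (simp add: a(2) sum_distrib_left mult.assoc)
qed

lemma diff_op_sum:
  fixes P :: "'i \<Rightarrow> ('m \<Rightarrow> complex^'d^'d) \<Rightarrow> 'm \<Rightarrow> complex"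
  assumes "\<And>i. i \<in> K \<Longrightarrow> diff_op c W k (P i)"
  shows "diff_op c W k (\<lambda>F x. \<Sum>i\<in>K. P i F x)"
proof -
  have "\<forall>i\<in>K. \<exists>a. diff_op_coeffs c W k (P i) a"
    using assms unfolding diff_op_def by blast
  from bchoice[OF this] obtain a where "\<forall>i\<in>K. diff_op_coeffs c W k (P i) (a i)" ..
  note a = diff_op_coeffsD[OF bspec[OF this]]
  show ?thesis
    unfolding diff_op_def diff_op_coeffs_def
  proof (intro exI[of _ "\<lambda>I t x. \<Sum>i\<in>K. a i I t x"] conjI allI impI ballI)
    show "smooth_fun A W (\<lambda>x. \<Sum>i\<in>K. a i I t x)" for I t
      by (rule smooth_fun_sum[OF W(1)]) (rule a)
    fix V and F :: "'m \<Rightarrow> complex^'d^'d" and x assume V: "open V" "smooth_fun A V F" "x \<in> V \<inter> W"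
    have "(\<Sum>i\<in>K. P i F x) = (\<Sum>i\<in>K. \<Sum>I | length I \<le> k. \<Sum>t\<in>UNIV.
        a i I t x * chart_derivs c I (\<lambda>y. F y $ fst t $ snd t) x)"
      by (rule sum.cong) (use a(2) V in auto)
    also have "\<dots> = (\<Sum>I | length I \<le> k. \<Sum>t\<in>UNIV. \<Sum>i\<in>K.
        a i I t x * chart_derivs c I (\<lambda>y. F y $ fst t $ snd t) x)"
      unfolding sum.swap[of _ _ K] ..
    finally show "(\<Sum>i\<in>K. P i F x) = (\<Sum>I | length I \<le> k. \<Sum>t\<in>UNIV.
        (\<Sum>i\<in>K. a i I t x) * chart_derivs c I (\<lambda>y. F y $ fst t $ snd t) x)"
      by (simp add: sum_distrib_right)
  qed
qed

lemma bidiff_op_on_sum: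
  fixes P :: "'i \<Rightarrow> ('m \<Rightarrow> complex^'d^'d) \<Rightarrow> ('m \<Rightarrow> complex^'d^'d) \<Rightarrow> 'm \<Rightarrow> complex"
  assumes "\<And>i. i \<in> K \<Longrightarrow> bidiff_op_on c W k (P i)"
  shows "bidiff_op_on c W k (\<lambda>F G x. \<Sum>i\<in>K. P i F G x)"
proof -
  have "\<forall>i\<in>K. \<exists>a. bidiff_op_coeffs c W k (P i) a"
    using assms unfolding bidiff_op_on_def by blast
  from bchoice[OF this] obtain a where "\<forall>i\<in>K. bidiff_op_coeffs c W k (P i) (a i)" ..
  note a = bidiff_op_coeffsD[OF bspec[OF this]]
  show ?thesis
    unfolding bidiff_op_on_def bidiff_op_coeffs_def
  proof (intro exI[of _ "\<lambda>I J t t' x. \<Sum>i\<in>K. a i I J t t' x"] conjI allI impI ballI)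
    show "smooth_fun A W (\<lambda>x. \<Sum>i\<in>K. a i I J t t' x)" for I J t t'
      by (rule smooth_fun_sum[OF W(1)]) (rule a)
    fix V and F G :: "'m \<Rightarrow> complex^'d^'d" and x assume V: "open V" "smooth_fun A V F" "smooth_fun A V G" "x \<in> V \<inter> W"
    have "(\<Sum>i\<in>K. P i F G x) = (\<Sum>i\<in>K. \<Sum>I | length I \<le> k. \<Sum>J | length J \<le> k.
        \<Sum>t\<in>UNIV. \<Sum>t'\<in>UNIV. a i I J t t' x *
        chart_derivs c I (\<lambda>y. F y $ fst t $ snd t) x * chart_derivs c J (\<lambda>y. G y $ fst t' $ snd t') x)"
      by (rule sum.cong) (use a(2) V in auto)
    also have "\<dots> = (\<Sum>I | length I \<le> k. \<Sum>J | length J \<le> k. \<Sum>t\<in>UNIV. \<Sum>t'\<in>UNIV. \<Sum>i\<in>K.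
        a i I J t t' x *
        chart_derivs c I (\<lambda>y. F y $ fst t $ snd t) x * chart_derivs c J (\<lambda>y. G y $ fst t' $ snd t') x)"
      unfolding sum.swap[of _ _ K] ..
    finally show "(\<Sum>i\<in>K. P i F G x) = (\<Sum>I | length I \<le> k. \<Sum>J | length J \<le> k.
        \<Sum>t\<in>UNIV. \<Sum>t'\<in>UNIV. (\<Sum>i\<in>K. a i I J t t' x) *
        chart_derivs c I (\<lambda>y. F y $ fst t $ snd t) x * chart_derivs c J (\<lambda>y. G y $ fst t' $ snd t') x)"
      by (simp add: sum_distrib_right)
  qed
qed

lemma bidiff_op_on_mult:
  fixes P :: "('m \<Rightarrow> complex^'d^'d) \<Rightarrow> ('m \<Rightarrow> complex^'d^'d) \<Rightarrow> 'm \<Rightarrow> complex"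
  assumes "bidiff_op_on c W k P" "smooth_fun A W f"
  shows "bidiff_op_on c W k (\<lambda>F G x. f x * P F G x)"
proof -
  obtain a where "bidiff_op_coeffs c W k P a" using assms(1) unfolding bidiff_op_on_def ..
  note a = bidiff_op_coeffsD[OF this]
  show ?thesis
    unfolding bidiff_op_on_def bidiff_op_coeffs_def
  proof (intro exI[of _ "\<lambda>I J t t' x. f x * a I J t t' x"] conjI allI impI ballI)
    show "smooth_fun A W (\<lambda>x. f x * a I J t t' x)" for I J t t'
      by (rule smooth_fun_mult[OF W(1) assms(2) a(1)])
  qed (simp add: a(2) sum_distrib_left mult.assoc)
qed

lemma bidiff_op_on_product:
  fixes P Q :: "('m \<Rightarrow> complex^'d^'d) \<Rightarrow> 'm \<Rightarrow> complex"
  assumes "diff_op c W k P" "diff_op c W k Q"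
  shows "bidiff_op_on c W k (\<lambda>F G x. P F x * Q G x)"
proof -
  obtain a where "diff_op_coeffs c W k P a" using assms(1) unfolding diff_op_def ..
  note a = diff_op_coeffsD[OF this]
  obtain b where "diff_op_coeffs c W k Q b" using assms(2) unfolding diff_op_def ..
  note b = diff_op_coeffsD[OF this]
  show ?thesis
    unfolding bidiff_op_on_def bidiff_op_coeffs_def
  proof (intro exI[of _ "\<lambda>I J t t' x. a I t x * b J t' x"] conjI allI impI ballI)
    show "smooth_fun A W (\<lambda>x. a I t x * b J t' x)" for I J t t'
      by (rule smooth_fun_mult[OF W(1) a(1) b(1)])
    fix V and F G :: "'m \<Rightarrow> complex^'d^'d" and x assume V: "open V" "smooth_fun A V F" "smooth_fun A V G" "x \<in> V \<inter> W"
    let ?f = "\<lambda>I t. a I t x * chart_derivs c I (\<lambda>y. F y $ fst t $ snd t) x"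
    let ?g = "\<lambda>J t. b J t x * chart_derivs c J (\<lambda>y. G y $ fst t $ snd t) x"
    have "P F x * Q G x = (\<Sum>I | length I \<le> k. \<Sum>t\<in>UNIV. ?f I t) * (\<Sum>J | length J \<le> k. \<Sum>t\<in>UNIV. ?g J t)"
      using a(2)[ OF V(1,2,4)] b(2)[ OF V(1,3,4)] by simp
    also have "\<dots> = (\<Sum>I | length I \<le> k. \<Sum>J | length J \<le> k. \<Sum>t\<in>UNIV. \<Sum>t'\<in>UNIV. ?f I t * ?g J t')"
      by (simp only: sum_product)
    finally show "P F x * Q G x = (\<Sum>I | length I \<le> k. \<Sum>J | length J \<le> k. \<Sum>t\<in>UNIV. \<Sum>t'\<in>UNIV.
        a I t x * b J t' x *
        chart_derivs c I (\<lambda>y. F y $ fst t $ snd t) x * chart_derivs c J (\<lambda>y. G y $ fst t' $ snd t') x)"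
      by (simp add: ac_simps)
  qed
qed

lemma diff_op_chart_deriv:
  fixes P :: "('m \<Rightarrow> complex^'d^'d) \<Rightarrow> 'm \<Rightarrow> complex"
  assumes "diff_op c W k P"
  shows "diff_op c W (Suc k) (\<lambda>F. chart_deriv c w (P F))"
proof -
  obtain a where "diff_op_coeffs c W k P a" using assms(1) unfolding diff_op_def ..
  note a = diff_op_coeffsD[OF this]
  \<comment> \<open>Leibniz rule: \<open>b\<close> collects the terms in which the coefficient is
    differentiated, \<open>d\<close> those in which the function is, so that the word
    \<open>I\<close> becomes \<open>w # I\<close>.\<close>
  define b where "b I t = (if length I \<le> k then chart_deriv c w (a I t) else (\<lambda>x. 0))" for I t
  define d where "d I t = (if I \<noteq> [] \<and> hd I = w then a (tl I) t else (\<lambda>x. 0))" for I t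
  have a': "smooth_fun A (V \<inter> W) (a I t)" for V I t
    by (rule smooth_fun_subset[OF a(1)]) simp
  show ?thesis
    unfolding diff_op_def diff_op_coeffs_def
  proof (intro exI[of _ "\<lambda>I t x. b I t x + d I t x"] conjI allI impI ballI)
    fix I t
    have "smooth_fun A W (chart_deriv c w (a I t))"
      using chart_deriv_smooth[OF c W(1) a(1)] W(2) by (simp add: Int_absorb2)
    then have "smooth_fun A W (b I t)" "smooth_fun A W (d I t)"
      using a(1) smooth_fun_const[OF W(1), of "0::complex"] by (simp_all add: b_def d_def)
    then show "smooth_fun A W (\<lambda>x. b I t x + d I t x)" by (rule smooth_fun_add[OF W(1)])
  next
    fix V and F :: "'m \<Rightarrow> complex^'d^'d" and x assume V: "open V" "smooth_fun A V F" and x: "x \<in> V \<inter> W"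
    let ?D = "\<lambda>I t. chart_derivs c I (\<lambda>y. F y $ fst t $ snd t)"
    have VW: "open (V \<inter> W)" using V W by auto
    have x': "x \<in> (V \<inter> W) \<inter> fst c" using x W by auto
    note Dsm = chart_derivs_entry_smooth[OF V]
    have "chart_deriv c w (P F) x =
        chart_deriv c w (\<lambda>y. \<Sum>I | length I \<le> k. \<Sum>t\<in>UNIV. a I t y * ?D I t y) x"
      by (rule chart_deriv_cong[OF c VW x']) (use a(2)[ OF V] in auto)
    also have "\<dots> = (\<Sum>I | length I \<le> k. chart_deriv c w (\<lambda>y. \<Sum>t\<in>UNIV. a I t y * ?D I t y) x)"
      by (rule chart_deriv_sum[OF c VW _ x'])
        (intro smooth_fun_sum[OF VW] smooth_fun_mult[OF VW] a' Dsm)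
    also have "\<dots> = (\<Sum>I | length I \<le> k. \<Sum>t\<in>UNIV. chart_deriv c w (\<lambda>y. a I t y * ?D I t y) x)"
      by (intro sum.cong refl chart_deriv_sum[OF c VW _ x'] smooth_fun_mult[OF VW] a' Dsm)
    also have "\<dots> = (\<Sum>I | length I \<le> k. \<Sum>t\<in>UNIV. chart_deriv c w (a I t) x * ?D I t x +
        a I t x * chart_deriv c w (?D I t) x)"
      by (intro sum.cong refl chart_deriv_mult[OF c a' Dsm x'])
    also have "\<dots> = (\<Sum>I | length I \<le> k. \<Sum>t\<in>UNIV. chart_deriv c w (a I t) x * ?D I t x) +
        (\<Sum>I | length I \<le> k. \<Sum>t\<in>UNIV. a I t x * ?D (w # I) t x)"
      by (simp add: sum.distrib)
    also have "(\<Sum>I | length I \<le> k. \<Sum>t\<in>UNIV. chart_deriv c w (a I t) x * ?D I t x) =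
        (\<Sum>I | length I \<le> Suc k. \<Sum>t\<in>UNIV. b I t x * ?D I t x)"
      by (rule sum.mono_neutral_cong_left) (use finite_words in \<open>auto simp: b_def\<close>)
    \<comment> \<open>The words of this sum all begin with \<open>w\<close>. They are reindexed by
      the full word, and \<open>d\<close> vanishes on every other word of length at most
      \<open>Suc k\<close>.\<close>
    also have "(\<Sum>I | length I \<le> k. \<Sum>t\<in>UNIV. a I t x * ?D (w # I) t x) =
        (\<Sum>I\<in>(#) w ` {I. length I \<le> k}. \<Sum>t\<in>UNIV. d I t x * ?D I t x)"
      by (subst sum.reindex) (auto simp: d_def simp del: chart_derivs.simps)
    also have "\<dots> = (\<Sum>I | length I \<le> Suc k. \<Sum>t\<in>UNIV. d I t x * ?D I t x)"
    proof (rule sum.mono_neutral_left)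
      show "\<forall>I\<in>{I. length I \<le> Suc k} - (#) w ` {I. length I \<le> k}. (\<Sum>t\<in>UNIV. d I t x * ?D I t x) = 0"
      proof
        fix I assume I: "I \<in> {I. length I \<le> Suc k} - (#) w ` {I. length I \<le> k}"
        then have "\<not> (I \<noteq> [] \<and> hd I = w)" by (cases I) auto
        then show "(\<Sum>t\<in>UNIV. d I t x * ?D I t x) = 0" by (auto simp: d_def)
      qed
    qed (use finite_words in auto)
    finally show "chart_deriv c w (P F) x =
        (\<Sum>I | length I \<le> Suc k. \<Sum>t\<in>UNIV. (b I t x + d I t x) * ?D I t x)"
      by (simp add: distrib_right sum.distrib)
  qed
qed

lemma diff_op_chart_derivs:
  fixes P :: "('m \<Rightarrow> complex^'d^'d) \<Rightarrow> 'm \<Rightarrow> complex"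
  assumes "diff_op c W k P"
  shows "diff_op c W (k + length I) (\<lambda>F. chart_derivs c I (P F))"
proof (induction I)
  case (Cons w I)
  from diff_op_chart_deriv[OF this, of w] show ?case by simp
qed (use assms in simp)

end

text \<open>The star product at order \<open>n\<close> involves \<open>C r\<close> for all
  \<open>r \<le> n\<close>. The sum of their orders bounds each of them and is monotone in
  \<open>n\<close>, which the orders themselves need not be.\<close>

definition C_bound :: "nat \<Rightarrow> nat" where
  "C_bound n = (\<Sum>r\<le>n. C_order r)"

lemma C_order_le_bound: "r \<le> n \<Longrightarrow> C_order r \<le> C_bound n"
  unfolding C_bound_def by (rule member_le_sum) auto

lemma C_bound_mono: "m \<le> n \<Longrightarrow> C_bound m \<le> C_bound n"
  unfolding C_bound_def by (rule sum_mono2) auto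

context
  fixes c W
  assumes c: "c \<in> A" and W: "open W" "W \<subseteq> fst c"
begin

text \<open>With \<open>g\<close> frozen, its derivatives join the coefficients; the resulting
  operator therefore lives over the set \<open>W\<close> on which \<open>g\<close> is
  smooth.\<close>

lemma diff_op_C_left:
  fixes P :: "('m \<Rightarrow> complex^'d^'d) \<Rightarrow> 'm \<Rightarrow> complex"
  assumes P: "diff_op c W k P" and g: "smooth_fun A W g"
  shows "diff_op c W (k + C_order r) (\<lambda>F. C r (P F) g)"
proof -
  obtain a where "C_coeffs c r (C_order r) a" using C_coeffs_exist[OF c] ..
  note a = C_coeffsD[OF this]
  have coeff: "smooth_fun A W (\<lambda>x. a I J x * chart_derivs c J g x)" for I J
    using smooth_fun_mult[OF W(1) smooth_fun_subset[OF a(1) W(2)]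
        chart_derivs_smooth[OF c W(1) g, unfolded Int_absorb2[OF W(2)]]] .
  have "diff_op c W (k + C_order r) (\<lambda>F x. \<Sum>I | length I \<le> C_order r. \<Sum>J | length J \<le> C_order r.
      a I J x * chart_derivs c J g x * chart_derivs c I (P F) x)"
    by (intro diff_op_sum[OF c W] diff_op_mult[OF c W] coeff
        diff_op_mono[OF c W diff_op_chart_derivs[OF c W P]]) simp
  then show ?thesis
  proof (rule diff_op_cong[OF c W])
    fix V and F :: "'m \<Rightarrow> complex^'d^'d" and x assume V: "open V" "smooth_fun A V F" "x \<in> V \<inter> W"
    have "open (V \<inter> W)" "x \<in> V \<inter> W \<inter> fst c" using V W by auto
    moreover have "smooth_fun A (V \<inter> W) g" by (rule smooth_fun_subset[OF g]) simp
    moreover note diff_op_smooth[OF c W P V(1,2)]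
    ultimately show "(\<Sum>I | length I \<le> C_order r. \<Sum>J | length J \<le> C_order r.
      a I J x * chart_derivs c J g x * chart_derivs c I (P F) x) = C r (P F) g x"
      using a(2) by (simp add: mult.assoc mult.commute[of "chart_derivs c _ g x"])
  qed
qed

lemma bidiff_op_on_C:
  fixes P Q :: "('m \<Rightarrow> complex^'d^'d) \<Rightarrow> 'm \<Rightarrow> complex"
  assumes P: "diff_op c W k P" and Q: "diff_op c W k Q"
    and l: "k + C_order r \<le> l"
  shows "bidiff_op_on c W l (\<lambda>F G. C r (P F) (Q G))"
proof -
  obtain a where "C_coeffs c r (C_order r) a" using C_coeffs_exist[OF c] ..
  note a = C_coeffsD[OF this]
  have coeff: "smooth_fun A W (a I J)" for I J
    by (rule smooth_fun_subset[OF a(1) W(2)])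
  have "bidiff_op_on c W l (\<lambda>F G x. \<Sum>I | length I \<le> C_order r. \<Sum>J | length J \<le> C_order r.
      a I J x * (chart_derivs c I (P F) x * chart_derivs c J (Q G) x))"
    by (intro bidiff_op_on_sum[OF c W] bidiff_op_on_mult[OF c W] coeff
        bidiff_op_on_product[OF c W] diff_op_mono[OF c W diff_op_chart_derivs[OF c W P]]
        diff_op_mono[OF c W diff_op_chart_derivs[OF c W Q]]) (use l in auto)
  then show ?thesis
  proof (rule bidiff_op_on_cong[OF c W])
    fix V and F G :: "'m \<Rightarrow> complex^'d^'d" and x assume V: "open V" "smooth_fun A V F" "smooth_fun A V G" "x \<in> V \<inter> W"
    have "open (V \<inter> W)" "x \<in> V \<inter> W \<inter> fst c" using V W by auto
    moreover note diff_op_smooth[OF c W P V(1,2)] diff_op_smooth[OF c W Q V(1,3)]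
    ultimately show "(\<Sum>I | length I \<le> C_order r. \<Sum>J | length J \<le> C_order r.
      a I J x * (chart_derivs c I (P F) x * chart_derivs c J (Q G) x)) = C r (P F) (Q G) x"
      using a(2) by (simp add: mult.assoc)
  qed
qed

definition matrix_diff_op :: "nat \<Rightarrow> (('m \<Rightarrow> complex^'d^'d) \<Rightarrow> 'm \<Rightarrow> complex^'d^'d) \<Rightarrow> bool" where
  "matrix_diff_op k P \<longleftrightarrow> (\<forall>i j. diff_op c W k (\<lambda>F x. P F x $ i $ j))"

lemma matrix_diff_op_ident: "matrix_diff_op 0 (\<lambda>F x. F x)"
  unfolding matrix_diff_op_def by (intro allI diff_op_entry[OF c W])

lemma matrix_diff_op_mono: "matrix_diff_op k P \<Longrightarrow> k \<le> k' \<Longrightarrow> matrix_diff_op k' P"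
  unfolding matrix_diff_op_def using diff_op_mono[OF c W] by blast

lemma matrix_diff_op_mult_left:
  assumes "matrix_diff_op k P" "smooth_fun A W u"
  shows "matrix_diff_op k (\<lambda>F x. u x ** P F x)"
  unfolding matrix_diff_op_def matrix_matrix_mult_def vec_lambda_beta
  by (intro allI diff_op_sum[OF c W] diff_op_mult[OF c W] smooth_fun_entry[OF W(1) assms(2)]
      assms(1)[unfolded matrix_diff_op_def, rule_format])

lemma matrix_diff_op_mult_right:
  assumes "matrix_diff_op k P" "smooth_fun A W u"
  shows "matrix_diff_op k (\<lambda>F x. P F x ** u x)"
  unfolding matrix_diff_op_def matrix_matrix_mult_def vec_lambda_beta
  by (subst mult.commute, intro allI diff_op_sum[OF c W] diff_op_mult[OF c W]
      smooth_fun_entry[OF W(1) assms(2)] assms(1)[unfolded matrix_diff_op_def, rule_format])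

text \<open>Order \<open>n\<close> of the product is a finite sum of terms \<open>C r\<close> with
  \<open>r \<le> n\<close>, each applied to an entry of \<open>P F\<close> and one of
  \<open>v (n - r)\<close>; the latter is frozen.\<close>

lemma matrix_diff_op_mstar:
  fixes P :: "('m \<Rightarrow> complex^'d^'d) \<Rightarrow> 'm \<Rightarrow> complex^'d^'d"
  assumes P: "matrix_diff_op k P" and v: "formal_smooth A W v"
  shows "matrix_diff_op (k + C_bound n) (\<lambda>F. mstar C (fconst (P F)) v n)"
  unfolding matrix_diff_op_def
proof (intro allI)
  fix i j
  have v': "smooth_fun A W (\<lambda>y. v m y $ l $ j)" for m l
    by (rule formal_smoothD[OF formal_smooth_entry[OF W(1) v]])
  note P' = P[unfolded matrix_diff_op_def, rule_format]
  have "diff_op c W (k + C_bound n) (\<lambda>F x. \<Sum>l\<in>UNIV. \<Sum>r\<le>n.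
      C r (\<lambda>y. P F y $ i $ l) (\<lambda>y. v (n - r) y $ l $ j) x)"
    by (intro diff_op_sum[OF c W] diff_op_mono[OF c W diff_op_C_left[OF P' v']])
      (use C_order_le_bound in auto)
  then show "diff_op c W (k + C_bound n) (\<lambda>F x. mstar C (fconst (P F)) v n x $ i $ j)"
  proof (rule diff_op_cong[OF c W])
    fix V and F :: "'m \<Rightarrow> complex^'d^'d" and x assume "open V" "x \<in> V \<inter> W"
    then show "(\<Sum>l\<in>UNIV. \<Sum>r\<le>n. C r (\<lambda>y. P F y $ i $ l) (\<lambda>y. v (n - r) y $ l $ j) x) =
        mstar C (fconst (P F)) v n x $ i $ j"
      using star_fconst_left[OF W(1) _ formal_smooth_entry[OF W(1) v], of x]
      by (simp add: mstar_def fconst_entry)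
  qed
qed

lemma matrix_diff_op_smooth:
  fixes P :: "('m \<Rightarrow> complex^'d^'d) \<Rightarrow> 'm \<Rightarrow> complex^'d^'d"
  assumes P: "matrix_diff_op k P" and V: "open V" and F: "smooth_fun A V F"
  shows "smooth_fun A (V \<inter> W) (P F)"
proof -
  have "smooth_fun A (V \<inter> W) (\<lambda>x. P F x $ i $ j)" for i j
    by (rule diff_op_smooth[OF c W P[unfolded matrix_diff_op_def, rule_format] V F])
  moreover have "open (V \<inter> W)" using V W by auto
  ultimately show ?thesis by (simp add: smooth_fun_mat)
qed

lemma matrix_diff_op_form:
  fixes P :: "('m \<Rightarrow> complex^'d^'d) \<Rightarrow> 'm \<Rightarrow> complex^'d^'d"
  assumes "matrix_diff_op k P"
  shows "\<exists>a. (\<forall>I p q i j. smooth_fun A W (a I p q i j)) \<and>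
    (\<forall>V F. open V \<longrightarrow> smooth_fun A V F \<longrightarrow> (\<forall>x\<in>V \<inter> W. \<forall>i j. P F x $ i $ j =
      (\<Sum>I | length I \<le> k. \<Sum>p\<in>UNIV. \<Sum>q\<in>UNIV. a I p q i j x *
        chart_derivs c I (\<lambda>y. F y $ p $ q) x)))"
proof -
  have "\<forall>i j. \<exists>a. diff_op_coeffs c W k (\<lambda>F x. P F x $ i $ j) a"
    using assms unfolding matrix_diff_op_def diff_op_def .
  then obtain a where "\<forall>i j. diff_op_coeffs c W k (\<lambda>F x. P F x $ i $ j) (a i j)"
    unfolding choice_iff by (elim exE)
  note a = diff_op_coeffsD[OF this[rule_format]]
  show ?thesis
  proof (intro exI[of _ "\<lambda>I p q i j. a i j I (p, q)"] conjI allI impI ballI)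
    show "smooth_fun A W (a i j I (p, q))" for I p q i j by (rule a(1))
    fix V and F :: "'m \<Rightarrow> complex^'d^'d" and x i j
    assume V: "open V" "smooth_fun A V F" "x \<in> V \<inter> W"
    show "P F x $ i $ j = (\<Sum>I | length I \<le> k. \<Sum>p\<in>UNIV. \<Sum>q\<in>UNIV. a i j I (p, q) x *
        chart_derivs c I (\<lambda>y. F y $ p $ q) x)"
      using a(2)[OF V, of i j] by (simp add: sum_UNIV_prod)
  qed
qed

text \<open>Two star products are nested, and each may add up to \<open>C_bound n\<close>
  derivatives; hence the order. The Gram matrix, \<open>v\<close> and the pointwise inverse
  contribute to the coefficients.\<close>

lemma bidiff_op_on_local_product:
  fixes u :: "'m \<Rightarrow> complex^'d^'d"
  assumes u: "smooth_fun A W u" and v: "star_inverse A C W u v"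
  shows "bidiff_op_on c W (C_bound n + C_bound n)
    (\<lambda>F G x. local_product C u v (fconst F) (fconst G) n x $ i $ j)"
proof -
  note v' = star_inverse_smooth[OF W(1) u v] and inv = matrix_inv_smooth[OF W(1) u v]
  have Fu: "matrix_diff_op 0 (\<lambda>F x. F x ** u x)"
    by (rule matrix_diff_op_mult_right[OF matrix_diff_op_ident u])
  have T: "matrix_diff_op (C_bound n) (\<lambda>F. mstar C (fconst (\<lambda>x. F x ** u x)) v (n - r))" for r
    by (rule matrix_diff_op_mono[OF matrix_diff_op_mstar[OF Fu v']]) (simp add: C_bound_mono)
  have Fu': "matrix_diff_op (C_bound n) (\<lambda>F x. F x ** u x)"
    by (rule matrix_diff_op_mono[OF Fu]) simp
  have T': "diff_op c W (C_bound n) (\<lambda>F x. mstar C (fconst (\<lambda>x. F x ** u x)) v (n - r) x $ i $ k)" for r i k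
    using T[of r] unfolding matrix_diff_op_def by blast
  have Fu'': "diff_op c W (C_bound n) (\<lambda>F x. (F x ** u x) $ k $ l)" for k l
    using Fu' unfolding matrix_diff_op_def by blast
  let ?R = "\<lambda>F G l x. \<Sum>k\<in>UNIV. \<Sum>r\<le>n. C r (\<lambda>y. mstar C (fconst (\<lambda>x. F x ** u x)) v (n - r) y $ i $ k)
      (\<lambda>y. (G y ** u y) $ k $ l) x"
  have "bidiff_op_on c W (C_bound n + C_bound n) (\<lambda>F G x. \<Sum>l\<in>UNIV. matrix_inv (u x) $ l $ j * ?R F G l x)"
    by (intro bidiff_op_on_sum[OF c W] bidiff_op_on_mult[OF c W] smooth_fun_entry[OF W(1) inv]
        bidiff_op_on_C[OF T' Fu'']) (simp add: C_order_le_bound)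
  then show ?thesis
  proof (rule bidiff_op_on_cong[OF c W])
    fix V and F G :: "'m \<Rightarrow> complex^'d^'d" and x assume V: "open V" "smooth_fun A V F" "smooth_fun A V G" "x \<in> V \<inter> W"
    have VW: "open (V \<inter> W)" using V W by auto
    have "formal_smooth A (V \<inter> W) (mstar C (fconst (\<lambda>x. F x ** u x)) v)"
      unfolding formal_smooth_def
      by (intro allI matrix_diff_op_smooth[OF matrix_diff_op_mstar[OF Fu v'] V(1,2)])
    note e = formal_smooth_entry[OF VW this]
    have "mstar C (mstar C (\<lambda>r y. fconst F r y ** u y) v) (\<lambda>r y. fconst G r y ** u y) n x $ i $ l =
        ?R F G l x" for l
      using star_fconst_right[OF VW V(4) e]
      by (simp add: mstar_def[of C "mstar C _ v"] fconst_entry mult_u_fconst[OF W(1) u v])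
    then show "(\<Sum>l\<in>UNIV. matrix_inv (u x) $ l $ j * ?R F G l x) =
        local_product C u v (fconst F) (fconst G) n x $ i $ j"
      by (simp add: local_product_def matrix_matrix_mult_def[of _ "matrix_inv (u x)"] mult.commute)
  qed
qed

end

end

section \<open>The global product\<close>

locale hermitian_bundle = star_manifold A br C
  for A :: "('m::{t2_space, second_countable_topology}, 'n::finite) chart set" and br C +
  fixes E :: "('m, 'e) vbundle"
    and h :: "'e \<Rightarrow> 'e \<Rightarrow> complex"
    and U :: "'i \<Rightarrow> 'm set"
    and \<psi> :: "'i \<Rightarrow> 'e \<Rightarrow> complex^'d::finite"
    and v :: "'i \<Rightarrow> nat \<Rightarrow> 'm \<Rightarrow> complex^'d^'d"
  assumes bundle_E: "holomorphic_bundle A E U \<psi>"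
    and metric: "hermitian_metric A E U \<psi> h"
    and v: "star_inverse A C (U \<alpha>) (gram E h (\<psi> \<alpha>)) (v \<alpha>)"
begin

abbreviation u :: "'i \<Rightarrow> 'm \<Rightarrow> complex^'d^'d" where "u \<alpha> \<equiv> gram E h (\<psi> \<alpha>)"

abbreviation tr :: "'i \<Rightarrow> 'i \<Rightarrow> 'm \<Rightarrow> complex^'d^'d" where
  "tr \<alpha> \<beta> \<equiv> transition E (\<psi> \<alpha>) (\<psi> \<beta>)"

abbreviation rep :: "'i \<Rightarrow> (nat \<Rightarrow> 'm \<Rightarrow> 'e dual_endo) \<Rightarrow> nat \<Rightarrow> 'm \<Rightarrow> complex^'d^'d" where
  "rep \<alpha> \<equiv> local_rep E (\<psi> \<alpha>)"

abbreviation lprod :: "'i \<Rightarrow> (nat \<Rightarrow> 'm \<Rightarrow> complex^'d^'d) \<Rightarrow> (nat \<Rightarrow> 'm \<Rightarrow> complex^'d^'d) \<Rightarrow>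
    nat \<Rightarrow> 'm \<Rightarrow> complex^'d^'d" where
  "lprod \<alpha> \<equiv> local_product C (u \<alpha>) (v \<alpha>)"

lemma open_U: "open (U \<alpha>)"
  using bundle_E by (simp add: holomorphic_bundle_def)

lemma triv: "trivialization E (U \<alpha>) (\<psi> \<alpha>)"
  using bundle_E by (simp add: holomorphic_bundle_def)

lemma U_cover: "\<exists>\<alpha>. x \<in> U \<alpha>"
  using bundle_E by (auto simp: holomorphic_bundle_def)

lemma u_smooth: "smooth_fun A (U \<alpha>) (u \<alpha>)"
  using metric by (simp add: hermitian_metric_def)

lemma holomorphic_fun_subset:
  assumes "holomorphic_fun A V f" "W \<subseteq> V"
  shows "holomorphic_fun A W f"
  using assms(1) smooth_fun_subset[OF _ assms(2)] subsetD[OF assms(2)]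
  unfolding holomorphic_fun_def by blast

lemma tr_holomorphic: "V \<subseteq> U \<alpha> \<inter> U \<beta> \<Longrightarrow> holomorphic_fun A V (\<lambda>x. tr \<alpha> \<beta> x $ i $ j)"
  by (rule holomorphic_fun_subset[where V = "U \<alpha> \<inter> U \<beta>"])
    (use bundle_E in \<open>simp_all add: holomorphic_bundle_def transition_def\<close>)

lemma tr_smooth: "open V \<Longrightarrow> V \<subseteq> U \<alpha> \<inter> U \<beta> \<Longrightarrow> smooth_fun A V (tr \<alpha> \<beta>)"
  using tr_holomorphic by (simp add: smooth_fun_mat holomorphic_fun_def)

lemma endo_matrix_transition:
  assumes "T \<in> dual_endos E x" "x \<in> U \<alpha>" "x \<in> U \<beta>"
  shows "endo_matrix E (\<psi> \<alpha>) x T = tr \<alpha> \<beta> x ** endo_matrix E (\<psi> \<beta>) x T ** tr \<beta> \<alpha> x"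
  using endo_matrix_matrix_endo[OF triv assms(2) triv assms(3), of "endo_matrix E (\<psi> \<beta>) x T"]
    matrix_endo_endo_matrix[OF triv assms(3,1)] by simp

lemma matrix_endo_transition:
  assumes "x \<in> U \<alpha>" "x \<in> U \<beta>"
  shows "matrix_endo E (\<psi> \<alpha>) x (tr \<alpha> \<beta> x ** M ** tr \<beta> \<alpha> x) = matrix_endo E (\<psi> \<beta>) x M"
  using matrix_endo_endo_matrix[OF triv assms(1) matrix_endo_dual_endos[OF triv assms(2)]]
    endo_matrix_matrix_endo[OF triv assms(1) triv assms(2)] by simp

text \<open>Here \<open>b\<close> is the conjugate transpose of the transition matrix, and the
  reverse transition matrix takes the role of \<open>a'\<close>.\<close>

lemma lprod_transition:
  assumes V: "open V" "V \<subseteq> U \<alpha> \<inter> U \<beta>" and x: "x \<in> V"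
    and F: "formal_smooth A V F" "formal_smooth A V F'"
      "\<And>r x. x \<in> V \<Longrightarrow> F r x = tr \<alpha> \<beta> x ** F' r x ** tr \<beta> \<alpha> x"
    and G: "formal_smooth A V G" "formal_smooth A V G'"
      "\<And>r x. x \<in> V \<Longrightarrow> G r x = tr \<alpha> \<beta> x ** G' r x ** tr \<beta> \<alpha> x"
  shows "lprod \<alpha> F G n x = tr \<alpha> \<beta> x ** lprod \<beta> F' G' n x ** tr \<beta> \<alpha> x"
proof (rule local_product_transition[OF V(1) _ _ _ _ _ _ _ _ _ F(1,2) G(1,2) F(3) G(3) x,
      where b = "\<lambda>x. \<chi> i j. cnj (tr \<alpha> \<beta> x $ j $ i)"])
  have sub: "V \<subseteq> U \<alpha>" "V \<subseteq> U \<beta>" using V by auto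
  show "smooth_fun A V (u \<alpha>)" "smooth_fun A V (u \<beta>)"
    using smooth_fun_subset[OF u_smooth] sub by auto
  show "star_inverse A C V (u \<alpha>) (v \<alpha>)" "star_inverse A C V (u \<beta>) (v \<beta>)"
    using star_inverse_subset[OF v] sub by auto
  show "holomorphic_fun A V (\<lambda>x. tr \<alpha> \<beta> x $ i $ j)" for i j
    by (rule tr_holomorphic[OF V(2)])
  show "holomorphic_fun A V (\<lambda>x. tr \<beta> \<alpha> x $ i $ j)" for i j
    by (rule tr_holomorphic) (use sub in auto)
  show "antiholomorphic_fun A V (\<lambda>x. (\<chi> i j. cnj (tr \<alpha> \<beta> x $ j $ i)) $ i $ j)" for i j
    using antiholomorphic_fun_cnj[OF V(1) tr_holomorphic[OF V(2)]] by simp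
  show "tr \<beta> \<alpha> y ** tr \<alpha> \<beta> y = mat 1"
    and "u \<alpha> y = tr \<alpha> \<beta> y ** u \<beta> y ** (\<chi> i j. cnj (tr \<alpha> \<beta> y $ j $ i))" if "y \<in> V" for y
    using that sub transition_inverse[OF triv _ triv] gram_transition[OF triv _ triv _ metric] by blast+
qed

lemma rep_smooth: "formal_section A E U \<psi> V f \<Longrightarrow> formal_smooth A (V \<inter> U \<alpha>) (rep \<alpha> f)"
  by (simp add: formal_section_def smooth_section_def formal_smooth_def local_rep_def)

lemma formal_section_dual_endos: "formal_section A E U \<psi> V f \<Longrightarrow> x \<in> V \<Longrightarrow> f r x \<in> dual_endos E x"
  by (simp add: formal_section_def smooth_section_def)

text \<open>Stated over an arbitrary open \<open>V\<close>, since the coefficient operators act on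
  local sections as well and the local isomorphism concerns sections over a small set.\<close>

lemma lprod_overlap:
  assumes V: "open V" and f: "formal_section A E U \<psi> V f" and g: "formal_section A E U \<psi> V g"
    and x: "x \<in> V" "x \<in> U \<alpha>" "x \<in> U \<beta>"
  shows "matrix_endo E (\<psi> \<alpha>) x (lprod \<alpha> (rep \<alpha> f) (rep \<alpha> g) n x) =
    matrix_endo E (\<psi> \<beta>) x (lprod \<beta> (rep \<beta> f) (rep \<beta> g) n x)"
proof -
  let ?V = "V \<inter> U \<alpha> \<inter> U \<beta>"
  have "lprod \<alpha> (rep \<alpha> f) (rep \<alpha> g) n x =
      tr \<alpha> \<beta> x ** lprod \<beta> (rep \<beta> f) (rep \<beta> g) n x ** tr \<beta> \<alpha> x"
  proof (rule lprod_transition[where V = ?V])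
    show "open ?V" using V open_U by auto
    show "formal_smooth A ?V (rep \<alpha> f)" "formal_smooth A ?V (rep \<alpha> g)"
      "formal_smooth A ?V (rep \<beta> f)" "formal_smooth A ?V (rep \<beta> g)"
      by (rule formal_smooth_subset[OF rep_smooth[OF f]] formal_smooth_subset[OF rep_smooth[OF g]], blast)+
    show "rep \<alpha> f r y = tr \<alpha> \<beta> y ** rep \<beta> f r y ** tr \<beta> \<alpha> y"
      "rep \<alpha> g r y = tr \<alpha> \<beta> y ** rep \<beta> g r y ** tr \<beta> \<alpha> y" if "y \<in> ?V" for r y
      unfolding local_rep_def
      using that by (auto intro!: endo_matrix_transition formal_section_dual_endos[OF f]
          formal_section_dual_endos[OF g])
  qed (use x in auto)
  then show ?thesis by (simp add: matrix_endo_transition x)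
qed

section \<open>The coefficient operators of the global product\<close>

definition const_section :: "('m \<Rightarrow> 'e dual_endo) \<Rightarrow> nat \<Rightarrow> 'm \<Rightarrow> 'e dual_endo" where
  "const_section F = (\<lambda>r x. if r = 0 then F x else (\<lambda>s e. 0))"

lemma endo_matrix_zero: "endo_matrix E \<phi> x (\<lambda>s e. 0) = 0"
  by (simp add: endo_matrix_def vec_eq_iff)

lemma rep_const_section: "rep \<alpha> (const_section F) = fconst (\<lambda>x. endo_matrix E (\<psi> \<alpha>) x (F x))"
  by (simp add: local_rep_def const_section_def fconst_def endo_matrix_zero fun_eq_iff)

lemma const_section_formal:
  assumes "open V" "smooth_section A E U \<psi> V F"
  shows "formal_section A E U \<psi> V (const_section F)"
proof -
  have "(\<lambda>s e. 0) \<in> dual_endos E x" for x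
    by (simp add: dual_endos_def dual_fibre_def)
  then have "smooth_section A E U \<psi> V (\<lambda>x s e. 0)"
    using assms(1) open_U by (auto simp: smooth_section_def endo_matrix_zero intro!: smooth_fun_const)
  then have "smooth_section A E U \<psi> V (const_section F r)" for r
    using assms(2) by (cases "r = 0") (simp_all add: const_section_def)
  then show ?thesis by (simp add: formal_section_def)
qed

text \<open>A coefficient operator is a function on all total maps and all points, so a
  trivialization has to be picked pointwise. On sections smooth near the point,
  \<open>lprod_overlap\<close> makes the choice immaterial.\<close>

definition bundle_star :: "nat \<Rightarrow> ('m \<Rightarrow> 'e dual_endo) \<Rightarrow> ('m \<Rightarrow> 'e dual_endo) \<Rightarrow> 'm \<Rightarrow> 'e dual_endo" where
  "bundle_star r F G x = (let \<alpha> = SOME \<alpha>. x \<in> U \<alpha> in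
     matrix_endo E (\<psi> \<alpha>) x (lprod \<alpha> (rep \<alpha> (const_section F)) (rep \<alpha> (const_section G)) r x))"

lemma bundle_star_eq:
  assumes "open V" "smooth_section A E U \<psi> V F" "smooth_section A E U \<psi> V G" "x \<in> V" "x \<in> U \<alpha>"
  shows "bundle_star r F G x =
    matrix_endo E (\<psi> \<alpha>) x (lprod \<alpha> (rep \<alpha> (const_section F)) (rep \<alpha> (const_section G)) r x)"
proof -
  have "x \<in> U (SOME \<alpha>. x \<in> U \<alpha>)" using U_cover by (rule someI_ex)
  then show ?thesis
    unfolding bundle_star_def Let_def
    by (intro lprod_overlap[OF assms(1) const_section_formal[OF assms(1,2)]
          const_section_formal[OF assms(1,3)] assms(4) _ assms(5)])
qed

context
  fixes V :: "'m set" and \<alpha> :: 'i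
  assumes V: "open V" "V \<subseteq> U \<alpha>"
begin

lemma u_smooth_on: "smooth_fun A V (u \<alpha>)"
  by (rule smooth_fun_subset[OF u_smooth V(2)])

lemma v_on: "star_inverse A C V (u \<alpha>) (v \<alpha>)"
  by (rule star_inverse_subset[OF v V(2)])

lemmas lprod_smooth = local_product_smooth[OF V(1) u_smooth_on v_on]
lemmas lprod_cong = local_product_cong[OF V(1) u_smooth_on v_on]
lemmas lprod_assoc = local_product_assoc[OF V(1) u_smooth_on v_on]
lemmas lprod_0 = local_product_0[OF V(1) u_smooth_on v_on]
lemmas lprod_expand = local_product_expand[OF V(1) u_smooth_on v_on]

end

context
  fixes V :: "'m set"
  assumes V: "open V"
begin

lemma open_V: "open (V \<inter> U \<alpha>)"
  using V open_U by auto

text \<open>\<open>section_star\<close> adds the operators evaluated on single coefficients; by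
  \<open>lprod_expand\<close> and additivity of \<open>matrix_endo\<close> this sum is the local
  product of the full series.\<close>

lemma section_star_eq:
  assumes f: "formal_section A E U \<psi> V f" and g: "formal_section A E U \<psi> V g"
    and x: "x \<in> V" "x \<in> U \<alpha>"
  shows "section_star bundle_star f g n x = matrix_endo E (\<psi> \<alpha>) x (lprod \<alpha> (rep \<alpha> f) (rep \<alpha> g) n x)"
proof (intro ext)
  fix s e
  have bundle_star: "bundle_star r (f i) (g j) x =
      matrix_endo E (\<psi> \<alpha>) x (lprod \<alpha> (fconst (rep \<alpha> f i)) (fconst (rep \<alpha> g j)) r x)" for r i j
  proof -
    have "smooth_section A E U \<psi> V (f i)" "smooth_section A E U \<psi> V (g j)"
      using f g by (simp_all add: formal_section_def)
    from bundle_star_eq[OF V this x] show ?thesis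
      unfolding rep_const_section by (simp add: local_rep_def)
  qed
  have "lprod \<alpha> (rep \<alpha> f) (rep \<alpha> g) n x = (\<Sum>r\<le>n. \<Sum>i\<le>n - r.
      lprod \<alpha> (fconst (rep \<alpha> f i)) (fconst (rep \<alpha> g (n - r - i))) r x)"
    by (rule lprod_expand[OF open_V _ rep_smooth[OF f] rep_smooth[OF g]]) (use x in auto)
  then show "section_star bundle_star f g n x s e =
      matrix_endo E (\<psi> \<alpha>) x (lprod \<alpha> (rep \<alpha> f) (rep \<alpha> g) n x) s e"
    by (simp add: section_star_def bundle_star matrix_endo_sum)
qed

lemma rep_section_star:
  assumes "formal_section A E U \<psi> V f" "formal_section A E U \<psi> V g" "x \<in> V" "x \<in> U \<alpha>"
  shows "rep \<alpha> (section_star bundle_star f g) n x = lprod \<alpha> (rep \<alpha> f) (rep \<alpha> g) n x"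
  unfolding local_rep_def[of E "\<psi> \<alpha>" "section_star bundle_star f g"] section_star_eq[OF assms]
  by (rule endo_matrix_matrix_endo_self[OF triv assms(4)])

lemma section_star_section:
  assumes f: "formal_section A E U \<psi> V f" and g: "formal_section A E U \<psi> V g"
  shows "formal_section A E U \<psi> V (section_star bundle_star f g)"
  unfolding formal_section_def smooth_section_def
proof (intro allI conjI ballI)
  fix n x assume x: "x \<in> V"
  obtain \<alpha> where "x \<in> U \<alpha>" using U_cover by blast
  then show "section_star bundle_star f g n x \<in> dual_endos E x"
    unfolding section_star_eq[OF f g x \<open>x \<in> U \<alpha>\<close>] by (rule matrix_endo_dual_endos[OF triv])
next
  fix n \<alpha>
  have "formal_smooth A (V \<inter> U \<alpha>) (lprod \<alpha> (rep \<alpha> f) (rep \<alpha> g))"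
    by (rule lprod_smooth[OF open_V _ rep_smooth[OF f] rep_smooth[OF g]]) simp
  then have "formal_smooth A (V \<inter> U \<alpha>) (rep \<alpha> (section_star bundle_star f g))"
    by (rule iffD2[OF formal_smooth_cong[OF open_V], rotated]) (use rep_section_star[OF f g] in simp)
  then show "smooth_fun A (V \<inter> U \<alpha>) (\<lambda>x. endo_matrix E (\<psi> \<alpha>) x (section_star bundle_star f g n x))"
    by (simp add: formal_smooth_def local_rep_def)
qed

text \<open>The claim concerns one point, so one trivialization around it suffices. The
  representative of the inner product is the local product only over
  \<open>V \<inter> U \<alpha>\<close>, whence the appeal to \<open>lprod_cong\<close> before
  \<open>lprod_assoc\<close>.\<close>

lemma section_star_assoc:
  assumes f: "formal_section A E U \<psi> V f" and g: "formal_section A E U \<psi> V g"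
    and k: "formal_section A E U \<psi> V k" and x: "x \<in> V"
  shows "section_star bundle_star (section_star bundle_star f g) k n x = section_star bundle_star f (section_star bundle_star g k) n x"
proof -
  obtain \<alpha> where \<alpha>: "x \<in> U \<alpha>" using U_cover by blast
  let ?V = "V \<inter> U \<alpha>"
  have x': "x \<in> ?V" and sub: "?V \<subseteq> U \<alpha>" using x \<alpha> by auto
  note fg = section_star_section[OF f g] and gk = section_star_section[OF g k]
  note cong = lprod_cong[OF open_V sub _ _ x']
  have "lprod \<alpha> (rep \<alpha> (section_star bundle_star f g)) (rep \<alpha> k) n x =
      lprod \<alpha> (lprod \<alpha> (rep \<alpha> f) (rep \<alpha> g)) (rep \<alpha> k) n x"
    by (rule cong[OF rep_smooth[OF fg] rep_smooth[OF k]]) (simp_all add: rep_section_star[OF f g])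
  also have "\<dots> = lprod \<alpha> (rep \<alpha> f) (lprod \<alpha> (rep \<alpha> g) (rep \<alpha> k)) n x"
    by (rule lprod_assoc[OF open_V sub rep_smooth[OF f] rep_smooth[OF g] rep_smooth[OF k] x'])
  also have "\<dots> = lprod \<alpha> (rep \<alpha> f) (rep \<alpha> (section_star bundle_star g k)) n x"
    by (rule cong[OF rep_smooth[OF f] rep_smooth[OF gk], symmetric])
      (simp_all add: rep_section_star[OF g k])
  finally show ?thesis
    unfolding section_star_eq[OF fg k x \<alpha>] section_star_eq[OF f gk x \<alpha>] by simp
qed

end

lemma bundle_star_0:
  assumes F: "smooth_section A E U \<psi> UNIV F" and G: "smooth_section A E U \<psi> UNIV G"
  shows "bundle_star 0 F G x = F x \<circ> G x"
proof -
  obtain \<alpha> where \<alpha>: "x \<in> U \<alpha>" using U_cover by blast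
  let ?F = "endo_matrix E (\<psi> \<alpha>) x (F x)" and ?G = "endo_matrix E (\<psi> \<alpha>) x (G x)"
  have x: "x \<in> UNIV \<inter> U \<alpha>" using \<alpha> by simp
  have "lprod \<alpha> (rep \<alpha> (const_section F)) (rep \<alpha> (const_section G)) 0 x =
      rep \<alpha> (const_section F) 0 x ** rep \<alpha> (const_section G) 0 x"
    by (rule lprod_0[OF open_V[OF open_UNIV] _ rep_smooth[OF const_section_formal[OF open_UNIV F]]
          rep_smooth[OF const_section_formal[OF open_UNIV G]] x]) simp
  then have "bundle_star 0 F G x = matrix_endo E (\<psi> \<alpha>) x ?F \<circ> matrix_endo E (\<psi> \<alpha>) x ?G"
    using bundle_star_eq[OF open_UNIV F G UNIV_I \<alpha>] matrix_endo_mult[OF triv \<alpha>]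
    by (simp add: rep_const_section fconst_def)
  then show ?thesis
    using F G matrix_endo_endo_matrix[OF triv \<alpha>] by (simp add: smooth_section_def)
qed

text \<open>The order must precede \<alpha> and \<open>c\<close>, and it can because
  \<open>C_bound\<close> depends on neither; the coefficients are then chosen for each chart,
  trivialization and matrix entry.\<close>

lemma bundle_star_bidiff: "section_bidiff_op A E U \<psi> (bundle_star r)"
  unfolding section_bidiff_op_def
proof (intro conjI allI impI ballI exI[of _ "C_bound r + C_bound r"])
  fix V F G x
  assume *: "open V" "smooth_section A E U \<psi> V F" "smooth_section A E U \<psi> V G" "x \<in> V"
  obtain \<alpha> where \<alpha>: "x \<in> U \<alpha>" using U_cover by blast
  show "bundle_star r F G x \<in> dual_endos E x"
    unfolding bundle_star_eq[OF * \<alpha>] by (rule matrix_endo_dual_endos[OF triv \<alpha>])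
next
  fix \<alpha> c assume c: "c \<in> A"
  let ?k = "C_bound r + C_bound r"
  let ?W = "U \<alpha> \<inter> fst c"
  have W: "open ?W" "?W \<subseteq> fst c" "?W \<subseteq> U \<alpha>" using open_U open_chart[OF c] by auto
  have "\<forall>i j. \<exists>a. bidiff_op_coeffs c ?W ?k
      (\<lambda>F G x. lprod \<alpha> (fconst F) (fconst G) r x $ i $ j) a"
    using bidiff_op_on_local_product[OF c W(1,2) u_smooth_on[OF W(1,3)] v_on[OF W(1,3)]]
    unfolding bidiff_op_on_def by (intro allI)
  then obtain a where "\<forall>i j. bidiff_op_coeffs c ?W ?k
      (\<lambda>F G x. lprod \<alpha> (fconst F) (fconst G) r x $ i $ j) (a i j)"
    unfolding choice_iff by (elim exE)
  note a = bidiff_op_coeffsD[OF this[rule_format]]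
  let ?a = "\<lambda>I J p q p' q' i j. a i j I J (p, q) (p', q')"
  have smooth: "\<forall>I J p q p' q' i j. smooth_fun A ?W (?a I J p q p' q' i j)"
    using a(1) by blast
  have form: "endo_matrix E (\<psi> \<alpha>) x (bundle_star r F G x) $ i $ j =
      (\<Sum>I | length I \<le> ?k. \<Sum>J | length J \<le> ?k.
        \<Sum>p\<in>UNIV. \<Sum>q\<in>UNIV. \<Sum>p'\<in>UNIV. \<Sum>q'\<in>UNIV. ?a I J p q p' q' i j x *
          chart_derivs c I (\<lambda>y. endo_matrix E (\<psi> \<alpha>) y (F y) $ p $ q) x *
          chart_derivs c J (\<lambda>y. endo_matrix E (\<psi> \<alpha>) y (G y) $ p' $ q') x)"
    if *: "open V" "smooth_section A E U \<psi> V F" "smooth_section A E U \<psi> V G" "x \<in> V \<inter> U \<alpha> \<inter> fst c"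
    for V F G x i j
  proof -
    have x: "x \<in> V" "x \<in> U \<alpha>" "x \<in> (V \<inter> U \<alpha>) \<inter> ?W" using *(4) by auto
    have sm: "smooth_fun A (V \<inter> U \<alpha>) (\<lambda>x. endo_matrix E (\<psi> \<alpha>) x (F x))"
      "smooth_fun A (V \<inter> U \<alpha>) (\<lambda>x. endo_matrix E (\<psi> \<alpha>) x (G x))"
      using *(2,3) by (simp_all add: smooth_section_def)
    show ?thesis
      unfolding bundle_star_eq[OF *(1-3) x(1,2)] endo_matrix_matrix_endo_self[OF triv x(2)] rep_const_section
      using a(2)[OF open_V[OF *(1)] sm x(3), of i j]
      by (simp add: sum_UNIV_prod)
  qed
  show "\<exists>a. (\<forall>I J p q p' q' i j. smooth_fun A ?W (a I J p q p' q' i j)) \<and>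
    (\<forall>V F G. open V \<longrightarrow> smooth_section A E U \<psi> V F \<longrightarrow> smooth_section A E U \<psi> V G \<longrightarrow>
      (\<forall>x\<in>V \<inter> U \<alpha> \<inter> fst c. \<forall>i j. endo_matrix E (\<psi> \<alpha>) x (bundle_star r F G x) $ i $ j =
        (\<Sum>I | length I \<le> ?k. \<Sum>J | length J \<le> ?k.
          \<Sum>p\<in>UNIV. \<Sum>q\<in>UNIV. \<Sum>p'\<in>UNIV. \<Sum>q'\<in>UNIV. a I J p q p' q' i j x *
            chart_derivs c I (\<lambda>y. endo_matrix E (\<psi> \<alpha>) y (F y) $ p $ q) x *
            chart_derivs c J (\<lambda>y. endo_matrix E (\<psi> \<alpha>) y (G y) $ p' $ q') x)))"
    by (intro exI[of _ ?a] conjI smooth allI impI ballI, rule form)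
qed

section \<open>The local isomorphism by formal differential operators\<close>

context
  fixes \<alpha> :: 'i
begin

definition to_matrix_op :: "nat \<Rightarrow> ('m \<Rightarrow> 'e dual_endo) \<Rightarrow> 'm \<Rightarrow> complex^'d^'d" where
  "to_matrix_op r F = mstar C (fconst (\<lambda>x. endo_matrix E (\<psi> \<alpha>) x (F x) ** u \<alpha> x)) (v \<alpha>) r"

definition from_matrix_op :: "nat \<Rightarrow> ('m \<Rightarrow> complex^'d^'d) \<Rightarrow> 'm \<Rightarrow> 'e dual_endo" where
  "from_matrix_op r F x = matrix_endo E (\<psi> \<alpha>) x
     (mstar C (fconst F) (fconst (u \<alpha>)) r x ** matrix_inv (u \<alpha> x))"

text \<open>The operator is built from the trivialization \<alpha>, but its coefficients are
  demanded with respect to every trivialization \<beta>. Writing the representative for \<alpha> as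
  the conjugate of the one for \<beta> turns the transition matrices into smooth coefficients; this
  is the operator \<open>P\<close>.\<close>

lemma to_matrix_op_diff_op: "section_to_matrix_diff_op A E U \<psi> (U \<alpha>) (to_matrix_op r)"
  unfolding section_to_matrix_diff_op_def
proof (intro exI[of _ "C_bound r"] allI ballI)
  fix \<beta> c assume c: "c \<in> A"
  let ?W = "U \<alpha> \<inter> U \<beta> \<inter> fst c"
  have W: "open ?W" "?W \<subseteq> fst c" "?W \<subseteq> U \<alpha>" "?W \<subseteq> U \<alpha> \<inter> U \<beta>" "?W \<subseteq> U \<beta> \<inter> U \<alpha>"
    using open_U open_chart[OF c] by auto
  define P where "P F = mstar C (fconst (\<lambda>x. tr \<alpha> \<beta> x ** F x ** tr \<beta> \<alpha> x ** u \<alpha> x)) (v \<alpha>) r" for F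
  have "matrix_diff_op c ?W (0 + C_bound r) P"
    unfolding P_def
    by (intro matrix_diff_op_mstar[OF c W(1,2)] matrix_diff_op_mult_right[OF c W(1,2)]
        matrix_diff_op_mult_left[OF c W(1,2)] matrix_diff_op_ident[OF c W(1,2)]
        tr_smooth[OF W(1)] W(4,5) u_smooth_on[OF W(1,3)]
        star_inverse_smooth[OF W(1) u_smooth_on[OF W(1,3)] v_on[OF W(1,3)]])
  then have "\<exists>a. (\<forall>I p q i j. smooth_fun A ?W (a I p q i j)) \<and>
    (\<forall>V F. open V \<longrightarrow> smooth_fun A V F \<longrightarrow> (\<forall>x\<in>V \<inter> ?W. \<forall>i j. P F x $ i $ j =
      (\<Sum>I | length I \<le> C_bound r. \<Sum>p\<in>UNIV. \<Sum>q\<in>UNIV. a I p q i j x *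
        chart_derivs c I (\<lambda>y. F y $ p $ q) x)))"
    using matrix_diff_op_form[OF c W(1,2)] by simp
  then obtain a where a: "\<forall>I p q i j. smooth_fun A ?W (a I p q i j)"
    "\<forall>V F. open V \<longrightarrow> smooth_fun A V F \<longrightarrow> (\<forall>x\<in>V \<inter> ?W. \<forall>i j. P F x $ i $ j =
      (\<Sum>I | length I \<le> C_bound r. \<Sum>p\<in>UNIV. \<Sum>q\<in>UNIV. a I p q i j x *
        chart_derivs c I (\<lambda>y. F y $ p $ q) x))"
    by (elim exE conjE)
  have form: "to_matrix_op r F x $ i $ j = (\<Sum>I | length I \<le> C_bound r. \<Sum>p\<in>UNIV. \<Sum>q\<in>UNIV.
      a I p q i j x * chart_derivs c I (\<lambda>y. endo_matrix E (\<psi> \<beta>) y (F y) $ p $ q) x)"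
    if *: "open V" "V \<subseteq> U \<alpha>" "smooth_section A E U \<psi> V F" "x \<in> V \<inter> U \<beta> \<inter> fst c" for V F x i j
  proof -
    let ?V = "V \<inter> U \<beta>"
    have x: "x \<in> ?V" "x \<in> ?V \<inter> ?W" using * by auto
    have V: "open ?V" "?V \<subseteq> U \<alpha>" using *(1,2) open_U by auto
    have \<beta>: "smooth_fun A ?V (\<lambda>x. endo_matrix E (\<psi> \<beta>) x (F x))"
      using *(3) by (simp add: smooth_section_def)
    have "smooth_fun A (V \<inter> U \<alpha>) (\<lambda>x. endo_matrix E (\<psi> \<alpha>) x (F x))"
      using *(3) by (simp add: smooth_section_def)
    then have \<alpha>: "smooth_fun A ?V (\<lambda>x. endo_matrix E (\<psi> \<alpha>) x (F x))"
      by (rule smooth_fun_subset) (use *(2) in auto)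
    have "to_matrix_op r F x = P (\<lambda>x. endo_matrix E (\<psi> \<beta>) x (F x)) x"
      unfolding to_matrix_op_def P_def
    proof (rule mstar_cong[OF V(1) x(1)])
      show "formal_smooth A ?V (fconst (\<lambda>x. endo_matrix E (\<psi> \<alpha>) x (F x) ** u \<alpha> x))"
        by (intro formal_smooth_fconst smooth_fun_matrix_mult V \<alpha> u_smooth_on)
      show "formal_smooth A ?V (v \<alpha>)"
        by (rule star_inverse_smooth[OF V(1) u_smooth_on[OF V] v_on[OF V]])
      show "fconst (\<lambda>x. endo_matrix E (\<psi> \<alpha>) x (F x) ** u \<alpha> x) r y =
          fconst (\<lambda>x. tr \<alpha> \<beta> x ** endo_matrix E (\<psi> \<beta>) x (F x) ** tr \<beta> \<alpha> x ** u \<alpha> x) r y"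
        if y: "y \<in> ?V" for r y
      proof -
        have "F y \<in> dual_endos E y" using *(3) y by (simp add: smooth_section_def)
        from endo_matrix_transition[OF this, of \<alpha> \<beta>] y V(2) show ?thesis by (auto simp: fconst_def)
      qed
    qed simp
    with a(2)[rule_format, OF V(1) \<beta> x(2)] show ?thesis by simp
  qed
  show "\<exists>a. (\<forall>I p q i j. smooth_fun A ?W (a I p q i j)) \<and>
    (\<forall>V F. open V \<longrightarrow> V \<subseteq> U \<alpha> \<longrightarrow> smooth_section A E U \<psi> V F \<longrightarrow>
      (\<forall>x\<in>V \<inter> U \<beta> \<inter> fst c. \<forall>i j. to_matrix_op r F x $ i $ j =
        (\<Sum>I | length I \<le> C_bound r. \<Sum>p\<in>UNIV. \<Sum>q\<in>UNIV. a I p q i j x *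
          chart_derivs c I (\<lambda>y. endo_matrix E (\<psi> \<beta>) y (F y) $ p $ q) x)))"
    by (intro exI[of _ a] conjI a(1) allI impI ballI, rule form)
qed

text \<open>Here it is the output that must be read in every trivialization \<beta>, so in
  \<open>P\<close> the transition matrices enclose the result instead of the argument.\<close>

lemma from_matrix_op_diff_op: "matrix_to_section_diff_op A E U \<psi> (U \<alpha>) (from_matrix_op r)"
  unfolding matrix_to_section_diff_op_def
proof (intro exI[of _ "C_bound r"] conjI allI ballI impI)
  fix V :: "'m set" and F x assume "V \<subseteq> U \<alpha>" "x \<in> V"
  then have "x \<in> U \<alpha>" by auto
  then show "from_matrix_op r F x \<in> dual_endos E x"
    unfolding from_matrix_op_def by (rule matrix_endo_dual_endos[OF triv])
next
  fix \<beta> c assume c: "c \<in> A"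
  let ?W = "U \<alpha> \<inter> U \<beta> \<inter> fst c"
  have W: "open ?W" "?W \<subseteq> fst c" "?W \<subseteq> U \<alpha>" "?W \<subseteq> U \<alpha> \<inter> U \<beta>" "?W \<subseteq> U \<beta> \<inter> U \<alpha>"
    using open_U open_chart[OF c] by auto
  define P where "P F x = tr \<beta> \<alpha> x ** (mstar C (fconst F) (fconst (u \<alpha>)) r x ** matrix_inv (u \<alpha> x)) ** tr \<alpha> \<beta> x"
    for F x
  have "matrix_diff_op c ?W (0 + C_bound r) P"
    unfolding P_def[abs_def]
    by (intro matrix_diff_op_mult_right[OF c W(1,2)]
        matrix_diff_op_mult_left[OF c W(1,2)] matrix_diff_op_mstar[OF c W(1,2)]
        matrix_diff_op_ident[OF c W(1,2)] tr_smooth[OF W(1)] W(4,5)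
        fconst_u_smooth[OF W(1) u_smooth_on[OF W(1,3)] v_on[OF W(1,3)]]
        matrix_inv_smooth[OF W(1) u_smooth_on[OF W(1,3)] v_on[OF W(1,3)]])
  then have "\<exists>a. (\<forall>I p q i j. smooth_fun A ?W (a I p q i j)) \<and>
    (\<forall>V F. open V \<longrightarrow> smooth_fun A V F \<longrightarrow> (\<forall>x\<in>V \<inter> ?W. \<forall>i j. P F x $ i $ j =
      (\<Sum>I | length I \<le> C_bound r. \<Sum>p\<in>UNIV. \<Sum>q\<in>UNIV. a I p q i j x *
        chart_derivs c I (\<lambda>y. F y $ p $ q) x)))"
    using matrix_diff_op_form[OF c W(1,2)] by simp
  then obtain a where a: "\<forall>I p q i j. smooth_fun A ?W (a I p q i j)"
    "\<forall>V F. open V \<longrightarrow> smooth_fun A V F \<longrightarrow> (\<forall>x\<in>V \<inter> ?W. \<forall>i j. P F x $ i $ j =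
      (\<Sum>I | length I \<le> C_bound r. \<Sum>p\<in>UNIV. \<Sum>q\<in>UNIV. a I p q i j x *
        chart_derivs c I (\<lambda>y. F y $ p $ q) x))"
    by (elim exE conjE)
  have form: "endo_matrix E (\<psi> \<beta>) x (from_matrix_op r F x) $ i $ j =
      (\<Sum>I | length I \<le> C_bound r. \<Sum>p\<in>UNIV. \<Sum>q\<in>UNIV.
        a I p q i j x * chart_derivs c I (\<lambda>y. F y $ p $ q) x)"
    if *: "open V" "V \<subseteq> U \<alpha>" "smooth_fun A V F" "x \<in> V \<inter> U \<beta> \<inter> fst c" for V F x i j
  proof -
    have x: "x \<in> U \<alpha>" "x \<in> U \<beta>" "x \<in> V \<inter> ?W" using * by auto
    have "endo_matrix E (\<psi> \<beta>) x (from_matrix_op r F x) = P F x"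
      unfolding from_matrix_op_def P_def by (rule endo_matrix_matrix_endo[OF triv x(2) triv x(1)])
    with a(2)[rule_format, OF *(1,3) x(3)] show ?thesis by simp
  qed
  show "\<exists>a. (\<forall>I p q i j. smooth_fun A ?W (a I p q i j)) \<and>
    (\<forall>V F. open V \<longrightarrow> V \<subseteq> U \<alpha> \<longrightarrow> smooth_fun A V F \<longrightarrow>
      (\<forall>x\<in>V \<inter> U \<beta> \<inter> fst c. \<forall>i j. endo_matrix E (\<psi> \<beta>) x (from_matrix_op r F x) $ i $ j =
        (\<Sum>I | length I \<le> C_bound r. \<Sum>p\<in>UNIV. \<Sum>q\<in>UNIV. a I p q i j x *
          chart_derivs c I (\<lambda>y. F y $ p $ q) x)))"
    by (intro exI[of _ a] conjI a(1) allI impI ballI, rule form)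
qed

lemmas U_facts = open_U[of \<alpha>] u_smooth[of \<alpha>] v[of \<alpha>]

text \<open>By linearity over \<nu> in the left factor, the operators \<open>to_matrix_op r\<close>
  assemble to the algebraic map \<open>to_matrix\<close>, whose properties thereby carry over to
  sections.\<close>

lemma formal_to_matrix_T:
  assumes "x \<in> U \<alpha>"
  shows "formal_to_matrix to_matrix_op f n x = to_matrix (u \<alpha>) (v \<alpha>) (rep \<alpha> f) n x"
proof -
  have "to_matrix (u \<alpha>) (v \<alpha>) (rep \<alpha> f) n x =
      (\<Sum>i\<le>n. mstar C (fconst (\<lambda>x. rep \<alpha> f i x ** u \<alpha> x)) (v \<alpha>) (n - i) x)"
    unfolding to_matrix_def[OF U_facts]
    by (rule mstar_expand_left[OF open_U assms star_inverse_smooth[OF U_facts]])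
  also have "\<dots> = (\<Sum>i\<le>n. to_matrix_op (n - i) (f i) x)"
    by (simp add: to_matrix_op_def local_rep_def)
  also have "\<dots> = formal_to_matrix to_matrix_op f n x"
    unfolding formal_to_matrix_def by (rule sum_antidiagonal_flip[of "\<lambda>i r. to_matrix_op r (f i) x"])
  finally show ?thesis by simp
qed

lemma formal_to_section_S:
  assumes x: "x \<in> U \<alpha>" and F: "formal_smooth A (U \<alpha>) F"
  shows "formal_to_section from_matrix_op F n x = matrix_endo E (\<psi> \<alpha>) x (from_matrix (u \<alpha>) F n x)"
proof (intro ext)
  fix s e
  have "from_matrix (u \<alpha>) F n x =
      (\<Sum>i\<le>n. mstar C (fconst (F i)) (fconst (u \<alpha>)) (n - i) x ** matrix_inv (u \<alpha> x))"
    unfolding from_matrix_def[OF U_facts] sum_matrix_mult_right[symmetric]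
    by (subst mstar_expand_left[OF open_U x fconst_u_smooth[OF U_facts]]) (rule refl)
  then have "matrix_endo E (\<psi> \<alpha>) x (from_matrix (u \<alpha>) F n x) s e = (\<Sum>i\<le>n. from_matrix_op (n - i) (F i) x s e)"
    by (simp add: matrix_endo_sum from_matrix_op_def)
  also have "\<dots> = formal_to_section from_matrix_op F n x s e"
    unfolding formal_to_section_def by (rule sum_antidiagonal_flip[of "\<lambda>i r. from_matrix_op r (F i) x s e"])
  finally show "formal_to_section from_matrix_op F n x s e =
      matrix_endo E (\<psi> \<alpha>) x (from_matrix (u \<alpha>) F n x) s e" by simp
qed

lemma rep_smooth_U:
  assumes "formal_section A E U \<psi> (U \<alpha>) f"
  shows "formal_smooth A (U \<alpha>) (rep \<alpha> f)"
  using rep_smooth[OF assms, of \<alpha>] by simp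

lemma to_matrix_cong:
  assumes "formal_smooth A (U \<alpha>) F" "\<And>r y. y \<in> U \<alpha> \<Longrightarrow> F r y = G r y" "x \<in> U \<alpha>"
  shows "to_matrix (u \<alpha>) (v \<alpha>) F n x = to_matrix (u \<alpha>) (v \<alpha>) G n x"
  unfolding to_matrix_def[OF U_facts]
  by (rule mstar_cong[OF open_U assms(3) mult_u_smooth[OF U_facts assms(1)] star_inverse_smooth[OF U_facts]])
    (simp_all add: assms(2))

lemma formal_to_matrix_smooth:
  assumes "formal_section A E U \<psi> (U \<alpha>) f"
  shows "formal_smooth A (U \<alpha>) (formal_to_matrix to_matrix_op f)"
  by (rule iffD2[OF formal_smooth_cong[OF open_U formal_to_matrix_T]
        to_matrix_smooth[OF U_facts rep_smooth_U[OF assms]]])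

lemma from_matrix_op_to_matrix_op:
  assumes f: "formal_section A E U \<psi> (U \<alpha>) f" and x: "x \<in> U \<alpha>"
  shows "formal_to_section from_matrix_op (formal_to_matrix to_matrix_op f) n x = f n x"
proof -
  have "from_matrix (u \<alpha>) (formal_to_matrix to_matrix_op f) n x =
      from_matrix (u \<alpha>) (to_matrix (u \<alpha>) (v \<alpha>) (rep \<alpha> f)) n x"
    unfolding from_matrix_def[OF U_facts]
    by (subst mstar_cong[OF open_U x formal_to_matrix_smooth[OF f] fconst_u_smooth[OF U_facts]
          formal_to_matrix_T refl]) (auto intro: refl)
  also have "\<dots> = rep \<alpha> f n x"
    by (rule from_matrix_to_matrix[OF U_facts rep_smooth_U[OF f] x])
  finally show ?thesis
    unfolding formal_to_section_S[OF x formal_to_matrix_smooth[OF f]] local_rep_def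
    using matrix_endo_endo_matrix[OF triv x formal_section_dual_endos[OF f x]] by simp
qed

lemma rep_formal_to_section:
  assumes F: "formal_smooth A (U \<alpha>) F" and x: "x \<in> U \<alpha>"
  shows "rep \<alpha> (formal_to_section from_matrix_op F) n x = from_matrix (u \<alpha>) F n x"
  unfolding local_rep_def formal_to_section_S[OF x F]
  by (rule endo_matrix_matrix_endo_self[OF triv x])

lemma to_matrix_op_from_matrix_op:
  assumes F: "formal_smooth A (U \<alpha>) F" and x: "x \<in> U \<alpha>"
  shows "formal_to_matrix to_matrix_op (formal_to_section from_matrix_op F) n x = F n x"
proof -
  have "to_matrix (u \<alpha>) (v \<alpha>) (rep \<alpha> (formal_to_section from_matrix_op F)) n x =
      to_matrix (u \<alpha>) (v \<alpha>) (from_matrix (u \<alpha>) F) n x"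
    by (rule to_matrix_cong[OF from_matrix_smooth[OF U_facts F] rep_formal_to_section[OF F, symmetric] x,
          symmetric])
  also have "\<dots> = F n x" by (rule to_matrix_from_matrix[OF U_facts F x])
  finally show ?thesis by (simp add: formal_to_matrix_T[OF x])
qed

lemma to_matrix_op_section_star:
  assumes f: "formal_section A E U \<psi> (U \<alpha>) f" and g: "formal_section A E U \<psi> (U \<alpha>) g"
    and x: "x \<in> U \<alpha>"
  shows "formal_to_matrix to_matrix_op (section_star bundle_star f g) n x =
    mstar C (formal_to_matrix to_matrix_op f) (formal_to_matrix to_matrix_op g) n x"
proof -
  have "formal_to_matrix to_matrix_op (section_star bundle_star f g) n x =
      to_matrix (u \<alpha>) (v \<alpha>) (rep \<alpha> (section_star bundle_star f g)) n x"
    by (rule formal_to_matrix_T[OF x])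
  also have "\<dots> = to_matrix (u \<alpha>) (v \<alpha>) (lprod \<alpha> (rep \<alpha> f) (rep \<alpha> g)) n x"
    by (rule to_matrix_cong[OF rep_smooth_U[OF section_star_section[OF open_U f g]] _ x])
      (simp add: rep_section_star[OF open_U f g])
  also have "\<dots> = mstar C (to_matrix (u \<alpha>) (v \<alpha>) (rep \<alpha> f)) (to_matrix (u \<alpha>) (v \<alpha>) (rep \<alpha> g)) n x"
    by (rule to_matrix_local_product[OF U_facts rep_smooth_U[OF f] rep_smooth_U[OF g] x])
  also have "\<dots> = mstar C (formal_to_matrix to_matrix_op f) (formal_to_matrix to_matrix_op g) n x"
    by (rule mstar_cong[OF open_U x formal_to_matrix_smooth[OF f] formal_to_matrix_smooth[OF g]
          formal_to_matrix_T formal_to_matrix_T, symmetric])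
  finally show ?thesis .
qed

end

theorem associated_star_product_bundle_star: "associated_star_product A C E U \<psi> bundle_star"
  unfolding associated_star_product_def
proof (intro conjI allI impI)
  fix x0
  obtain \<alpha> where "x0 \<in> U \<alpha>" using U_cover by blast
  \<comment> \<open>Any trivializing set around the point serves as \<open>W\<close>.\<close>
  then show "\<exists>W to_matrix_op from_matrix_op. open W \<and> x0 \<in> W \<and>
        (\<forall>r. section_to_matrix_diff_op A E U \<psi> W (to_matrix_op r)) \<and>
        (\<forall>r. matrix_to_section_diff_op A E U \<psi> W (from_matrix_op r)) \<and>
        (\<forall>f. formal_section A E U \<psi> W f \<longrightarrow>
           (\<forall>n. \<forall>x\<in>W. formal_to_section from_matrix_op (formal_to_matrix to_matrix_op f) n x = f n x)) \<and>
        (\<forall>F. formal_smooth A W F \<longrightarrow>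
           (\<forall>n. \<forall>x\<in>W. formal_to_matrix to_matrix_op (formal_to_section from_matrix_op F) n x = F n x)) \<and>
        (\<forall>f g. formal_section A E U \<psi> W f \<longrightarrow> formal_section A E U \<psi> W g \<longrightarrow>
           (\<forall>n. \<forall>x\<in>W. formal_to_matrix to_matrix_op (section_star bundle_star f g) n x =
              mstar C (formal_to_matrix to_matrix_op f) (formal_to_matrix to_matrix_op g) n x))"
    by (intro exI[of _ "U \<alpha>"] exI[of _ "to_matrix_op \<alpha>"] exI[of _ "from_matrix_op \<alpha>"])
      (simp add: open_U to_matrix_op_diff_op from_matrix_op_diff_op from_matrix_op_to_matrix_op to_matrix_op_from_matrix_op to_matrix_op_section_star)
qed (simp_all add: bundle_star_bidiff bundle_star_0 section_star_assoc[OF open_UNIV])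

end

text \<open>The witness for \<open>B\<close> is \<open>bundle_star\<close>; agreement on overlaps
  and the local formula are the case \<open>V = UNIV\<close> of facts proved over open sets.\<close>

theorem lemma3:
  fixes A :: "('m::{t2_space, second_countable_topology}, 'n::finite) chart set"
    and br :: "('m \<Rightarrow> complex) \<Rightarrow> ('m \<Rightarrow> complex) \<Rightarrow> 'm \<Rightarrow> complex"
    and C :: "nat \<Rightarrow> ('m \<Rightarrow> complex) \<Rightarrow> ('m \<Rightarrow> complex) \<Rightarrow> 'm \<Rightarrow> complex"
    and E :: "('m, 'e) vbundle"
    and h :: "'e \<Rightarrow> 'e \<Rightarrow> complex"
    and U :: "'i \<Rightarrow> 'm set"
    and \<psi> :: "'i \<Rightarrow> 'e \<Rightarrow> complex^'d::finite"
    and v :: "'i \<Rightarrow> nat \<Rightarrow> 'm \<Rightarrow> complex^'d^'d"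
  defines "u \<equiv> \<lambda>\<alpha>. gram E h (\<psi> \<alpha>)"
  defines "lprod \<equiv> \<lambda>\<alpha> f g. local_product C (u \<alpha>) (v \<alpha>) (local_rep E (\<psi> \<alpha>) f) (local_rep E (\<psi> \<alpha>) g)"
  assumes "kaehler_poisson A br"
    and "star_product A br C"
    and "separation_of_variables A C"
    and "holomorphic_bundle A E U \<psi>"
    and "hermitian_metric A E U \<psi> h"
    and "\<And>\<alpha>. star_inverse A C (U \<alpha>) (u \<alpha>) (v \<alpha>)"
  shows "(\<forall>f g. formal_section A E U \<psi> UNIV f \<longrightarrow> formal_section A E U \<psi> UNIV g \<longrightarrow>
            (\<forall>\<alpha> \<beta> n. \<forall>x\<in>U \<alpha> \<inter> U \<beta>.
               matrix_endo E (\<psi> \<alpha>) x (lprod \<alpha> f g n x) = matrix_endo E (\<psi> \<beta>) x (lprod \<beta> f g n x)))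
       \<and> (\<exists>B. associated_star_product A C E U \<psi> B \<and>
            (\<forall>f g. formal_section A E U \<psi> UNIV f \<longrightarrow> formal_section A E U \<psi> UNIV g \<longrightarrow>
               (\<forall>\<alpha> n. \<forall>x\<in>U \<alpha>.
                  section_star B f g n x = matrix_endo E (\<psi> \<alpha>) x (lprod \<alpha> f g n x))))"
proof -
  interpret hermitian_bundle A br C E h U \<psi> v
    by unfold_locales (use assms(3-8) in \<open>simp_all add: kaehler_poisson_def u_def\<close>)
  have "matrix_endo E (\<psi> \<alpha>) x (lprod \<alpha> f g n x) = matrix_endo E (\<psi> \<beta>) x (lprod \<beta> f g n x)"
    if "formal_section A E U \<psi> UNIV f" "formal_section A E U \<psi> UNIV g" "x \<in> U \<alpha> \<inter> U \<beta>"
    for f g \<alpha> \<beta> n x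
    unfolding lprod_def u_def
    by (rule lprod_overlap[OF open_UNIV that(1,2)]) (use that(3) in auto)
  moreover have "section_star bundle_star f g n x = matrix_endo E (\<psi> \<alpha>) x (lprod \<alpha> f g n x)"
    if "formal_section A E U \<psi> UNIV f" "formal_section A E U \<psi> UNIV g" "x \<in> U \<alpha>" for f g \<alpha> n x
    unfolding lprod_def u_def by (rule section_star_eq[OF open_UNIV that(1,2) UNIV_I that(3)])
  ultimately show ?thesis using associated_star_product_bundle_star by blast
qed

end
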